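(* Let $k$ be an algebraically closed field of characteristic $0$. Let $a,b,c$ be positive integers with $\gcd(a,b,c)=1$, and let $e,f,g$ be positive integers with $\gcd(e,f,g)=1$ and $$ae+bf-cg=0.$$ Suppose that the following conditions are satisfied: (1) The number $$w=\frac{g^2c}{ab}$$ satisfies $w<1$. (2) Let $n$ be the number of integers $\delta\leq 0$ such that the vector $$(b,a)+\delta(e,-f)$$ has non-negative components, both divisible by $g$. Then there exist exactly $n$ integers $\gamma\geq 0$ such that $$(n-1)(b,a)+\gamma(e,-f)$$ has non-negative components, both divisible by $g$. Moreover, $n(b,a)\not\equiv(0,0)\pmod g$. Then the blowup $\operatorname{Bl}_{t_0}\mathbb{P}(a,b,c)$ of the weighted projective plane $\mathbb{P}(a,b,c)$ over $k$ at the identity point $t_0$ of its torus does not have a finitely generated Cox ring.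
   Context: The weighted projective plane $\mathbb{P}(a,b,c)$ is $\operatorname{Proj}k[x,y,z]$, where $x,y,z$ have degrees $a,b,c$ respectively; it is a toric surface and $t_0=[1:1:1]$ is the identity element of its torus. For a normal $\mathbb{Q}$-factorial projective variety $X$ over $k$ with finitely generated class group $\operatorname{Cl}(X)$, a Cox ring of $X$ is any multigraded $k$-algebra of the form $$R(X;D_1,\ldots,D_r)=\bigoplus_{(m_1,\ldots,m_r)\in\mathbb{Z}^r}H^0\big(X,\mathcal{O}_X(m_1D_1+\cdots+m_rD_r)\big),$$ where $D_1,\ldots,D_r$ are Weil divisors whose classes span $\operatorname{Cl}(X)\otimes\mathbb{Q}$. Finite generation of one Cox ring of $X$ (as a $k$-algebra) is equivalent to finite generation of every Cox ring of $X$; "$X$ does not have a finitely generated Cox ring" means that these algebras are not finitely generated over $k$. *)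

theory Defs
  imports "HOL-Algebra.Algebra" "HOL-Algebra.Algebraic_Closure_Type"
    "HOL-Computational_Algebra.Fraction_Field"
begin

text \<open>
  An integral separated scheme \<open>V\<close> of finite type over \<open>k\<close> is represented, following Zariski,
  Chevalley and Nagata, by the set of the local rings \<open>O_{V,p}\<close> of all its (not necessarily closed)
  points \<open>p\<close>, as subrings of the function field of \<open>V\<close>.  By separatedness distinct points have
  distinct local rings, so that a point may be identified with its local ring.  The ambient field
  \<open>'f\<close> is allowed to be larger than the function field.
\<close>

type_synonym 'f model = "'f set set"

abbreviation subring_of :: "'f::field set \<Rightarrow> 'f ring" where
  "subring_of A \<equiv> ring_of_type_algebra\<lparr>carrier := A\<rparr>"

text \<open>The local ring of the generic point is the function field, and it contains all others.\<close>

definition function_field :: "'f model \<Rightarrow> 'f set" where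
  "function_field V = \<Union>V"

text \<open>The non-units; used only for local rings \<open>A\<close>.\<close>

definition max_ideal :: "'f::field set \<Rightarrow> 'f set" where
  "max_ideal A = A - Units (subring_of A)"

definition localization :: "'f::field set \<Rightarrow> 'f set \<Rightarrow> 'f set" where
  "localization B Q = {r / s |r s. r \<in> B \<and> s \<in> B - Q}"


section \<open>Weil divisors, class group and Cox rings\<close>

text \<open>
  Prime divisors correspond to points of codimension one, that is to those local rings that have
  Krull dimension one: the zero ideal and the maximal ideal are their only prime ideals.
\<close>

definition prime_divisors :: "'f::field model \<Rightarrow> 'f set set" where
  "prime_divisors V = {A \<in> V. card {P. primeideal P (subring_of A)} = 2}"

text \<open>
  The order of vanishing of a nonzero rational function along a prime divisor.  On a normal variety
  the local ring \<open>A\<close> of the divisor is a discrete valuation ring with uniformizer \<open>\<pi>\<close>.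
\<close>

definition ord_along :: "'f::field set \<Rightarrow> 'f \<Rightarrow> int" where
  "ord_along A h = (THE n. \<exists>\<pi>\<in>A. \<exists>u\<in>Units (subring_of A).
     max_ideal A = cgenideal (subring_of A) \<pi> \<and> h = u * \<pi> powi n)"

abbreviation weil_divisors :: "'f::field model \<Rightarrow> ('f set \<Rightarrow>\<^sub>0 int) monoid" where
  "weil_divisors V \<equiv> free_Abelian_group (prime_divisors V)"

definition principal_divisors :: "'f::field model \<Rightarrow> ('f set \<Rightarrow>\<^sub>0 int) set" where
  "principal_divisors V = {D \<in> carrier (weil_divisors V).
     \<exists>h \<in> function_field V - {0}.
       \<forall>A \<in> prime_divisors V. Poly_Mapping.lookup D A = ord_along A h}"

definition class_group :: "'f::field model \<Rightarrow> ('f set \<Rightarrow>\<^sub>0 int) set monoid" where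
  "class_group V = weil_divisors V Mod principal_divisors V"

definition divisor_class :: "'f::field model \<Rightarrow> ('f set \<Rightarrow>\<^sub>0 int) \<Rightarrow> ('f set \<Rightarrow>\<^sub>0 int) set" where
  "divisor_class V D = principal_divisors V #>\<^bsub>weil_divisors V\<^esub> D"

text \<open>
  A set of classes spans \<open>Cl(V) \<otimes> \<rat>\<close> iff every class has a positive multiple in the subgroup
  generated by that set.
\<close>

definition span_class_group :: "'f::field model \<Rightarrow> ('f set \<Rightarrow>\<^sub>0 int) list \<Rightarrow> bool" where
  "span_class_group V Ds \<longleftrightarrow> (\<forall>C \<in> carrier (class_group V). \<exists>N::nat. N > 0 \<and>
     C [^]\<^bsub>class_group V\<^esub> N \<in> generate (class_group V) (divisor_class V ` set Ds))"

text \<open>\<open>H\<^sup>0(V, O_V(D))\<close>; the zero section has no order of vanishing.\<close>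

definition sections :: "'f::field model \<Rightarrow> ('f set \<Rightarrow>\<^sub>0 int) \<Rightarrow> 'f set" where
  "sections V D = {h \<in> function_field V.
     h = 0 \<or> (\<forall>A \<in> prime_divisors V. ord_along A h + Poly_Mapping.lookup D A \<ge> 0)}"

text \<open>
  The algebra \<open>R(V; D_1, \<dots>, D_r)\<close> as a subring of the group algebra of \<open>\<int>\<^sup>r\<close> (Laurent polynomials
  in \<open>r\<close> variables) over the ambient field: the section in multidegree \<open>m\<close> is the coefficient at
  \<open>m\<close>.  Multidegrees \<open>m\<close> are finitely supported functions vanishing outside of \<open>{..<r}\<close>.
\<close>

definition cox_ring ::
  "'f::field model \<Rightarrow> ('f set \<Rightarrow>\<^sub>0 int) list \<Rightarrow> ((nat \<Rightarrow>\<^sub>0 int) \<Rightarrow>\<^sub>0 'f) set" where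
  "cox_ring V Ds = {F. \<forall>m \<in> Poly_Mapping.keys F. Poly_Mapping.keys m \<subseteq> {..<length Ds} \<and>
     Poly_Mapping.lookup F m \<in>
       sections V (\<Sum>i<length Ds. frag_cmul (Poly_Mapping.lookup m i) (Ds ! i))}"

text \<open>\<open>k\<close> is the ground field, as a subfield of the ambient field.\<close>

definition finitely_generated_algebra ::
  "'f::field set \<Rightarrow> ((nat \<Rightarrow>\<^sub>0 int) \<Rightarrow>\<^sub>0 'f) set \<Rightarrow> bool" where
  "finitely_generated_algebra k R \<longleftrightarrow> (\<exists>G. finite G \<and> G \<subseteq> R \<and>
     generate_ring ring_of_type_algebra (Poly_Mapping.single 0 ` k \<union> G) = R)"

definition has_fg_cox_ring :: "'f::field set \<Rightarrow> 'f model \<Rightarrow> bool" where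
  "has_fg_cox_ring k V \<longleftrightarrow> (\<exists>Ds. set Ds \<subseteq> carrier (weil_divisors V) \<and> span_class_group V Ds \<and>
     finitely_generated_algebra k (cox_ring V Ds))"


section \<open>Blowing up a closed point\<close>

text \<open>
  Let \<open>A\<close> be the local ring of the closed point \<open>p\<close> and \<open>m\<close> its maximal ideal.  The blowup is an
  isomorphism away from \<open>p\<close>.  The points over \<open>p\<close> are those points of the blowup
  \<open>Proj (\<Oplus>\<^sub>n m\<^sup>n)\<close> of \<open>Spec A\<close> that lie over \<open>m\<close>.  This scheme is covered by the
  affine charts \<open>Spec A[m/f]\<close> with \<open>0 \<noteq> f \<in> m\<close>.
\<close>

definition blowup_chart :: "'f::field set \<Rightarrow> 'f \<Rightarrow> 'f set" where
  "blowup_chart A f = generate_ring ring_of_type_algebra (A \<union> {h / f |h. h \<in> max_ideal A})"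

definition blowup :: "'f::field model \<Rightarrow> 'f set \<Rightarrow> 'f model" where
  "blowup V A = (V - {A}) \<union>
     {localization (blowup_chart A f) Q |f Q. f \<in> max_ideal A - {0} \<and>
        primeideal Q (subring_of (blowup_chart A f)) \<and> max_ideal A \<subseteq> Q}"


section \<open>Weighted projective planes\<close>

text \<open>
  \<open>k[x,y,z]\<close> is the iterated polynomial ring \<open>k[x][y][z]\<close>.  The function field of
  \<open>\<P>(a,b,c)\<close> is the subfield of degree zero elements of its field of fractions.
\<close>

type_synonym 'k poly3 = "'k poly poly poly"

definition homogeneous :: "nat \<Rightarrow> nat \<Rightarrow> nat \<Rightarrow> nat \<Rightarrow> 'k::field poly3 \<Rightarrow> bool" where
  "homogeneous a b c d F \<longleftrightarrow>
     (\<forall>i j l. poly.coeff (poly.coeff (poly.coeff F l) j) i \<noteq> 0 \<longrightarrow> a * i + b * j + c * l = d)"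

definition eval3 :: "'k::field poly3 \<Rightarrow> 'k \<Rightarrow> 'k \<Rightarrow> 'k \<Rightarrow> 'k" where
  "eval3 F x y z = poly (poly (poly F [:[:z:]:]) [:y:]) x"

definition irrelevant_ideal :: "nat \<Rightarrow> nat \<Rightarrow> nat \<Rightarrow> 'k::field poly3 set" where
  "irrelevant_ideal a b c = genideal ring_of_type_algebra {F. \<exists>d>0. homogeneous a b c d F}"

definition proj_points :: "nat \<Rightarrow> nat \<Rightarrow> nat \<Rightarrow> 'k::field poly3 set set" where
  "proj_points a b c = {P. primeideal P ring_of_type_algebra \<and>
     P = genideal ring_of_type_algebra {F \<in> P. \<exists>d. homogeneous a b c d F} \<and>
     \<not> irrelevant_ideal a b c \<subseteq> P}"

definition proj_local_ring ::
  "nat \<Rightarrow> nat \<Rightarrow> nat \<Rightarrow> 'k::field poly3 set \<Rightarrow> 'k poly3 fract set" where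
  "proj_local_ring a b c P =
     {Fract F G |F G d. homogeneous a b c d F \<and> homogeneous a b c d G \<and> G \<notin> P}"

definition weighted_proj_plane :: "nat \<Rightarrow> nat \<Rightarrow> nat \<Rightarrow> 'k::field poly3 fract model" where
  "weighted_proj_plane a b c = proj_local_ring a b c ` proj_points a b c"

text \<open>A polynomial lies in the ideal of \<open>[x:y:z]\<close> iff all its homogeneous parts vanish at \<open>(x,y,z)\<close>.\<close>

definition point_ideal ::
  "nat \<Rightarrow> nat \<Rightarrow> nat \<Rightarrow> 'k::field \<Rightarrow> 'k \<Rightarrow> 'k \<Rightarrow> 'k poly3 set" where
  "point_ideal a b c x y z =
     genideal ring_of_type_algebra {F. (\<exists>d. homogeneous a b c d F) \<and> eval3 F x y z = 0}"

definition wpp_point ::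
  "nat \<Rightarrow> nat \<Rightarrow> nat \<Rightarrow> 'k::field \<Rightarrow> 'k \<Rightarrow> 'k \<Rightarrow> 'k poly3 fract set" where
  "wpp_point a b c x y z = proj_local_ring a b c (point_ideal a b c x y z)"

definition scalars :: "'k::field poly3 fract set" where
  "scalars = range (\<lambda>u. Fract [:[:[:u:]:]:] 1)"

end

theory Submission
  imports Defs "Berlekamp_Zassenhaus.Unique_Factorization_Poly"
begin

text \<open>
  The prime divisors of the blowup are the exceptional curve and the curves cut out by irreducible
  homogeneous polynomials.  Multiplication by a product of their equations therefore identifies
  \<open>H\<^sup>0(D)\<close> with the space of homogeneous polynomials \<open>P\<close> of a degree \<open>\<delta>(D)\<close> whose multiplicity
  at \<open>(1,1,1)\<close> is at least \<open>\<mu>(D)\<close>, where \<open>\<delta>\<close> and \<open>\<mu>\<close> are additive and vanish on principal divisors.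

  Evaluation of \<open>P\<close> at \<open>(0,1,0)\<close> is multiplicative and additive.  In a finitely generated Cox ring the
  multidegrees of the sections that do not vanish there thus lie in the cone over finitely many of
  them.  Condition (2) implies \<open>g \<delta> > a b \<mu>\<close> for such sections with \<open>\<mu> > 0\<close>: a power of \<open>P\<close> would
  otherwise have degree \<open>a b s\<close> and multiplicity at least \<open>g s\<close>, and a linear combination of its
  vanishing derivatives at \<open>(1,1,1)\<close> isolates the coefficient of \<open>y\<^sup>a\<^sup>s\<close>.  Hence
  \<open>\<mu> \<le> C (g \<delta> - a b \<mu>)\<close> on the cone.  On the other hand, since \<open>w < 1\<close>, interpolation on the lattice
  points of a triangle yields for all \<open>m < g s\<close> a polynomial of degree \<open>a b s\<close> and multiplicity at
  least \<open>m\<close> with value 1 at \<open>(0,1,0)\<close>.  Among these, \<open>g \<delta> - a b \<mu>\<close> stays bounded while \<open>\<mu>\<close> does not.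
\<close>

section \<open>Polynomial functions of two coordinates\<close>

text \<open>The numbers come from the curve \<open>x^e y^f = z^g\<close>. It has degree
  \<open>c g\<close> and multiplicity 1 at (1,1,1), so its strict transform has self-intersection
  \<open>w - 1 < 0\<close>, and it passes through (0,1,0). The number
  \<open>g \<delta> - a b \<mu>\<close> is \<open>a b\<close> times the intersection number with
  this strict transform. If the Cox ring were finitely generated, the edge
  \<open>g \<delta> = a b \<mu>\<close> of the nef cone would contain a class without base points,
  hence one with a section that is nonzero at (0,1,0). The proof turns this into linear algebra on
  exponents: a column of the triangle consists of monomials that differ by powers of
  \<open>z^g / (x^e y^f)\<close>, and only the corner is nonzero at (0,1,0). The obstacle in between
  is the definition of divisors as local rings: before a section becomes a polynomial, all points of
  codimension one on the blowup have to be found and their valuations computed.\<close>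

inductive polyfun :: "('p \<Rightarrow> 'k) \<Rightarrow> ('p \<Rightarrow> 'k) \<Rightarrow> nat \<Rightarrow> ('p \<Rightarrow> 'k::comm_ring_1) \<Rightarrow> bool"
  for U W where
  const: "polyfun U W n (\<lambda>_. u)"
| add: "polyfun U W n h \<Longrightarrow> polyfun U W n h' \<Longrightarrow> polyfun U W n (\<lambda>p. h p + h' p)"
| times_U: "polyfun U W n h \<Longrightarrow> polyfun U W (Suc n) (\<lambda>p. U p * h p)"
| times_W: "polyfun U W n h \<Longrightarrow> polyfun U W (Suc n) (\<lambda>p. W p * h p)"
| Suc: "polyfun U W n h \<Longrightarrow> polyfun U W (Suc n) h"

lemma polyfun_mono: "polyfun U W n h \<Longrightarrow> n \<le> m \<Longrightarrow> polyfun U W m h"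
  by (rule dec_induct[where P = "\<lambda>m. polyfun U W m h"]) (auto intro: polyfun.Suc)

lemma polyfun_scale:
  assumes "polyfun U W n h"
  shows "polyfun U W n (\<lambda>p. u * h p)"
  using assms
proof (induction rule: polyfun.induct)
  case (const n w)
  show ?case using polyfun.const[of U W n "u * w"] by simp
next
  case (add n h h')
  show ?case using polyfun.add[OF add.IH] by (simp add: algebra_simps)
next
  case (times_U n h)
  show ?case using polyfun.times_U[OF times_U.IH] by (simp add: algebra_simps)
next
  case (times_W n h)
  show ?case using polyfun.times_W[OF times_W.IH] by (simp add: algebra_simps)
qed (rule polyfun.Suc)

lemma polyfun_diff:
  assumes "polyfun U W n h" "polyfun U W n h'"
  shows "polyfun U W n (\<lambda>p. h p - h' p)"
  using polyfun.add[OF assms(1) polyfun_scale[OF assms(2), of "-1"]] by simp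

lemma polyfun_mult:
  assumes "polyfun U W n h" "polyfun U W m h'"
  shows "polyfun U W (n + m) (\<lambda>p. h p * h' p)"
  using assms(1)
proof (induction rule: polyfun.induct)
  case (const n w)
  show ?case using polyfun_mono[OF polyfun_scale[OF assms(2), of w], of "n + m"] by simp
next
  case (add n h h')
  show ?case using polyfun.add[OF add.IH] by (simp add: algebra_simps)
next
  case (times_U n h)
  show ?case using polyfun.times_U[OF times_U.IH] by (simp add: algebra_simps)
next
  case (times_W n h)
  show ?case using polyfun.times_W[OF times_W.IH] by (simp add: algebra_simps)
next
  case (Suc n h)
  show ?case using polyfun.Suc[OF Suc.IH] by simp
qed

lemma polyfun_coord:
  "polyfun U W 1 U" "polyfun U W 1 W"
  using polyfun.times_U[OF polyfun.const[of U W 0 1]] polyfun.times_W[OF polyfun.const[of U W 0 1]]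
  by simp_all

lemma polyfun_sum:
  assumes "\<And>i. i \<in> A \<Longrightarrow> polyfun U W n (h i)"
  shows "polyfun U W n (\<lambda>p. \<Sum>i\<in>A. h i p)"
  using assms
proof (induction A rule: infinite_finite_induct)
  case (insert x F)
  then show ?case by (auto intro!: polyfun.add)
qed (auto intro: polyfun.const)

lemma polyfun_prod:
  assumes "finite A" "\<And>i. i \<in> A \<Longrightarrow> polyfun U W 1 (h i)"
  shows "polyfun U W (card A) (\<lambda>p. \<Prod>i\<in>A. h i p)"
  using assms
proof (induction A rule: finite_induct)
  case (insert x F)
  have "polyfun U W (1 + card F) (\<lambda>p. h x p * (\<Prod>i\<in>F. h i p))"
    using insert by (intro polyfun_mult) auto
  then show ?case using insert by simp
qed (auto intro: polyfun.const)

lemma polyfun_gbinomial: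
  fixes h :: "'p \<Rightarrow> 'k::field_char_0"
  assumes "polyfun U W 1 h"
  shows "polyfun U W n (\<lambda>p. h p gchoose n)"
proof -
  have "polyfun U W (card {0..<n}) (\<lambda>p. \<Prod>i\<in>{0..<n}. h p - of_nat i)"
    using assms by (intro polyfun_prod polyfun_diff polyfun.const) auto
  from polyfun_scale[OF this, of "inverse (fact n)"] show ?thesis
    by (simp add: gbinomial_prod_rev field_simps)
qed

text \<open>Division by \<open>U - x\<close>, with a remainder that depends on \<open>W\<close>
  only. The disjunction about \<open>h0\<close> replaces the bound \<open>n - 1\<close> on its
  degree, so that for \<open>n = 0\<close> the quotient has to be 0.\<close>

lemma polyfun_split:
  fixes U W :: "'p \<Rightarrow> 'k::idom"
  assumes "polyfun U W n h"
  shows "\<exists>q h0. degree q \<le> n \<and> (\<forall>p. h p = poly q (W p) + (U p - x) * h0 p) \<and>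
    (h0 = (\<lambda>_. 0) \<or> (\<exists>n'. n = Suc n' \<and> polyfun U W n' h0))"
  using assms
proof (induction rule: polyfun.induct)
  case (const n u)
  show ?case by (rule exI[of _ "[:u:]"], rule exI[of _ "\<lambda>_. 0"]) simp
next
  case (add n h h')
  then obtain q1 h1 q2 h2 where
    1: "degree q1 \<le> n" "\<forall>p. h p = poly q1 (W p) + (U p - x) * h1 p"
      "h1 = (\<lambda>_. 0) \<or> (\<exists>n'. n = Suc n' \<and> polyfun U W n' h1)" and
    2: "degree q2 \<le> n" "\<forall>p. h' p = poly q2 (W p) + (U p - x) * h2 p"
      "h2 = (\<lambda>_. 0) \<or> (\<exists>n'. n = Suc n' \<and> polyfun U W n' h2)"
    by (elim exE conjE) (rule that; assumption)
  have "(\<lambda>p. h1 p + h2 p) = (\<lambda>_. 0) \<or> (\<exists>n'. n = Suc n' \<and> polyfun U W n' (\<lambda>p. h1 p + h2 p))"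
    using 1(3) 2(3) by (auto intro: polyfun.add)
  moreover have "h p + h' p = poly (q1 + q2) (W p) + (U p - x) * (h1 p + h2 p)" for p
    using 1(2)[rule_format, of p] 2(2)[rule_format, of p] by (simp add: ring_distribs)
  ultimately show ?case using 1(1) 2(1)
    by (intro exI[of _ "q1 + q2"] exI[of _ "\<lambda>p. h1 p + h2 p"]) (auto simp: degree_add_le)
next
  case (times_U n h)
  then obtain q h1 where
    1: "degree q \<le> n" "\<forall>p. h p = poly q (W p) + (U p - x) * h1 p"
      "h1 = (\<lambda>_. 0) \<or> (\<exists>n'. n = Suc n' \<and> polyfun U W n' h1)"
    by (elim exE conjE) (rule that; assumption)
  have "polyfun U W n (\<lambda>p. x * h1 p)"
    using 1(3) by (auto intro: polyfun_scale polyfun.const polyfun.Suc)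
  then have "polyfun U W n (\<lambda>p. h p + x * h1 p)"
    by (rule polyfun.add[OF times_U.hyps])
  moreover have "U p * h p = poly (smult x q) (W p) + (U p - x) * (h p + x * h1 p)" for p
    using 1(2)[rule_format, of p] by (simp add: ring_distribs)
  ultimately show ?case
    using 1 by (intro exI[of _ "smult x q"] exI[of _ "\<lambda>p. h p + x * h1 p"]) auto
next
  case (times_W n h)
  then obtain q h1 where
    1: "degree q \<le> n" "\<forall>p. h p = poly q (W p) + (U p - x) * h1 p"
      "h1 = (\<lambda>_. 0) \<or> (\<exists>n'. n = Suc n' \<and> polyfun U W n' h1)"
    by (elim exE conjE) (rule that; assumption)
  have "(\<lambda>p. W p * h1 p) = (\<lambda>_. 0) \<or> polyfun U W n (\<lambda>p. W p * h1 p)"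
    using 1(3) by (auto intro: polyfun.times_W)
  moreover have "W p * h p = poly (pCons 0 q) (W p) + (U p - x) * (W p * h1 p)" for p
    using 1(2)[rule_format, of p] by (simp add: ring_distribs)
  ultimately show ?case using 1(1)
    by (intro exI[of _ "pCons 0 q"] exI[of _ "\<lambda>p. W p * h1 p"])
      (auto intro: degree_pCons_le[THEN order_trans])
next
  case (Suc n h)
  then obtain q h1 where
    1: "degree q \<le> n" "\<forall>p. h p = poly q (W p) + (U p - x) * h1 p"
      "h1 = (\<lambda>_. 0) \<or> (\<exists>n'. n = Suc n' \<and> polyfun U W n' h1)"
    by (elim exE conjE) (rule that; assumption)
  then show ?case by (intro exI[of _ q] exI[of _ h1]) (auto intro: polyfun.Suc)
qed

text \<open>Used to pass from column and row to the exponents \<open>i\<close> and \<open>j\<close>,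
  of which they are affine functions. As \<open>polyfun\<close> speaks of functions on an arbitrary
  index type, the change of coordinates is an induction and not a substitution into
  polynomials.\<close>

lemma polyfun_change_coord:
  assumes "polyfun U' W' n h" "polyfun U W 1 U'" "polyfun U W 1 W'"
  shows "polyfun U W n h"
  using assms(1)
proof (induction rule: polyfun.induct)
  case (times_U n h)
  then show ?case using polyfun_mult[OF assms(2) times_U.IH] by simp
next
  case (times_W n h)
  then show ?case using polyfun_mult[OF assms(3) times_W.IH] by simp
qed (auto intro: polyfun.intros)

text \<open>The weights are the values of the Lagrange basis polynomials. They are chosen before
  \<open>q\<close>, because the functional that is built from them has to serve all test functions
  at once.\<close>

lemma lagrange_weights:
  fixes W :: "'p \<Rightarrow> 'k::field"
  assumes "finite C" "inj_on W C"
  shows "\<exists>L. \<forall>q y. degree q < card C \<longrightarrow> poly q y = (\<Sum>p\<in>C. L p y * poly q (W p))"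
proof -
  define l where "l p = (\<Prod>p'\<in>C - {p}. smult (inverse (W p - W p')) [:- W p', 1:])" for p
  have deg: "degree (l p) \<le> card C - 1" if "p \<in> C" for p
  proof -
    have "degree (l p) \<le> (\<Sum>p'\<in>C - {p}. degree (smult (inverse (W p - W p')) [:- W p', 1:]))"
      unfolding l_def using assms(1) by (intro degree_prod_sum_le[unfolded o_def]) simp
    also have "\<dots> \<le> (\<Sum>p'\<in>C - {p}. 1)"
      by (intro sum_mono) (use degree_smult_le in auto)
    also have "\<dots> = card C - 1" using that assms by simp
    finally show ?thesis .
  qed
  have val: "poly (l p) (W p') = (if p' = p then 1 else 0)" if "p \<in> C" "p' \<in> C" for p p'
  proof (cases "p' = p")
    case True
    have "W p - W p'' \<noteq> 0" if "p'' \<in> C - {p}" for p''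
      using inj_onD[OF assms(2), of p p''] that \<open>p \<in> C\<close> by auto
    moreover have "poly (smult (inverse (W p - W k)) [:- W k, 1:]) (W p) =
        inverse (W p - W k) * (W p - W k)" for k
      unfolding poly_smult by simp
    ultimately show ?thesis using True unfolding l_def poly_prod by (auto intro!: prod.neutral)
  next
    case False
    then show ?thesis using that assms(1) by (auto simp: l_def poly_prod intro!: prod_zero bexI[of _ p'])
  qed
  have "poly q y = (\<Sum>p\<in>C. poly (l p) y * poly q (W p))" if q: "degree q < card C" for q y
  proof -
    define q' where "q' = (\<Sum>p\<in>C. smult (poly q (W p)) (l p))"
    have "degree q' \<le> card C - 1" unfolding q'_def
      by (intro degree_sum_le) (use assms deg degree_smult_le order_trans in blast)+
    then have "degree q' < card C" using q by linarith
    moreover have "poly q' y = poly q y" if "y \<in> W ` C" for y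
    proof -
      from that obtain p where p: "p \<in> C" "y = W p" by auto
      have "poly q' y = (\<Sum>p'\<in>C. if p = p' then poly q (W p') else 0)"
        unfolding q'_def p(2) poly_sum by (intro sum.cong) (auto simp: val p)
      also have "\<dots> = poly q y" using p assms(1) by simp
      finally show ?thesis .
    qed
    ultimately have "q' = q"
      using q assms by (intro poly_eqI_degree[of "W ` C"]) (auto simp: card_image)
    then have "poly q y = poly q' y" by simp
    also have "\<dots> = (\<Sum>p\<in>C. poly (l p) y * poly q (W p))"
      by (simp add: q'_def poly_sum mult.commute)
    finally show ?thesis .
  qed
  then show ?thesis by (intro exI[of _ "\<lambda>p. poly (l p)"]) blast
qed

text \<open>
  By induction on the number of columns: a polynomial function of degree \<open>n\<close> is a polynomial in \<open>W\<close> of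
  degree at most \<open>n\<close> plus \<open>U - x (Suc m)\<close> times a polynomial function of degree \<open>n - 1\<close>.  The first summand
  is determined on the last column and the second one vanishes there.
\<close>

lemma interpolation_on_columns:
  fixes U W :: "'p \<Rightarrow> 'k::field"
  assumes C: "\<And>k. k \<in> {1..m} \<Longrightarrow> finite (C k) \<and> card (C k) = k \<and> inj_on W (C k)"
    and U: "\<And>k p. k \<in> {1..m} \<Longrightarrow> p \<in> C k \<Longrightarrow> U p = x k"
    and x: "inj_on x {1..m}"
  shows "\<exists>\<alpha>. \<forall>n h. n < m \<longrightarrow> polyfun U W n h \<longrightarrow> (\<Sum>p\<in>(\<Union>k\<in>{1..m}. C k). \<alpha> p * h p) = h R"
  using assms
proof (induction m)
  case 0
  then show ?case by simp
next
  case (Suc m)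
  define T where "T = (\<Union>k\<in>{1..m}. C k)"
  define x0 where "x0 = x (Suc m)"
  have "\<exists>\<alpha>. \<forall>n h. n < m \<longrightarrow> polyfun U W n h \<longrightarrow> (\<Sum>p\<in>(\<Union>k\<in>{1..m}. C k). \<alpha> p * h p) = h R"
    by (rule Suc.IH) (use Suc.prems in \<open>auto intro: inj_on_subset\<close>)
  then obtain \<alpha>' where \<alpha>': "\<And>n h. n < m \<Longrightarrow> polyfun U W n h \<Longrightarrow> (\<Sum>p\<in>T. \<alpha>' p * h p) = h R"
    unfolding T_def by blast
  have fin: "finite T" "finite (C (Suc m))" and cardC: "card (C (Suc m)) = Suc m"
    and injC: "inj_on W (C (Suc m))"
    using Suc.prems(1) by (auto simp: T_def)
  have UT: "U p \<noteq> x0" if "p \<in> T" for p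
  proof -
    from that obtain k where k: "k \<in> {1..m}" "p \<in> C k" by (auto simp: T_def)
    then have "U p = x k" using Suc.prems(2) by auto
    moreover have "x k \<noteq> x (Suc m)" using inj_onD[OF Suc.prems(3), of k "Suc m"] k by auto
    ultimately show ?thesis by (simp add: x0_def)
  qed
  have UC: "U p = x0" if "p \<in> C (Suc m)" for p using Suc.prems(2) that by (auto simp: x0_def)
  have disj: "T \<inter> C (Suc m) = {}" using UT UC by blast
  \<comment> \<open>Dividing by \<open>U p - x0\<close> turns weights that evaluate
    \<open>h1\<close> at \<open>R\<close> into weights that evaluate \<open>(U - x0) * h1\<close> at
    \<open>R\<close>. One column less suffices for \<open>h1\<close>, since its degree is one
    less.\<close>
  define \<alpha> where "\<alpha> p = (U R - x0) * \<alpha>' p / (U p - x0)" for p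
  obtain L where L: "\<And>q y. degree q < Suc m \<Longrightarrow> poly q y = (\<Sum>p\<in>C (Suc m). L p y * poly q (W p))"
    using lagrange_weights[OF fin(2) injC] cardC by auto
  \<comment> \<open>On the new column \<open>h\<close> equals \<open>q\<close> of \<open>W\<close>.
    The weights there have to yield the value of \<open>q\<close> at \<open>W R\<close> and to undo
    what \<open>q\<close> contributes through the old columns.\<close>
  define \<beta> where "\<beta> p = L p (W R) - (\<Sum>p'\<in>T. \<alpha> p' * L p (W p'))" for p
  define \<gamma> where "\<gamma> p = (if p \<in> T then \<alpha> p else \<beta> p)" for p
  have "(\<Sum>p\<in>T \<union> C (Suc m). \<gamma> p * h p) = h R" if n: "n < Suc m" and h: "polyfun U W n h" for n h
  proof -
    obtain q h1 where q: "degree q \<le> n" "\<forall>p. h p = poly q (W p) + (U p - x0) * h1 p"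
      "h1 = (\<lambda>_. 0) \<or> (\<exists>n'. n = Suc n' \<and> polyfun U W n' h1)"
      using polyfun_split[OF h, of x0] by (elim exE conjE) (rule that; assumption)
    have 1: "(\<Sum>p\<in>T. \<alpha>' p * h1 p) = h1 R" using q(3) \<alpha>' n by auto
    have "(\<Sum>p\<in>T. \<alpha> p * h p) = (\<Sum>p\<in>T. \<alpha> p * poly q (W p) + (U R - x0) * (\<alpha>' p * h1 p))"
      using UT by (intro sum.cong) (auto simp: \<alpha>_def q(2) field_simps)
    also have "\<dots> = (\<Sum>p\<in>T. \<alpha> p * poly q (W p)) + (U R - x0) * h1 R"
      by (simp add: sum.distrib sum_distrib_left[symmetric] 1)
    finally have 2: "(\<Sum>p\<in>T. \<alpha> p * h p) = (\<Sum>p\<in>T. \<alpha> p * poly q (W p)) + (U R - x0) * h1 R" .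
    have "(\<Sum>p\<in>C (Suc m). \<beta> p * h p) = (\<Sum>p\<in>C (Suc m). \<beta> p * poly q (W p))"
      by (intro sum.cong) (auto simp: q(2) UC)
    also have "\<dots> = (\<Sum>p\<in>C (Suc m). L p (W R) * poly q (W p)) -
        (\<Sum>p\<in>C (Suc m). \<Sum>p'\<in>T. \<alpha> p' * (L p (W p') * poly q (W p)))"
      by (simp add: \<beta>_def left_diff_distrib sum_subtractf sum_distrib_right mult.assoc)
    also have "(\<Sum>p\<in>C (Suc m). \<Sum>p'\<in>T. \<alpha> p' * (L p (W p') * poly q (W p))) =
        (\<Sum>p'\<in>T. \<alpha> p' * poly q (W p'))"
      using q(1) n by (subst sum.swap) (simp add: sum_distrib_left[symmetric] L[of q, symmetric])
    also have "(\<Sum>p\<in>C (Suc m). L p (W R) * poly q (W p)) = poly q (W R)"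
      using q(1) n by (intro L[symmetric]) simp
    finally have 3: "(\<Sum>p\<in>C (Suc m). \<beta> p * h p) = poly q (W R) - (\<Sum>p'\<in>T. \<alpha> p' * poly q (W p'))" .
    have "(\<Sum>p\<in>T \<union> C (Suc m). \<gamma> p * h p) = (\<Sum>p\<in>T. \<gamma> p * h p) + (\<Sum>p\<in>C (Suc m). \<gamma> p * h p)"
      by (rule sum.union_disjoint) (use fin disj in auto)
    also have "(\<Sum>p\<in>T. \<gamma> p * h p) = (\<Sum>p\<in>T. \<alpha> p * h p)" by (intro sum.cong) (auto simp: \<gamma>_def)
    also have "(\<Sum>p\<in>C (Suc m). \<gamma> p * h p) = (\<Sum>p\<in>C (Suc m). \<beta> p * h p)"
      by (intro sum.cong) (use disj in \<open>auto simp: \<gamma>_def\<close>)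
    finally show ?thesis using 2 3 q(2)[rule_format, of R] by simp
  qed
  moreover have "(\<Union>k\<in>{1..Suc m}. C k) = T \<union> C (Suc m)"
    by (auto simp: T_def atLeastAtMostSuc_conv)
  ultimately show ?case by (intro exI[of _ \<gamma>]) auto
qed

text \<open>Products of binomial coefficients span the polynomial functions:
  \<open>i * (i choose p)\<close> is a combination of \<open>i choose Suc p\<close> and
  \<open>i choose p\<close>. The moments are the Taylor coefficients at (1,1,1) that involve no
  derivative in \<open>z\<close>; among monomials of a fixed degree, \<open>l\<close> is an affine
  function of \<open>i\<close> and \<open>j\<close>.\<close>

lemma moments_imp_orthogonal:
  fixes \<alpha> :: "nat \<times> nat \<times> nat \<Rightarrow> 'k::comm_ring_1"
  assumes "\<And>p q. p + q < m \<Longrightarrow>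
      (\<Sum>(i,j,l)\<in>A. \<alpha> (i,j,l) * of_nat (i choose p) * of_nat (j choose q)) = 0"
    and "polyfun (\<lambda>(i,j,l). of_nat i) (\<lambda>(i,j,l). of_nat j) n h" "n < m"
  shows "(\<Sum>P\<in>A. \<alpha> P * h P) = 0"
proof -
  have choose: "of_nat i * of_nat (i choose p) =
      (of_nat (Suc p) * of_nat (i choose Suc p) + of_nat p * of_nat (i choose p) :: 'k)" for i p
  proof -
    have "i * (i choose p) = Suc p * (i choose Suc p) + p * (i choose p)"
    proof (cases "p \<le> i")
      case True
      then have "Suc p * (i choose Suc p) = (i - p) * (i choose p)"
        by (metis binomial_absorb_comp binomial_absorption mult.commute)
      then show ?thesis using True by (simp add: algebra_simps)
    qed (simp add: binomial_eq_0)
    then show ?thesis by (metis of_nat_add of_nat_mult)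
  qed
  \<comment> \<open>The binomial factors are carried along in the induction, so that multiplication
    by a coordinate only raises \<open>p\<close> or \<open>q\<close> by at most one.\<close>
  have "n + p + q < m \<longrightarrow>
      (\<Sum>(i,j,l)\<in>A. \<alpha> (i,j,l) * h (i,j,l) * of_nat (i choose p) * of_nat (j choose q)) = 0" for p q
    using assms(2)
  proof (induction arbitrary: p q rule: polyfun.induct)
    case (const n u)
    have "(\<Sum>(i,j,l)\<in>A. \<alpha> (i,j,l) * u * of_nat (i choose p) * of_nat (j choose q)) =
        u * (\<Sum>(i,j,l)\<in>A. \<alpha> (i,j,l) * of_nat (i choose p) * of_nat (j choose q))"
      by (simp add: sum_distrib_left case_prod_unfold algebra_simps)
    then show ?case using assms(1)[of p q] by auto
  next
    case (add n h h')
    show ?case using add.IH(1)[of p q] add.IH(2)[of p q]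
      by (auto simp: case_prod_unfold ring_distribs sum.distrib)
  next
    case (times_U n h)
    have "\<alpha> (i,j,l) * (of_nat i * h (i,j,l)) * of_nat (i choose p) * of_nat (j choose q) =
       of_nat (Suc p) * (\<alpha> (i,j,l) * h (i,j,l) * of_nat (i choose Suc p) * of_nat (j choose q)) +
       of_nat p * (\<alpha> (i,j,l) * h (i,j,l) * of_nat (i choose p) * of_nat (j choose q))" for i j l
    proof -
      have "\<alpha> (i,j,l) * (of_nat i * h (i,j,l)) * of_nat (i choose p) * of_nat (j choose q) =
        \<alpha> (i,j,l) * h (i,j,l) * (of_nat i * of_nat (i choose p)) * of_nat (j choose q)"
        by (simp add: ac_simps)
      then show ?thesis unfolding choose by (simp only: ring_distribs ac_simps)
    qed
    then show ?case using times_U.IH[of "Suc p" q] times_U.IH[of p q]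
      by (auto simp: case_prod_unfold sum.distrib sum_distrib_left[symmetric] simp del: of_nat_Suc)
  next
    case (times_W n h)
    have "\<alpha> (i,j,l) * (of_nat j * h (i,j,l)) * of_nat (i choose p) * of_nat (j choose q) =
       of_nat (Suc q) * (\<alpha> (i,j,l) * h (i,j,l) * of_nat (i choose p) * of_nat (j choose Suc q)) +
       of_nat q * (\<alpha> (i,j,l) * h (i,j,l) * of_nat (i choose p) * of_nat (j choose q))" for i j l
    proof -
      have "\<alpha> (i,j,l) * (of_nat j * h (i,j,l)) * of_nat (i choose p) * of_nat (j choose q) =
        \<alpha> (i,j,l) * h (i,j,l) * of_nat (i choose p) * (of_nat j * of_nat (j choose q))"
        by (simp add: ac_simps)
      then show ?thesis unfolding choose by (simp only: ring_distribs ac_simps)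
    qed
    then show ?case using times_W.IH[of p "Suc q"] times_W.IH[of p q]
      by (auto simp: case_prod_unfold sum.distrib sum_distrib_left[symmetric] simp del: of_nat_Suc)
  next
    case (Suc n h)
    then show ?case by simp
  qed
  from this[of 0 0] assms(3) show ?thesis by (simp add: case_prod_unfold)
qed

section \<open>Lattice points of the triangles\<close>

lemma dvd_of_gcd3:
  fixes e f g x :: int
  assumes "gcd e (gcd f g) = 1" "g dvd e * x" "g dvd f * x"
  shows "g dvd x"
proof -
  have "g dvd gcd (e * x) (gcd (f * x) (g * x))" using assms by simp
  also have "gcd (e * x) (gcd (f * x) (g * x)) = \<bar>x\<bar>"
    using assms(1) by (simp add: gcd_mult_right gcd_mult_left abs_mult gcd.commute)
  finally show ?thesis by simp
qed

locale relation_data =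
  fixes a b c e f g :: int
  assumes pos: "a > 0" "b > 0" "c > 0" "e > 0" "f > 0" "g > 0"
    and gcd_abc: "gcd a (gcd b c) = 1"
    and gcd_efg: "gcd e (gcd f g) = 1"
    and relation: "a * e + b * f = c * g"

text \<open>
  The exponents \<open>(i,j,l)\<close> of degree \<open>a b s\<close> form a triangle with columns \<open>J = 0, ..., g s\<close>, in which
  \<open>l = t J + g r\<close>.  The column \<open>J = g s\<close> consists of the corner \<open>(0, a s, 0)\<close> only.
\<close>

locale slope_data = relation_data +
  fixes t :: int
  assumes t_b: "g dvd b + e * t" and t_a: "g dvd a - f * t"
begin

text \<open>Integrality is the point. By the relation, \<open>c\<close> divides both
  \<open>a X\<close> and \<open>b X\<close> for the numerator \<open>X\<close> of \<open>J\<close>,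
  hence \<open>X\<close> itself because \<open>gcd a (gcd b c) = 1\<close>. In the same way
  \<open>gcd_efg\<close> makes \<open>l - t * J\<close> a multiple of \<open>g\<close>.\<close>

lemma column_row:
  fixes i j l s :: int
  assumes deg: "a * i + b * j + c * l = a * b * s"
  obtains J r where "c * J = f * (b * s - i) + e * j" "a * J = f * l + g * j"
    "b * (g * s - J) = g * i + e * l" "l = t * J + g * r"
proof -
  have "a * (f * (b * s - i) + e * j) - c * (f * l + g * j) =
      f * (a * b * s - (a * i + b * j + c * l)) + j * (a * e + b * f - c * g)"
    by (simp add: algebra_simps)
  then have aJ: "a * (f * (b * s - i) + e * j) = c * (f * l + g * j)"
    using deg relation by simp
  have "b * (f * (b * s - i) + e * j) - c * (b * (g * s) - (g * i + e * l)) =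
      e * (a * i + b * j + c * l - a * b * s) + (b * s - i) * (a * e + b * f - c * g)"
    by (simp add: algebra_simps)
  then have bJ: "b * (f * (b * s - i) + e * j) = c * (b * (g * s) - (g * i + e * l))"
    using deg relation by simp
  have "c dvd f * (b * s - i) + e * j"
    using dvd_of_gcd3[of a b c "f * (b * s - i) + e * j"] gcd_abc aJ bJ by simp
  then obtain J where J: "f * (b * s - i) + e * j = c * J" by blast
  have "c * (a * J) = c * (f * l + g * j)"
    using aJ unfolding J by (simp add: ac_simps)
  then have aJ: "a * J = f * l + g * j" using pos by simp
  have "c * (b * J) = c * (b * (g * s) - (g * i + e * l))"
    using bJ unfolding J by (simp only: ac_simps)
  then have "b * J = b * (g * s) - (g * i + e * l)" using pos by simp
  then have bJ: "b * (g * s - J) = g * i + e * l" by (simp add: algebra_simps)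
  have "e * (l - t * J) = g * (b * s - i) - (b + e * t) * J" using bJ by (simp add: algebra_simps)
  then have "g dvd e * (l - t * J)" using t_b by simp
  moreover have "f * (l - t * J) = (a - f * t) * J - g * j" using aJ by (simp add: algebra_simps)
  then have "g dvd f * (l - t * J)" using t_a by simp
  ultimately have "g dvd l - t * J" using dvd_of_gcd3[OF gcd_efg] by blast
  then obtain r where "l - t * J = g * r" by blast
  then have "l = t * J + g * r" by simp
  with J aJ bJ show ?thesis using that[of J r] by simp
qed

end

text \<open>The form in which high multiplicity is used: the coefficients are orthogonal to every
  function of column and row of degree below \<open>g s\<close>. Over the field, column and row are
  affine functions \<open>U\<close>, \<open>W\<close> of the exponents; that they are integers at
  the points of \<open>A\<close> allows \<open>h\<close> to be evaluated there by counting
  arguments.\<close>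

lemma vanishing_test:
  fixes \<alpha> :: "nat \<times> nat \<times> nat \<Rightarrow> 'k::field_char_0" and s :: nat
  assumes data: "slope_data a b c e f g t" and fin: "finite A"
    and deg: "\<And>i j l. (i,j,l) \<in> A \<Longrightarrow> a * int i + b * int j + c * int l = a * b * int s"
    and moments: "\<And>p q. int (p + q) < g * int s \<Longrightarrow>
      (\<Sum>(i,j,l)\<in>A. \<alpha> (i,j,l) * of_nat (i choose p) * of_nat (j choose q)) = 0"
    and N: "int N < g * int s"
    and h: "\<And>U W. polyfun U W N (\<lambda>P::nat \<times> nat \<times> nat. h (U P) (W P))"
    and w: "\<And>i j l J r. (i,j,l) \<in> A \<Longrightarrow> a * J = f * int l + g * int j \<Longrightarrow>
       b * (g * int s - J) = g * int i + e * int l \<Longrightarrow> int l = t * J + g * r \<Longrightarrow>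
       h (of_int J) (of_int r) = w (i,j,l)"
  shows "(\<Sum>P\<in>A. \<alpha> P * w P) = 0"
proof -
  interpret slope_data a b c e f g t by fact
  define U :: "nat \<times> nat \<times> nat \<Rightarrow> 'k" where
    "U = (\<lambda>(i,j,l). (of_int (f * b * int s) - of_int f * of_nat i + of_int e * of_nat j) / of_int c)"
  define W :: "nat \<times> nat \<times> nat \<Rightarrow> 'k" where
    "W = (\<lambda>(i,j,l). ((of_int (a * b * int s) - of_int a * of_nat i - of_int b * of_nat j) / of_int c
        - of_int t * U (i,j,l)) / of_int g)"
  let ?I = "\<lambda>(i,j,l). of_nat i :: 'k" and ?J = "\<lambda>(i,j,l). of_nat j :: 'k"
  have 1: "polyfun ?I ?J 1 (\<lambda>(i,j,l). (u + v * of_nat i + v' * of_nat j))" for u v v' :: 'k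
  proof -
    have "polyfun ?I ?J 1 (\<lambda>P. u + v * ?I P + v' * ?J P)"
      by (intro polyfun.add polyfun.const polyfun_scale polyfun_coord)
    then show ?thesis by (simp add: case_prod_unfold)
  qed
  have U: "polyfun ?I ?J 1 U"
    using polyfun_scale[OF 1[of "of_int (f * b * int s)" "- of_int f" "of_int e"], of "inverse (of_int c)"]
    unfolding U_def by (simp add: case_prod_unfold field_simps)
  have W: "polyfun ?I ?J 1 W"
    using polyfun_scale[OF polyfun_diff[OF
        polyfun_scale[OF 1[of "of_int (a * b * int s)" "- of_int a" "- of_int b"], of "inverse (of_int c)"]
        polyfun_scale[OF U, of "of_int t"]], of "inverse (of_int g)"]
    unfolding W_def by (simp add: case_prod_unfold divide_inverse algebra_simps)
  have "polyfun ?I ?J N (\<lambda>P. h (U P) (W P))"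
    by (rule polyfun_change_coord[OF h U W])
  then have "(\<Sum>P\<in>A. \<alpha> P * h (U P) (W P)) = 0"
    using moments N by (intro moments_imp_orthogonal[where m = "nat (g * int s)" and n = N]) (auto simp: zless_nat_eq_int_zless)
  moreover have "h (U P) (W P) = w P" if "P \<in> A" for P
  proof -
    obtain i j l where P: "P = (i,j,l)" by (cases P)
    have d: "a * int i + b * int j + c * int l = a * b * int s" using deg that P by blast
    then obtain J r where J: "c * J = f * (b * int s - int i) + e * int j" "a * J = f * int l + g * int j"
      "b * (g * int s - J) = g * int i + e * int l" "int l = t * J + g * r"
      using column_row by blast
    have c: "of_int c \<noteq> (0::'k)" "of_int g \<noteq> (0::'k)" using pos by auto
    have "(of_int (f * b * int s) - of_int f * of_nat i + of_int e * of_nat j :: 'k) = of_int (c * J)"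
      unfolding J(1) by (simp add: algebra_simps)
    then have U: "U P = of_int J" using c by (simp add: U_def P)
    have "(of_int (a * b * int s) - of_int a * of_nat i - of_int b * of_nat j :: 'k) =
        of_int (a * b * int s - a * int i - b * int j)"
      by simp
    also have "a * b * int s - a * int i - b * int j = c * int l" using d by linarith
    finally have "W P = (of_int (int l) - of_int t * of_int J) / of_int g"
      using c U by (simp add: W_def P)
    also have "\<dots> = of_int r" unfolding J(4) using c by simp
    finally show ?thesis using w[OF _ J(2-4)] U P that by simp
  qed
  ultimately show ?thesis by simp
qed

text \<open>Both counts in condition (2) concern lattice points in columns. Writing
  \<open>\<delta> = t - g x\<close> turns the first set into the \<open>x \<ge> 1\<close> with
  \<open>e (g x - t) \<le> b\<close>, which bounds the column next to the corner. Writing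
  \<open>\<gamma> = t (n - 1) + g r\<close> turns the second one into rows \<open>r\<close> with
  \<open>0 \<le> l\<close> and \<open>f l \<le> a J\<close> in the column \<open>J = n - 1\<close>.
  The last assumption says that \<open>g\<close> does not divide \<open>n t\<close>, in particular
  \<open>t \<noteq> 0\<close>.\<close>

lemma (in relation_data) column_counts:
  fixes n :: nat
  assumes n_def: "n = card {\<delta>::int. \<delta> \<le> 0 \<and> b + \<delta> * e \<ge> 0 \<and> a - \<delta> * f \<ge> 0 \<and>
          g dvd b + \<delta> * e \<and> g dvd a - \<delta> * f}" (is "n = card ?R")
    and exactly_n: "card {\<gamma>::int. \<gamma> \<ge> 0 \<and> (int n - 1) * b + \<gamma> * e \<ge> 0 \<and> (int n - 1) * a - \<gamma> * f \<ge> 0 \<and>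
          g dvd (int n - 1) * b + \<gamma> * e \<and> g dvd (int n - 1) * a - \<gamma> * f} = n" (is "card ?L = n")
    and not_cong: "\<not> (g dvd n * b \<and> g dvd n * a)"
  obtains t where "0 < t" "t < g" "slope_data a b c e f g t" "n \<ge> 1" "\<not> g dvd int n * t"
    "\<forall>x. e * (g * x - t) \<le> b \<longrightarrow> x \<le> int n"
    "n = 1 \<or> f * (t + g) \<le> a \<longrightarrow>
       t * (int n - 1) < g \<and> (int n - 1) * a < f * (t * (int n - 1) + g * int n)"
proof -
  have n: "n \<ge> 1" using not_cong by (cases "n = 0") auto
  define R where "R = ?R"
  define L where "L = ?L"
  have cardR: "card R = n" unfolding R_def by (rule n_def[symmetric])
  have cardL: "card L = n" unfolding L_def by (rule exactly_n)
  have finR: "finite R" by (rule card_ge_0_finite) (use n cardR in linarith)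
  have finL: "finite L" by (rule card_ge_0_finite) (use n cardL in linarith)
  have "R \<noteq> {}" using cardR n by auto
  then obtain \<delta> where \<delta>: "\<delta> \<in> R" by blast
  define t where "t = \<delta> mod g"
  have t0: "0 \<le> t" "t < g" using pos by (auto simp: t_def)
  have "\<delta> = t + g * (\<delta> div g)" by (simp add: t_def)
  then obtain u where u: "\<delta> = t + g * u" by blast
  have "b + \<delta> * e = b + e * t + g * (u * e)" "a - \<delta> * f = (a - f * t) - g * (u * f)"
    unfolding u by (simp_all add: algebra_simps)
  then have "b + e * t = (b + \<delta> * e) - g * (u * e)" "a - f * t = (a - \<delta> * f) + g * (u * f)"
    by linarith+
  moreover have "g dvd b + \<delta> * e" "g dvd a - \<delta> * f" using \<delta> unfolding R_def by auto
  ultimately have tb: "g dvd b + e * t" and ta: "g dvd a - f * t" by (simp_all only: dvd_add dvd_diff dvd_triv_left)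
  have sd: "slope_data a b c e f g t" by unfold_locales (use tb ta in auto)
  have ngt: "\<not> g dvd int n * t"
  proof
    assume *: "g dvd int n * t"
    have "int n * b = int n * (b + e * t) - e * (int n * t)"
      "int n * a = int n * (a - f * t) + f * (int n * t)" by (simp_all add: algebra_simps)
    then have "g dvd n * b \<and> g dvd n * a" using * tb ta by (simp add: dvd_add dvd_diff)
    then show False using not_cong by simp
  qed
  then have t: "0 < t" using t0(1) by (cases "t = 0") auto
  have right: "x \<le> int n" if "e * (g * x - t) \<le> b" for x
  proof -
    have "(\<lambda>x. t - g * x) ` {1..x} \<subseteq> R"
    proof (unfold R_def, clarify)
      fix x' assume x': "x' \<in> {1..x}"
      have "g * 1 \<le> g * x'" using x' pos by (intro mult_left_mono) auto
      then have "t - g * x' \<le> 0" using t0(2) by linarith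
      moreover have "e * (g * x' - t) \<le> e * (g * x - t)" using x' pos by (intro mult_left_mono diff_right_mono) auto
      then have "b + (t - g * x') * e \<ge> 0" using that by (simp add: algebra_simps)
      moreover have "a - (t - g * x') * f \<ge> 0"
        using \<open>t - g * x' \<le> 0\<close> pos mult_nonpos_nonneg[of "t - g * x'" f] by linarith
      moreover have "b + (t - g * x') * e = (b + e * t) - g * (x' * e)"
        "a - (t - g * x') * f = (a - f * t) + g * (x' * f)" by (simp_all add: algebra_simps)
      then have "g dvd b + (t - g * x') * e" "g dvd a - (t - g * x') * f"
        using tb ta by (simp_all only: dvd_add dvd_diff dvd_triv_left)
      ultimately show "t - g * x' \<le> 0 \<and> b + (t - g * x') * e \<ge> 0 \<and> a - (t - g * x') * f \<ge> 0 \<and>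
          g dvd b + (t - g * x') * e \<and> g dvd a - (t - g * x') * f" by blast
    qed
    then have "card ((\<lambda>x. t - g * x) ` {1..x}) \<le> n" using card_mono[OF finR] unfolding cardR by blast
    moreover have "inj_on (\<lambda>x. t - g * x) {1..x}" using pos by (auto simp: inj_on_def)
    ultimately show ?thesis by (simp add: card_image)
  qed
  \<comment> \<open>If \<open>f (t + g) \<le> a\<close>, the rows 0, ..., n - 1 of the column
    \<open>J = n - 1\<close> belong to the set, and being \<open>n\<close> in number they exhaust
    it. Hence the rows -1 and \<open>n\<close> violate one of its inequalities. For
    \<open>n = 1\<close> the column is \<open>J = 0\<close>, and only row 0 fits.\<close>
  have left: "t * (int n - 1) < g \<and> (int n - 1) * a < f * (t * (int n - 1) + g * int n)"
    if asm: "n = 1 \<or> f * (t + g) \<le> a"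
  proof -
    let ?p = "\<lambda>x. t * (int n - 1) + g * x"
    have mem: "?p x \<in> L" if "?p x \<ge> 0" "f * ?p x \<le> (int n - 1) * a" for x
    proof -
      have "(int n - 1) * b + ?p x * e = (int n - 1) * (b + e * t) + g * (x * e)"
        "(int n - 1) * a - ?p x * f = (int n - 1) * (a - f * t) - g * (x * f)" by (simp_all add: algebra_simps)
      then have "g dvd (int n - 1) * b + ?p x * e" "g dvd (int n - 1) * a - ?p x * f" using tb ta by simp_all
      moreover have "(int n - 1) * b + ?p x * e \<ge> 0"
        using that(1) pos n by simp
      ultimately show ?thesis using that unfolding L_def by (simp add: mult.commute)
    qed
    have inj: "inj ?p" using pos by (auto simp: inj_def)
    have le: "f * ?p x \<le> (int n - 1) * a" if "x \<le> int n - 1" for x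
    proof (cases "n = 1")
      case True
      then show ?thesis using that pos by (simp add: mult_nonneg_nonpos)
    next
      case False
      have "g * x \<le> g * (int n - 1)" using that pos by simp
      then have "?p x \<le> (int n - 1) * (t + g)" by (simp add: algebra_simps)
      then have "f * ?p x \<le> f * ((int n - 1) * (t + g))" using pos by simp
      moreover have "f * ((int n - 1) * (t + g)) = (int n - 1) * (f * (t + g))" by (simp only: ac_simps)
      moreover have "(int n - 1) * (f * (t + g)) \<le> (int n - 1) * a"
        using asm False n by (intro mult_left_mono) auto
      ultimately show ?thesis by linarith
    qed
    have sub: "?p ` {0..int n - 1} \<subseteq> L"
    proof (rule image_subsetI, rule mem)
      fix x assume x: "x \<in> {0..int n - 1}"
      then show "?p x \<ge> 0" using t pos n by simp
      show "f * ?p x \<le> (int n - 1) * a" by (rule le) (use x in simp)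
    qed
    have "card (?p ` {0..int n - 1}) = n"
      using n by (simp add: card_image inj_on_subset[OF inj])
    then have eq: "?p ` {0..int n - 1} = L"
      using card_subset_eq[OF finL sub] cardL by simp
    have notin: "?p x \<notin> L" if "x \<notin> {0..int n - 1}" for x
    proof
      assume "?p x \<in> L"
      then have "?p x \<in> ?p ` {0..int n - 1}" using eq by simp
      then obtain y where "y \<in> {0..int n - 1}" "?p x = ?p y" by blast
      then show False using that injD[OF inj, of x y] by simp
    qed
    have "t * (int n - 1) < g"
    proof (rule ccontr)
      assume "\<not> ?thesis"
      then have "?p (- 1) \<in> L" using n by (intro mem le) auto
      then show False using notin[of "- 1"] by auto
    qed
    moreover have "(int n - 1) * a < f * (t * (int n - 1) + g * int n)"
    proof (rule ccontr)
      assume "\<not> ?thesis"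
      then have "?p (int n) \<in> L" using n t pos by (intro mem) auto
      then show False using notin[of "int n"] by auto
    qed
    ultimately show ?thesis ..
  qed
  show ?thesis by (rule that[OF t t0(2) sd n ngt]) (use right left in blast)+
qed

text \<open>This will be the value of the test function at the corner. Splitting the factor
  \<open>m - k\<close> leaves two convolutions: Vandermonde's identity gives
  \<open>-1 gchoose n\<close> for the first one and, after \<open>k\<close> is absorbed into the
  first binomial, \<open>-2 gchoose (n - 1)\<close> for the second one.\<close>

lemma vandermonde_alternating:
  fixes r m :: "'k::field_char_0"
  assumes "n \<ge> 1"
  shows "(\<Sum>k\<le>n. (m - of_nat k) * ((- r) gchoose k) * ((r - 1) gchoose (n - k))) =
    (- 1) ^ n * (m - r * of_nat n)"
proof -
  obtain n' where n': "n = Suc n'" using assms by (cases n) auto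
  have minus1: "(- 1 :: 'k) gchoose n = (- 1) ^ n"
    using gbinomial_minus[of "1::'k" n] by (simp add: gbinomial_of_nat_symmetric binomial_gbinomial[symmetric])
  have minus2: "(- 2 :: 'k) gchoose n' = (- 1) ^ n' * of_nat n"
  proof -
    have "(- 2 :: 'k) gchoose n' = (- 1) ^ n' * ((2 + of_nat n' - 1) gchoose n')"
      using gbinomial_minus[of "2::'k" n'] by simp
    also have "(2 + of_nat n' - 1 :: 'k) = of_nat (Suc n')" by simp
    also have "of_nat (Suc n') gchoose n' = (of_nat (Suc n' choose n') :: 'k)" by (rule binomial_gbinomial[symmetric])
    also have "Suc n' choose n' = n" using binomial_symmetric[of n' "Suc n'"] by (simp add: n')
    finally show ?thesis .
  qed
  have absorb: "of_nat (Suc k) * ((- r) gchoose Suc k) = - r * ((- r - 1) gchoose k)" for k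
    using gbinomial_absorption[of k "- r"] by simp
  have "(\<Sum>k\<le>n. of_nat k * ((- r) gchoose k) * ((r - 1) gchoose (n - k))) =
      (\<Sum>k\<le>n'. of_nat (Suc k) * ((- r) gchoose Suc k) * ((r - 1) gchoose (n' - k)))"
    unfolding n' by (simp add: sum.atMost_Suc_shift del: sum.atMost_Suc of_nat_Suc)
  also have "\<dots> = - r * (\<Sum>k\<le>n'. ((- r - 1) gchoose k) * ((r - 1) gchoose (n' - k)))"
    unfolding absorb by (simp add: sum_distrib_left mult.assoc)
  also have "\<dots> = - r * ((- 2) gchoose n')"
    by (subst gbinomial_Vandermonde[folded atMost_atLeast0]) simp
  finally have 2: "(\<Sum>k\<le>n. of_nat k * ((- r) gchoose k) * ((r - 1) gchoose (n - k))) = - r * ((- 2) gchoose n')" .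
  have "(\<Sum>k\<le>n. m * (((- r) gchoose k) * ((r - 1) gchoose (n - k)))) = m * (- 1) ^ n"
    by (simp only: sum_distrib_left[symmetric] gbinomial_Vandermonde[folded atMost_atLeast0]) (simp add: minus1)
  then have "(\<Sum>k\<le>n. (m - of_nat k) * ((- r) gchoose k) * ((r - 1) gchoose (n - k))) =
      m * (- 1) ^ n + r * ((- 2) gchoose n')"
    using 2 by (simp add: left_diff_distrib sum_subtractf mult.assoc)
  then show ?thesis unfolding minus2 n' by (simp add: algebra_simps)
qed

section \<open>Test functions that isolate the coefficient at the corner\<close>

lemma gbinomial_of_int_eq_0:
  assumes "0 \<le> r" "r < int k"
  shows "(of_int r :: 'k::field_char_0) gchoose k = 0"
proof -
  have "(of_int r :: 'k) = of_nat (nat r)" using assms by simp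
  moreover have "nat r choose k = 0" using assms by (intro binomial_eq_0) auto
  ultimately show ?thesis by (metis binomial_gbinomial of_nat_0)
qed

text \<open>A test function of degree below \<open>g s\<close> that vanishes at all exponents but
  the corner forces the coefficient there to be 0. Its shape depends on whether row 1 fits into
  column 1, that is on \<open>f (t + g) \<le> a\<close>: only then can the columns
  \<open>J < n\<close> have up to \<open>J + 1\<close> points.\<close>

lemma top_coefficient_vanishes:
  fixes \<alpha> :: "nat \<times> nat \<times> nat \<Rightarrow> 'k::field_char_0" and a b c e f g :: int and n s d :: nat
  assumes data: "relation_data a b c e f g"
    and n_def: "n = card {\<delta>::int. \<delta> \<le> 0 \<and> b + \<delta> * e \<ge> 0 \<and> a - \<delta> * f \<ge> 0 \<and>
          g dvd b + \<delta> * e \<and> g dvd a - \<delta> * f}"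
    and exactly_n: "card {\<gamma>::int. \<gamma> \<ge> 0 \<and> (int n - 1) * b + \<gamma> * e \<ge> 0 \<and> (int n - 1) * a - \<gamma> * f \<ge> 0 \<and>
          g dvd (int n - 1) * b + \<gamma> * e \<and> g dvd (int n - 1) * a - \<gamma> * f} = n"
    and not_cong: "\<not> (g dvd n * b \<and> g dvd n * a)"
    and fin: "finite A"
    and deg: "\<And>i j l. (i,j,l) \<in> A \<Longrightarrow> a * int i + b * int j + c * int l = a * b * int s"
    and moments: "\<And>p q. int (p + q) < g * int s \<Longrightarrow>
      (\<Sum>(i,j,l)\<in>A. \<alpha> (i,j,l) * of_nat (i choose p) * of_nat (j choose q)) = 0"
    and large: "int n < g * int s"
    and top: "(0, d, 0) \<in> A"
  shows "\<alpha> (0, d, 0) = 0"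
proof -
  interpret relation_data a b c e f g by fact
  obtain t where t: "0 < t" "t < g" and sd: "slope_data a b c e f g t" and n: "n \<ge> 1"
    and ngt: "\<not> g dvd int n * t" and right: "\<forall>x. e * (g * x - t) \<le> b \<longrightarrow> x \<le> int n"
    and left: "n = 1 \<or> f * (t + g) \<le> a \<longrightarrow>
       t * (int n - 1) < g \<and> (int n - 1) * a < f * (t * (int n - 1) + g * int n)"
    by (rule column_counts[OF n_def exactly_n not_cong])
  define m where "m = nat (g * int s)"
  have m: "int m = g * int s" "n < m" using large pos by (auto simp: m_def)
  \<comment> \<open>The corner has \<open>l = 0\<close> in the last column \<open>J = m\<close>, so
    that its row is \<open>- \<rho>\<close>.\<close>
  define \<rho> :: int where "\<rho> = t * int s"
  have s: "s > 0" using large pos by (cases "s = 0") auto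
  have range: "0 \<le> J \<and> J \<le> int m" if "a * J = f * int l + g * int j" "b * (g * int s - J) = g * int i + e * int l" for i j l J
  proof -
    have "0 \<le> a * J" "0 \<le> b * (int m - J)" using that pos m(1) by simp_all
    then show ?thesis using pos by (simp add: zero_le_mult_iff)
  qed
  have last: "(i,j,l) = (0,d,0) \<and> r = - \<rho>"
    if A: "(i,j,l) \<in> A" and J: "J = int m"
      and *: "b * (g * int s - J) = g * int i + e * int l" "int l = t * J + g * r" for i j l J r
  proof -
    have "g * int i + e * int l = 0" using * J m by simp
    moreover have "g * int i \<ge> 0" "e * int l \<ge> 0" using pos by auto
    ultimately have "g * int i = 0" "e * int l = 0" by linarith+
    then have il: "i = 0" "l = 0" using pos by auto
    then have "b * int j = b * int d" using deg[OF A] deg[OF top] by (simp only:)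
    then have "int j = int d" using pos by (simp only: mult_cancel_left) simp
    then have j: "j = d" by simp
    have "g * (\<rho> + r) = 0" using * J m il by (simp add: \<rho>_def algebra_simps)
    then show ?thesis using il j pos by simp
  qed
  show ?thesis
  proof (cases "n = 1 \<or> f * (t + g) \<le> a")
    case True
    note left = left[rule_format, OF True]
    \<comment> \<open>\<open>h\<close> vanishes on the triangle except at the corner: term by term if \<open>J < m - 1\<close>, and by
      Vandermonde's identity if \<open>J = m - 1\<close>, where this column has at most \<open>n\<close> points.\<close>
    define h :: "'k \<Rightarrow> 'k \<Rightarrow> 'k" where "h x y = (\<Sum>k\<le>n. (y gchoose k) *
        (((x - of_nat k) gchoose (m - 1 - k)) * ((of_int \<rho> - 1) gchoose (n - k))))" for x y
    define v :: 'k where "v = (- 1) ^ n * (of_nat m - of_int \<rho> * of_nat n)"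
    have "(\<Sum>P\<in>A. \<alpha> P * (if P = (0,d,0) then v else 0)) = 0"
    proof (rule vanishing_test[OF sd fin deg moments, where N = "m - 1" and h = h])
      show "int (m - 1) < g * int s" using m by linarith
      show "polyfun U W (m - 1) (\<lambda>P. h (U P) (W P))" for U W :: "nat \<times> nat \<times> nat \<Rightarrow> 'k"
        unfolding h_def
      proof (rule polyfun_sum)
        fix k assume "k \<in> {..n}"
        then have k: "k \<le> m - 1" using m by auto
        have "polyfun U W (k + (m - 1 - k + 0)) (\<lambda>P. (W P gchoose k) *
          (((U P - of_nat k) gchoose (m - 1 - k)) * ((of_int \<rho> - 1) gchoose (n - k))))"
          by (intro polyfun_mult polyfun_gbinomial polyfun_coord polyfun_diff polyfun.const)
        then show "polyfun U W (m - 1) (\<lambda>P. (W P gchoose k) *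
          (((U P - of_nat k) gchoose (m - 1 - k)) * ((of_int \<rho> - 1) gchoose (n - k))))"
          by (rule back_subst[where P = "\<lambda>N. polyfun U W N _"]) (use k in linarith)
      qed
    next
      fix i j l J r
      assume A: "(i,j,l) \<in> A" and aJ: "a * J = f * int l + g * int j"
        and bJ: "b * (g * int s - J) = g * int i + e * int l" and r: "int l = t * J + g * r"
      note J = range[OF aJ bJ]
      consider "J < int m - 1" | "J = int m - 1" | "J = int m" using J by linarith
      then show "h (of_int J) (of_int r) = (if (i,j,l) = (0,d,0) then v else 0)"
      proof cases
        case 1
        have "(of_int r gchoose k) * (((of_int J - of_nat k) gchoose (m - 1 - k)) *
            ((of_int \<rho> - 1) gchoose (n - k))) = (0 :: 'k)" if k: "k \<le> n" for k
        proof (cases "int k \<le> J")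
          case True
          have "(of_int (J - int k) :: 'k) gchoose (m - 1 - k) = 0"
            using True 1 m by (intro gbinomial_of_int_eq_0) auto
          then show ?thesis by simp
        next
          case False
          then have Jn: "J \<le> int n - 1" using k by linarith
          \<comment> \<open>In the columns \<open>J < n\<close> only the rows 0, ..., J occur, so
            that \<open>r gchoose k\<close> vanishes for \<open>k > J\<close>. A negative row would
            require \<open>t J \<ge> g\<close>.\<close>
          have "g * (- 1) < g * r"
          proof -
            have "t * J \<le> t * (int n - 1)" using Jn t by simp
            then show ?thesis using r left by linarith
          qed
          then have "0 \<le> r" using pos by (simp only: mult_less_cancel_left_pos)
          moreover have "r \<le> J"
          proof (rule ccontr)
            assume "\<not> r \<le> J"
            then have "g * (J + 1) \<le> g * r" using pos by simp
            then have "f * (t * J + g * (J + 1)) \<le> f * int l" using r pos by simp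
            moreover have "f * int l \<le> a * J" using aJ pos by simp
            \<comment> \<open>A point of column \<open>J\<close> in row \<open>J + 1\<close> or
              higher is moved \<open>n - 1 - J\<close> times by one column and one row. Each move
              adds \<open>t + g\<close> to \<open>l\<close> and respects the bound since
              \<open>f (t + g) \<le> a\<close>. It arrives in column \<open>n - 1\<close> at row
              \<open>n\<close> or higher, where \<open>left\<close> leaves no room.\<close>
            moreover have "(int n - 1 - J) * (f * (t + g)) \<le> (int n - 1 - J) * a"
            proof (cases "n = 1")
              case True
              then have "J = 0" using Jn J by simp
              then show ?thesis using True by simp
            next
              case False
              then show ?thesis using True Jn n by (intro mult_left_mono) auto
            qed
            moreover have "f * (t * J + g * (J + 1)) + (int n - 1 - J) * (f * (t + g)) =
                f * (t * (int n - 1) + g * int n)" by (simp add: algebra_simps)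
            moreover have "a * J + (int n - 1 - J) * a = (int n - 1) * a" by (simp add: algebra_simps)
            ultimately show False using left by linarith
          qed
          ultimately have "(of_int r :: 'k) gchoose k = 0" using False by (intro gbinomial_of_int_eq_0) auto
          then show ?thesis by simp
        qed
        then have "h (of_int J) (of_int r) = 0" unfolding h_def by (intro sum.neutral) auto
        moreover have "((i,j,l) = (0,d,0)) = False"
        proof (rule iffI)
          assume "(i,j,l) = (0,d,0)"
          then have "b * (g * int s - J) = 0" using bJ by simp
          then show False using 1 m pos by simp
        qed simp
        ultimately show ?thesis by (simp only: if_False)
      next
        case 2
        have "(of_int J - of_nat k :: 'k) gchoose (m - 1 - k) = 1" if "k \<le> n" for k
        proof -
          have "(of_int J - of_nat k :: 'k) = of_nat (m - 1 - k)"
          proof -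
            have "J - int k = int (m - 1 - k)" using 2 that m by linarith
            then show ?thesis by (metis of_int_diff of_int_of_nat_eq)
          qed
          then show ?thesis by (simp only: binomial_gbinomial[symmetric]) simp
        qed
        then have "h (of_int J) (of_int r) = (\<Sum>k\<le>n. (of_int r gchoose k) * ((of_int \<rho> - 1) gchoose (n - k)))"
          unfolding h_def by (intro sum.cong) auto
        also have "\<dots> = (of_int r + (of_int \<rho> - 1)) gchoose n"
          by (rule gbinomial_Vandermonde[folded atMost_atLeast0])
        also have "of_int r + (of_int \<rho> - 1) = (of_int (r + \<rho> - 1) :: 'k)" by simp
        also have "(of_int (r + \<rho> - 1) :: 'k) gchoose n = 0"
        proof (rule gbinomial_of_int_eq_0)
          \<comment> \<open>With \<open>x = r + \<rho>\<close> this reads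
            \<open>l = g x - t\<close>. Now \<open>l \<ge> 0\<close> and \<open>e l \<le> b\<close>
            put \<open>x - 1\<close> among 0, ..., n - 1, the roots of the binomial.\<close>
          have l: "int l = g * (r + \<rho>) - t" using r 2 m by (simp add: \<rho>_def algebra_simps)
          have "g * (r + \<rho>) > 0" using l t by linarith
          then show "0 \<le> r + \<rho> - 1" using pos by (simp add: zero_less_mult_iff)
          have "b = g * int i + e * int l" using bJ 2 m by (simp add: algebra_simps)
          then have "e * int l \<le> b" using pos by simp
          then have "r + \<rho> \<le> int n" using right[rule_format, of "r + \<rho>"] l by simp
          then show "r + \<rho> - 1 < int n" by simp
        qed
        finally have "h (of_int J) (of_int r) = 0" .
        moreover have "((i,j,l) = (0,d,0)) = False"
        proof (rule iffI)
          assume "(i,j,l) = (0,d,0)"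
          then have "b * (g * int s - J) = 0" using bJ by simp
          then show False using 2 m pos by simp
        qed simp
        ultimately show ?thesis by (simp only: if_False)
      next
        case 3
        note R = last[OF A 3 bJ r]
        have "((of_int J - of_nat k :: 'k) gchoose (m - 1 - k)) = of_nat m - of_nat k" if "k \<le> n" for k
        proof -
          have "(of_int J - of_nat k :: 'k) = of_nat (m - k)"
          proof -
            have "J - int k = int (m - k)" using 3 that m by linarith
            then show ?thesis by (metis of_int_diff of_int_of_nat_eq)
          qed
          then have "((of_int J - of_nat k :: 'k) gchoose (m - 1 - k)) = of_nat ((m - k) choose (m - 1 - k))"
            by (simp only: binomial_gbinomial[symmetric])
          moreover have "m - k = Suc (m - 1 - k)" using that m by simp
          then have "(m - k) choose (m - 1 - k) = m - k" by simp
          ultimately show ?thesis using that m by (simp add: of_nat_diff)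
        qed
        then have "h (of_int J) (of_int r) = (\<Sum>k\<le>n. (of_nat m - of_nat k) * ((- of_int \<rho>) gchoose k) *
            ((of_int \<rho> - 1) gchoose (n - k)))"
          unfolding h_def using R by (intro sum.cong) auto
        also have "\<dots> = v" unfolding v_def by (rule vandermonde_alternating[OF n])
        finally show ?thesis using R by simp
      qed
    qed
    moreover have "(\<Sum>P\<in>A. \<alpha> P * (if P = (0,d,0) then v else 0)) = \<alpha> (0,d,0) * v"
      using fin top by (simp add: if_distrib cong: if_cong)
    \<comment> \<open>Up to sign \<open>v\<close> is the integer \<open>s (g - n t)\<close>, which
      is nonzero because \<open>g\<close> does not divide \<open>n t\<close>; characteristic 0
      carries this over to the field.\<close>
    moreover have "v \<noteq> 0"
    proof
      assume "v = 0"
      then have "of_int (int m - \<rho> * int n) = (0::'k)" by (simp add: v_def)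
      then have "int m - \<rho> * int n = 0" by (simp only: of_int_eq_0_iff)
      then have "int s * (g - int n * t) = 0" using m by (simp add: \<rho>_def algebra_simps)
      then have "g = int n * t" using s by simp
      then show False using ngt by simp
    qed
    ultimately show ?thesis by simp
  next
    case False
    then have n2: "n \<ge> 2" and tg: "a < f * (t + g)" using n by auto
    \<comment> \<open>Here \<open>r = 0\<close> in the columns 0 and 1, so that a simpler test function suffices.\<close>
    define h :: "'k \<Rightarrow> 'k \<Rightarrow> 'k" where "h x y = y * ((x - 2) gchoose (m - 2))" for x y
    have "(\<Sum>P\<in>A. \<alpha> P * (if P = (0,d,0) then - of_int \<rho> else 0)) = 0"
    proof (rule vanishing_test[OF sd fin deg moments, where N = "1 + (m - 2)" and h = h])
      show "int (1 + (m - 2)) < g * int s" using m n2 by linarith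
      show "polyfun U W (1 + (m - 2)) (\<lambda>P. h (U P) (W P))" for U W :: "nat \<times> nat \<times> nat \<Rightarrow> 'k"
        unfolding h_def
        by (intro polyfun_mult polyfun_gbinomial polyfun_coord polyfun_diff polyfun.const)
    next
      fix i j l J r
      assume A: "(i,j,l) \<in> A" and aJ: "a * J = f * int l + g * int j"
        and bJ: "b * (g * int s - J) = g * int i + e * int l" and r: "int l = t * J + g * r"
      note J = range[OF aJ bJ]
      consider "J \<le> 1" | "2 \<le> J" "J < int m" | "J = int m" using J by linarith
      then show "h (of_int J) (of_int r) = (if (i,j,l) = (0,d,0) then - of_int \<rho> else 0)"
      proof cases
        case 1
        have gj: "g * int j \<ge> 0" using pos by simp
        have "r = 0"
        proof (cases "J = 0")
          case True
          then have "f * int l = 0" using aJ gj pos mult_nonneg_nonneg[of f "int l"] by (simp add: add_nonneg_eq_0_iff)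
          then show ?thesis using r True pos by simp
        next
          case False
          then have J1: "J = 1" using 1 J by linarith
          have "g * (- 1) < g * r" using r t J1 by simp
          then have "- 1 < r" using pos by (simp only: mult_less_cancel_left_pos)
          have "f * int l < f * (t + g)" using tg aJ J1 gj by simp
          then have "int l < t + g" using pos by (simp only: mult_less_cancel_left_pos)
          then have "g * r < g * 1" using r J1 by simp
          then have "r < 1" using pos by (simp only: mult_less_cancel_left_pos)
          then show ?thesis using \<open>- 1 < r\<close> by simp
        qed
        moreover have "((i,j,l) = (0,d,0)) = False"
        proof (rule iffI)
          assume "(i,j,l) = (0,d,0)"
          then have "b * (g * int s - J) = 0" using bJ by simp
          then show False using 1 m n2 pos by simp
        qed simp
        ultimately show ?thesis by (simp only: if_False) (simp add: h_def)
      next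
        case 2
        have "(of_int (J - 2) :: 'k) gchoose (m - 2) = 0"
          using 2 by (intro gbinomial_of_int_eq_0) auto
        moreover have "((i,j,l) = (0,d,0)) = False"
        proof (rule iffI)
          assume "(i,j,l) = (0,d,0)"
          then have "b * (g * int s - J) = 0" using bJ by simp
          then show False using 2 m pos by simp
        qed simp
        ultimately show ?thesis by (simp only: if_False) (simp add: h_def)
      next
        case 3
        note R = last[OF A 3 bJ r]
        have "J - 2 = int (m - 2)" using 3 m n2 by linarith
        then have "(of_int J - 2 :: 'k) = of_nat (m - 2)" by (metis of_int_diff of_int_numeral of_int_of_nat_eq)
        then have "(of_int J - 2 :: 'k) gchoose (m - 2) = 1"
          by (simp only: binomial_gbinomial[symmetric]) simp
        then show ?thesis using R by (simp add: h_def)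
      qed
    qed
    moreover have "(\<Sum>P\<in>A. \<alpha> P * (if P = (0,d,0) then - of_int \<rho> else 0)) = - \<alpha> (0,d,0) * of_int \<rho>"
      using fin top by (simp add: if_distrib cong: if_cong)
    moreover have "of_int \<rho> \<noteq> (0::'k)" using t s by (simp add: \<rho>_def)
    ultimately show ?thesis by simp
  qed
qed

section \<open>Interpolation of the corner from columns with enough lattice points\<close>

lemma greedy_choice:
  assumes "\<And>i. i < n \<Longrightarrow> finite (S i) \<and> card (S i) > i"
  shows "\<exists>x. inj_on x {..<n} \<and> (\<forall>i<n. x i \<in> S i)"
  using assms
proof (induction n)
  case (Suc n)
  then obtain x where x: "inj_on x {..<n}" "\<forall>i<n. x i \<in> S i" by fastforce
  have "card (x ` {..<n}) < card (S n)"
    using Suc.prems[of n] card_image[OF x(1)] by simp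
  then have "\<not> S n \<subseteq> x ` {..<n}" by (meson card_mono finite_imageI finite_lessThan leD)
  then obtain y where y: "y \<in> S n" "y \<notin> x ` {..<n}" by blast
  have "inj_on (x(n := y)) {..<Suc n}"
    using x(1) y(2) by (auto simp: inj_on_def lessThan_Suc)
  moreover have "\<forall>i<Suc n. (x(n := y)) i \<in> S i"
    using x(2) y(1) by (auto simp: less_Suc_eq)
  ultimately show ?case by blast
qed simp

text \<open>
  The inequalities for \<open>x k\<close> guarantee \<open>k\<close> lattice points in the column \<open>x k\<close>.  As \<open>w < 1\<close>, more than \<open>i\<close>
  columns satisfy them for \<open>k = m - i\<close>, so that distinct columns can be chosen greedily.
\<close>

lemma (in slope_data) choose_columns:
  fixes s m :: nat
  assumes w: "g * g * c < a * b" and m: "int m < g * int s"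
  obtains x :: "nat \<Rightarrow> int" where "inj_on x {1..m}"
    "\<And>k. k \<in> {1..m} \<Longrightarrow> int k * (f * g) \<le> a * x k \<and> int k * (e * g) \<le> b * (g * int s - x k)"
proof -
  define S where "S i = {J. int (m - i) * (f * g) \<le> a * J \<and> int (m - i) * (e * g) \<le> b * (g * int s - J)}" for i
  have "finite (S i) \<and> card (S i) > i" if i: "i < m" for i
  proof -
    define k where "k = int (m - i)"
    have k: "k \<ge> 1" using i by (simp add: k_def)
    \<comment> \<open>The ceilings of \<open>k f g / a\<close> and \<open>k e g / b\<close>,
      expressed by \<open>div\<close> of negated numbers. All columns from \<open>lo\<close> to
      \<open>g s - hi\<close> are admissible.\<close>
    define lo hi where "lo = - ((- (k * (f * g))) div a)" and "hi = - ((- (k * (e * g))) div b)"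
    have "- (k * (f * g)) = a * (- lo) + (- (k * (f * g))) mod a" by (simp add: lo_def)
    moreover have "(- (k * (f * g))) mod a \<ge> 0" "(- (k * (f * g))) mod a < a" using pos by simp_all
    ultimately have lo: "k * (f * g) \<le> a * lo" "a * lo < k * (f * g) + a" by linarith+
    have "- (k * (e * g)) = b * (- hi) + (- (k * (e * g))) mod b" by (simp add: hi_def)
    moreover have "(- (k * (e * g))) mod b \<ge> 0" "(- (k * (e * g))) mod b < b" using pos by simp_all
    ultimately have hi: "k * (e * g) \<le> b * hi" "b * hi < k * (e * g) + b" by linarith+
    have sub: "{lo..g * int s - hi} \<subseteq> S i"
    proof
      fix J assume J: "J \<in> {lo..g * int s - hi}"
      have "a * lo \<le> a * J" using J pos by simp
      then have 1: "k * (f * g) \<le> a * J" using lo by linarith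
      have "b * hi \<le> b * (g * int s - J)" using J pos by simp
      then have "k * (e * g) \<le> b * (g * int s - J)" using hi by linarith
      with 1 show "J \<in> S i" by (simp only: S_def k_def mem_Collect_eq)
    qed
    have "S i \<subseteq> {0..g * int s}"
    proof
      fix J assume "J \<in> S i"
      then have "k * (f * g) \<le> a * J" "k * (e * g) \<le> b * (g * int s - J)" by (auto simp: S_def k_def)
      moreover have "k * (f * g) \<ge> 0" "k * (e * g) \<ge> 0" using k pos by simp_all
      ultimately have "0 \<le> a * J" "0 \<le> b * (g * int s - J)" by linarith+
      then show "J \<in> {0..g * int s}" using pos by (simp add: zero_le_mult_iff)
    qed
    then have fin: "finite (S i)" by (rule finite_subset) simp
    have "b * (a * lo) < b * (k * (f * g) + a)" "a * (b * hi) < a * (k * (e * g) + b)"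
      using lo hi pos by simp_all
    then have "a * b * (lo + hi) < k * g * (a * e + b * f) + 2 * (a * b)"
      by (simp add: algebra_simps)
    also have "k * g * (a * e + b * f) = k * (g * g * c)" unfolding relation by simp
    finally have "a * b * (lo + hi) < k * (g * g * c) + 2 * (a * b)" .
    moreover have "k * (g * g * c) \<le> k * (a * b)" using w k by simp
    ultimately have "a * b * (lo + hi) < a * b * (k + 2)" by (simp add: algebra_simps)
    then have "lo + hi < k + 2" using pos by (simp add: mult_less_cancel_left_pos)
    \<comment> \<open>As \<open>w < 1\<close>, the two ceilings add up to at most
      \<open>k + 1\<close>. The interval thus has at least \<open>g s - k\<close> elements, and
      \<open>g s \<ge> m + 1\<close> makes this at least \<open>i + 1\<close>.\<close>
    then have "int i < g * int s - hi - lo + 1" using m i by (simp add: k_def)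
    then have "i < card {lo..g * int s - hi}" by simp
    also have "\<dots> \<le> card (S i)" by (rule card_mono[OF fin sub])
    finally show ?thesis using fin by blast
  qed
  from greedy_choice[of m S, OF this] obtain x where x: "inj_on x {..<m}" "\<forall>i<m. x i \<in> S i" by blast
  show ?thesis
  proof (rule that)
    have "inj_on (\<lambda>k. m - k) {1..m}" by (auto simp: inj_on_def)
    moreover have "(\<lambda>k. m - k) ` {1..m} \<subseteq> {..<m}" by auto
    ultimately show "inj_on (\<lambda>k. x (m - k)) {1..m}"
      using x(1) comp_inj_on[of "\<lambda>k. m - k" "{1..m}" x] inj_on_subset unfolding o_def by blast
    fix k assume "k \<in> {1..m}"
    then have "x (m - k) \<in> S (m - k)" "m - (m - k) = k" using x(2) by auto
    then show "int k * (f * g) \<le> a * x (m - k) \<and> int k * (e * g) \<le> b * (g * int s - x (m - k))"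
      by (simp add: S_def)
  qed
qed

text \<open>Points are written as \<open>(J, l)\<close>, and \<open>E\<close> recovers the exponents
  from them. A product of binomials in the exponents is a polynomial function of degree
  \<open>p + q + r\<close>, so weights that interpolate the value at the corner
  \<open>(g s, 0)\<close> reproduce the Taylor coefficients at (1,1,1) of the corner monomial below
  order \<open>m\<close>.\<close>

lemma (in slope_data) nonvanishing_combination:
  fixes s m d :: nat
  assumes w: "g * g * c < a * b" and m: "int m < g * int s" and d: "int d = a * int s"
  obtains T :: "(int \<times> int) set" and \<alpha> :: "int \<times> int \<Rightarrow> 'k::field_char_0"
    and E :: "int \<times> int \<Rightarrow> nat \<times> nat \<times> nat" where "finite T"
    "\<And>P i j l. P \<in> T \<Longrightarrow> E P = (i,j,l) \<Longrightarrow> a * int i + b * int j + c * int l = a * b * int s"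
    "\<And>P. P \<in> T \<Longrightarrow> E P \<noteq> (0,d,0)"
    "\<And>p q r. p + q + r < m \<Longrightarrow> (\<Sum>P\<in>T. \<alpha> P * (case E P of (i,j,l) \<Rightarrow>
       of_nat (i choose p) * of_nat (j choose q) * of_nat (l choose r))) =
       of_nat (0 choose p) * of_nat (d choose q) * of_nat (0 choose r)"
proof -
  obtain x where inj: "inj_on x {1..m}" and
    x: "\<And>k. k \<in> {1..m} \<Longrightarrow> int k * (f * g) \<le> a * x k \<and> int k * (e * g) \<le> b * (g * int s - x k)"
    using choose_columns[OF w m] by metis
  \<comment> \<open>Column \<open>x k\<close> takes the \<open>k\<close> smallest nonnegative
    \<open>l\<close> congruent to \<open>t * x k\<close> modulo \<open>g\<close>. They satisfy
    \<open>l \<le> g k\<close>, and with this bound the inequalities for \<open>x k\<close> keep the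
    exponents of \<open>x\<close> and \<open>y\<close> nonnegative.\<close>
  define C where "C k = (\<lambda>i. (x k, (t * x k) mod g + g * int i)) ` {..<k}" for k
  define T where "T = (\<Union>k\<in>{1..m}. C k)"
  define \<epsilon> where "\<epsilon> = (\<lambda>(J::int, l). (b * (g * int s - J) - e * l) div g)"
  define \<zeta> where "\<zeta> = (\<lambda>(J::int, l). (a * J - f * l) div g)"
  define E where "E P = (nat (\<epsilon> P), nat (\<zeta> P), nat (snd P))" for P
  define U W :: "int \<times> int \<Rightarrow> 'k" where "U = (\<lambda>P. of_int (fst P))" and "W = (\<lambda>P. of_int (snd P))"
  have g: "of_int g \<noteq> (0::'k)" "g \<noteq> 0" using pos by auto
  have props: "g * \<epsilon> P = b * (g * int s - fst P) - e * snd P \<and> g * \<zeta> P = a * fst P - f * snd P \<and>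
      snd P \<ge> 0 \<and> \<epsilon> P \<ge> 0 \<and> \<zeta> P \<ge> 0 \<and> (P \<in> T \<longrightarrow> fst P < g * int s)"
    if P: "P \<in> insert (g * int s, 0) T" for P
  proof (cases "P \<in> T")
    case True
    then obtain k i where k: "k \<in> {1..m}" "i < k" and P: "P = (x k, (t * x k) mod g + g * int i)"
      by (auto simp: T_def C_def)
    define l where "l = (t * x k) mod g + g * int i"
    have mod: "0 \<le> (t * x k) mod g" "(t * x k) mod g < g" using pos by simp_all
    have l0: "l \<ge> 0" unfolding l_def using mod pos by simp
    have "g * (int i + 1) \<le> g * int k" using k pos by simp
    then have lk: "l \<le> g * int k" using mod unfolding l_def by (simp add: algebra_simps)
    have "e * l \<le> e * (g * int k)" "f * l \<le> f * (g * int k)" using lk pos by simp_all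
    then have ge: "e * l \<le> b * (g * int s - x k)" "f * l \<le> a * x k" using x[OF k(1)] by (simp_all add: ac_simps)
    obtain y where "l = t * x k + g * y"
    proof
      show "l = t * x k + g * (int i - (t * x k) div g)"
        unfolding l_def minus_mult_div_eq_mod[symmetric] by (simp add: right_diff_distrib)
    qed
    then have "b * (g * int s - x k) - e * l = g * (b * int s - e * y) - (b + e * t) * x k"
      "a * x k - f * l = (a - f * t) * x k - g * (f * y)" by (simp_all add: algebra_simps)
    then have dvd: "g dvd b * (g * int s - x k) - e * l" "g dvd a * x k - f * l" using t_a t_b by simp_all
    have "int k * (e * g) > 0" using k pos by simp
    then have "0 < b * (g * int s - x k)" using x[OF k(1)] by linarith
    then have "x k < g * int s" using pos by (simp add: zero_less_mult_iff)
    then show ?thesis using P ge dvd l0 pos by (simp add: \<epsilon>_def \<zeta>_def l_def pos_imp_zdiv_nonneg_iff)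
  next
    case False
    then have P: "P = (g * int s, 0)" using that by simp
    have "a * (g * int s) div g = a * int s" using g(2) by (simp only: mult.left_commute[of a g]) simp
    then show ?thesis using pos False by (simp add: P \<epsilon>_def \<zeta>_def)
  qed
  have R: "E (g * int s, 0) = (0, d, 0)"
  proof -
    have "a * (g * int s) div g = int d" using g(2) d by (simp only: mult.left_commute[of a g]) simp
    then show ?thesis by (simp add: E_def \<epsilon>_def \<zeta>_def)
  qed
  have "\<exists>\<alpha>. \<forall>n h. n < m \<longrightarrow> polyfun U W n h \<longrightarrow> (\<Sum>P\<in>(\<Union>k\<in>{1..m}. C k). \<alpha> P * h P) = h (g * int s, 0)"
  proof (rule interpolation_on_columns)
    fix k assume k: "k \<in> {1..m}"
    have "inj_on (\<lambda>i. (x k, (t * x k) mod g + g * int i)) {..<k}" using g(2) by (auto simp: inj_on_def)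
    then have "card (C k) = k" unfolding C_def by (simp add: card_image)
    moreover have "inj_on W (C k)" by (auto simp: W_def C_def inj_on_def)
    ultimately show "finite (C k) \<and> card (C k) = k \<and> inj_on W (C k)" by (simp add: C_def)
    show "U P = of_int (x k)" if "P \<in> C k" for P using that by (auto simp: C_def U_def)
  next
    show "inj_on (\<lambda>k. of_int (x k) :: 'k) {1..m}" 
      by (rule inj_onI) (simp add: inj_onD[OF inj])
  qed
  then obtain \<alpha> where \<alpha>: "\<And>n h. n < m \<Longrightarrow> polyfun U W n h \<Longrightarrow> (\<Sum>P\<in>T. \<alpha> P * h P) = h (g * int s, 0)"
    unfolding T_def by blast
  show ?thesis
  proof (rule that)
    show "finite T" by (simp add: T_def C_def)
  next
    fix P i j l assume P: "P \<in> T" "E P = (i,j,l)"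
    have *: "g * \<epsilon> P = b * (g * int s - fst P) - e * snd P" "g * \<zeta> P = a * fst P - f * snd P"
      "snd P \<ge> 0" "\<epsilon> P \<ge> 0" "\<zeta> P \<ge> 0" using props[of P] P by simp_all
    then have ijl: "int i = \<epsilon> P" "int j = \<zeta> P" "int l = snd P" using P by (auto simp: E_def)
    have "g * (a * \<epsilon> P + b * \<zeta> P + c * snd P) = a * (g * \<epsilon> P) + b * (g * \<zeta> P) + (c * g) * snd P"
      by (simp add: algebra_simps)
    also have "\<dots> = g * (a * b * int s)" unfolding * relation[symmetric] by (simp add: algebra_simps)
    finally show "a * int i + b * int j + c * int l = a * b * int s" using g ijl by simp
  next
    fix P assume P: "P \<in> T"
    have *: "g * \<epsilon> P = b * (g * int s - fst P) - e * snd P" "snd P \<ge> 0" "\<epsilon> P \<ge> 0" "fst P < g * int s"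
      using props[of P] P by simp_all
    show "E P \<noteq> (0, d, 0)"
    proof
      assume "E P = (0, d, 0)"
      then have "\<epsilon> P = 0" "snd P = 0" using * by (auto simp: E_def)
      then have "b * (g * int s - fst P) = 0" using *(1) by simp
      then show False using *(4) pos by simp
    qed
  next
    fix p q r assume pqr: "p + q + r < m"
    define h where "h P = (((of_int b * (of_int (g * int s) - U P) - of_int e * W P) / of_int g) gchoose p) *
        (((of_int a * U P - of_int f * W P) / of_int g) gchoose q) * (W P gchoose r)" for P
    have aff: "polyfun U W 1 (\<lambda>P. (u * (v - U P) - u' * W P) / of_int g)"
      "polyfun U W 1 (\<lambda>P. (u * U P - u' * W P) / of_int g)" for u v u' :: 'k
      unfolding divide_inverse mult.commute[of _ "inverse _"]
      by (intro polyfun_diff polyfun_scale polyfun.const polyfun_coord)+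
    have "polyfun U W (p + q + r) h" unfolding h_def
      by (intro polyfun_mult polyfun_gbinomial polyfun_coord aff)
    then have "(\<Sum>P\<in>T. \<alpha> P * h P) = h (g * int s, 0)" using pqr by (intro \<alpha>) auto
    moreover have "h P = (case E P of (i,j,l) \<Rightarrow>
       of_nat (i choose p) * of_nat (j choose q) * of_nat (l choose r))"
      if P: "P \<in> insert (g * int s, 0) T" for P
    proof -
      have *: "g * \<epsilon> P = b * (g * int s - fst P) - e * snd P" "g * \<zeta> P = a * fst P - f * snd P"
        "snd P \<ge> 0" "\<epsilon> P \<ge> 0" "\<zeta> P \<ge> 0" using props[OF P] by simp_all
      have "of_int b * (of_int (g * int s) - U P) - of_int e * W P = (of_int (g * \<epsilon> P) :: 'k)"
        unfolding *(1) by (simp add: U_def W_def)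
      then have 1: "(of_int b * (of_int (g * int s) - U P) - of_int e * W P) / of_int g = (of_nat (nat (\<epsilon> P)) :: 'k)"
        using g *(4) by simp
      have "of_int a * U P - of_int f * W P = (of_int (g * \<zeta> P) :: 'k)"
        unfolding *(2) by (simp add: U_def W_def)
      then have 2: "(of_int a * U P - of_int f * W P) / of_int g = (of_nat (nat (\<zeta> P)) :: 'k)"
        using g *(5) by simp
      have 3: "W P = of_nat (nat (snd P))" using *(3) by (simp add: W_def)
      show ?thesis unfolding h_def 1 2 unfolding 3 by (simp add: E_def binomial_gbinomial)
    qed
    ultimately show "(\<Sum>P\<in>T. \<alpha> P * (case E P of (i,j,l) \<Rightarrow>
       of_nat (i choose p) * of_nat (j choose q) * of_nat (l choose r))) =
       of_nat (0 choose p) * of_nat (d choose q) * of_nat (0 choose r)"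
      using R by simp
  qed
qed

section \<open>Polynomials in three variables\<close>

definition cf :: "'k::comm_ring_1 poly poly poly \<Rightarrow> nat \<times> nat \<times> nat \<Rightarrow> 'k" where
  "cf F = (\<lambda>(i,j,l). coeff (coeff (coeff F l) j) i)"

definition mon :: "'k::comm_ring_1 \<Rightarrow> nat \<times> nat \<times> nat \<Rightarrow> 'k poly poly poly" where
  "mon u = (\<lambda>(i,j,l). monom (monom (monom u i) j) l)"

declare split_paired_All [simp del] split_paired_Ex [simp del]

definition supp :: "'k::comm_ring_1 poly poly poly \<Rightarrow> (nat \<times> nat \<times> nat) set" where
  "supp F = {P. cf F P \<noteq> 0}"

lemma cf_eqI: "(\<And>P. cf F P = cf G P) \<Longrightarrow> F = G"
  by (intro poly_eqI) (simp add: cf_def split_paired_all)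

lemma cf_0 [simp]: "cf 0 P = 0" and cf_add [simp]: "cf (F + G) P = cf F P + cf G P"
  and cf_diff [simp]: "cf (F - G) P = cf F P - cf G P" and cf_minus [simp]: "cf (- F) P = - cf F P"
  by (simp_all add: cf_def split: prod.split)

lemma cf_sum: "cf (\<Sum>i\<in>A. F i) P = (\<Sum>i\<in>A. cf (F i) P)"
  by (induction A rule: infinite_finite_induct) auto

lemma cf_mon [simp]: "cf (mon u P) Q = (if P = Q then u else 0)"
  by (auto simp: cf_def mon_def split: prod.split)

lemma mon_0 [simp]: "mon 0 P = 0"
  by (simp add: mon_def split: prod.split)

lemma mon_mult: "mon u (i,j,l) * mon v (i',j',l') = mon (u * v) (i+i',j+j',l+l')"
  by (simp add: mon_def mult_monom)

lemma mon_1 [simp]: "mon 1 (0,0,0) = 1"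
  by (simp add: mon_def monom_0)

lemma mon_const: "mon u (0,0,0) = [:[:[:u:]:]:]"
  by (simp add: mon_def monom_0)

lemma mon_power: "mon u (i,j,l) ^ n = mon (u ^ n) (n*i,n*j,n*l)"
  by (induction n) (simp_all add: mon_mult)

lemma finite_supp [simp]: "finite (supp F)"
proof -
  have "supp F \<subseteq> (\<Union>l\<in>{..degree F}. \<Union>j\<in>{..degree (coeff F l)}. \<Union>i\<in>{..degree (coeff (coeff F l) j)}. {(i,j,l)})"
  proof
    fix P assume P: "P \<in> supp F"
    obtain i j l where ijl: "P = (i,j,l)" by (cases P)
    have 1: "coeff (coeff (coeff F l) j) i \<noteq> 0" using P by (simp add: ijl supp_def cf_def)
    then have 2: "coeff (coeff F l) j \<noteq> 0" by auto
    then have 3: "coeff F l \<noteq> 0" by auto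
    show "P \<in> (\<Union>l\<in>{..degree F}. \<Union>j\<in>{..degree (coeff F l)}. \<Union>i\<in>{..degree (coeff (coeff F l) j)}. {(i,j,l)})"
      using le_degree[OF 1] le_degree[OF 2] le_degree[OF 3] by (simp add: ijl)
  qed
  then show ?thesis by (rule finite_subset) simp
qed

lemma sum_mon: "F = (\<Sum>P\<in>supp F. mon (cf F P) P)"
proof (rule cf_eqI)
  fix P
  have "cf (\<Sum>Q\<in>supp F. mon (cf F Q) Q) P = (\<Sum>Q\<in>supp F. if Q = P then cf F Q else 0)"
    by (simp add: cf_sum)
  also have "\<dots> = (if P \<in> supp F then cf F P else 0)" by simp
  finally show "cf F P = cf (\<Sum>Q\<in>supp F. mon (cf F Q) Q) P" by (simp add: supp_def)
qed

lemma sum_mon_superset: "finite A \<Longrightarrow> supp F \<subseteq> A \<Longrightarrow> F = (\<Sum>P\<in>A. mon (cf F P) P)"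
  by (subst sum_mon, rule sum.mono_neutral_left) (auto simp: supp_def)

subsection \<open>Substitution homomorphisms\<close>

lemma comm_ring_hom_eval_poly:
  assumes "comm_ring_hom h"
  shows "comm_ring_hom (\<lambda>p. eval_poly h p x)"
proof -
  interpret comm_ring_hom h by fact
  interpret map: map_poly_comm_ring_hom h ..
  show ?thesis unfolding eval_poly_def
    by unfold_locales (simp_all add: hom_distribs)
qed

definition subst3 :: "('k::comm_ring_1 \<Rightarrow> 'r::comm_ring_1) \<Rightarrow> 'r \<Rightarrow> 'r \<Rightarrow> 'r \<Rightarrow> 'k poly poly poly \<Rightarrow> 'r" where
  "subst3 h x y z F = eval_poly (\<lambda>q. eval_poly (\<lambda>p. eval_poly h p x) q y) F z"

lemma comm_ring_hom_subst3:
  assumes "comm_ring_hom h"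
  shows "comm_ring_hom (subst3 h x y z)"
  unfolding subst3_def[abs_def] by (intro comm_ring_hom_eval_poly assms)

lemma subst3_mon:
  assumes "comm_ring_hom h"
  shows "subst3 h x y z (mon u (i,j,l)) = h u * x ^ i * y ^ j * z ^ l"
proof -
  interpret h: comm_ring_hom h by fact
  interpret h1: comm_ring_hom "\<lambda>p. eval_poly h p x" by (intro comm_ring_hom_eval_poly assms)
  interpret h2: comm_ring_hom "\<lambda>q. eval_poly (\<lambda>p. eval_poly h p x) q y"
    by (intro comm_ring_hom_eval_poly assms)
  show ?thesis
    by (simp add: subst3_def mon_def h.eval_poly_monom h1.eval_poly_monom h2.eval_poly_monom)
qed

lemma hom_sum_supp:
  assumes "comm_ring_hom H"
  shows "H F = (\<Sum>P\<in>supp F. H (mon (cf F P) P))"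
proof -
  interpret comm_ring_hom H by fact
  show ?thesis by (subst sum_mon) (rule hom_sum)
qed

lemma hom_eqI:
  assumes "comm_ring_hom H" "comm_ring_hom H'" "\<And>u P. H (mon u P) = H' (mon u P)"
  shows "H F = H' F"
  by (simp only: hom_sum_supp[OF assms(1), of F] hom_sum_supp[OF assms(2), of F] assms(3))

lemma comm_ring_hom_id: "comm_ring_hom (\<lambda>x. x)"
  by unfold_locales simp_all

lemma comm_ring_hom_const_poly: "comm_ring_hom (\<lambda>x. [:x:])"
  by unfold_locales (simp_all add:)

lemma comm_ring_hom_comp: "comm_ring_hom H \<Longrightarrow> comm_ring_hom H' \<Longrightarrow> comm_ring_hom (\<lambda>x. H (H' x))"
proof -
  assume "comm_ring_hom H" "comm_ring_hom H'"
  then interpret H: comm_ring_hom H + H': comm_ring_hom H' by simp_all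
  show ?thesis
    by unfold_locales (simp_all add: H.hom_add H.hom_mult H'.hom_add H'.hom_mult)
qed

lemma comm_ring_hom_mon: "comm_ring_hom (\<lambda>u. mon u (0,0,0))"
  unfolding mon_const
  by (rule comm_ring_hom_comp[OF comm_ring_hom_const_poly
        comm_ring_hom_comp[OF comm_ring_hom_const_poly comm_ring_hom_const_poly]])

lemma comm_ring_hom_const4: "comm_ring_hom (\<lambda>u. [:mon u (0,0,0):])"
  by (rule comm_ring_hom_comp[OF comm_ring_hom_const_poly comm_ring_hom_mon])

abbreviation "varx \<equiv> mon 1 (1,0,0)"
abbreviation "vary \<equiv> mon 1 (0,1,0)"
abbreviation "varz \<equiv> mon 1 (0,0,1)"

lemma mon_vars: "mon u (0,0,0) * varx ^ i * vary ^ j * varz ^ l = mon u (i,j,l)"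
  by (simp add: mon_power mon_mult)

subsection \<open>Weighted degrees\<close>

text \<open>A fourth variable marks the degree, which makes degrees and lowest parts multiplicative for free.\<close>

definition grading :: "nat \<Rightarrow> nat \<Rightarrow> nat \<Rightarrow> 'k::comm_ring_1 poly poly poly \<Rightarrow> 'k poly poly poly poly" where
  "grading a b c = subst3 (\<lambda>u. [:mon u (0,0,0):]) (monom varx a) (monom vary b) (monom varz c)"

definition wdeg :: "nat \<Rightarrow> nat \<Rightarrow> nat \<Rightarrow> nat \<times> nat \<times> nat \<Rightarrow> nat" where
  "wdeg a b c = (\<lambda>(i,j,l). a * i + b * j + c * l)"

lemma comm_ring_hom_grading: "comm_ring_hom (grading a b c)"
  unfolding grading_def by (intro comm_ring_hom_subst3 comm_ring_hom_const4)

lemma grading_mon: "grading a b c (mon u P) = monom (mon u P) (wdeg a b c P)"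
proof -
  obtain i j l where P: "P = (i,j,l)" by (cases P)
  have "grading a b c (mon u P) = monom (mon u (0,0,0) * varx ^ i * vary ^ j * varz ^ l) (a * i + b * j + c * l)"
    unfolding grading_def P
    by (subst subst3_mon[OF comm_ring_hom_const4])
      (simp add: monom_power mult_monom ac_simps flip: monom_0)
  then show ?thesis by (simp only: mon_vars) (simp add: P wdeg_def)
qed

lemma coeff_grading: "cf (coeff (grading a b c F) d) P = (if wdeg a b c P = d then cf F P else 0)"
proof -
  have *: "coeff (grading a b c F) d = (\<Sum>Q\<in>supp F. if wdeg a b c Q = d then mon (cf F Q) Q else 0)"
    by (subst hom_sum_supp[OF comm_ring_hom_grading]) (simp add: grading_mon coeff_sum)
  have "cf (coeff (grading a b c F) d) P =
      (\<Sum>Q\<in>supp F. if Q = P then (if wdeg a b c P = d then cf F P else 0) else 0)"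
    unfolding * cf_sum by (intro sum.cong) auto
  also have "\<dots> = (if P \<in> supp F then (if wdeg a b c P = d then cf F P else 0) else 0)"
    by (rule sum.delta) simp
  finally show ?thesis by (auto simp: supp_def)
qed

lemma homogeneous_iff_cf: "homogeneous a b c d F \<longleftrightarrow> (\<forall>P. cf F P \<noteq> 0 \<longrightarrow> wdeg a b c P = d)"
  by (auto simp: homogeneous_def cf_def wdeg_def split_paired_All)

lemma homogeneous_iff_grading: "homogeneous a b c d F \<longleftrightarrow> grading a b c F = monom F d"
proof
  assume h: "homogeneous a b c d F"
  show "grading a b c F = monom F d"
    by (intro poly_eqI cf_eqI) (use h in \<open>auto simp: coeff_grading homogeneous_iff_cf\<close>)
next
  assume *: "grading a b c F = monom F d"
  show "homogeneous a b c d F" unfolding homogeneous_iff_cf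
  proof (intro allI impI)
    fix P assume P: "cf F P \<noteq> 0"
    have "cf (coeff (grading a b c F) (wdeg a b c P)) P = cf F P" by (simp add: coeff_grading)
    then show "wdeg a b c P = d" using P unfolding * by (auto split: if_splits)
  qed
qed

lemma homogeneous_part: "homogeneous a b c d (coeff (grading a b c F) d)"
  by (simp add: homogeneous_iff_cf coeff_grading)

lemma sum_homogeneous_parts: "F = (\<Sum>d\<le>degree (grading a b c F). coeff (grading a b c F) d)"
proof (rule cf_eqI)
  fix P
  let ?G = "grading a b c F"
  have "cf F P = cf (coeff ?G (wdeg a b c P)) P" by (simp add: coeff_grading)
  moreover have "wdeg a b c P \<le> degree ?G" if "cf F P \<noteq> 0"
    by (rule le_degree) (use that coeff_grading[of a b c F "wdeg a b c P" P] in auto)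
  ultimately show "cf F P = cf (\<Sum>d\<le>degree ?G. coeff ?G d) P"
    by (cases "cf F P = 0") (auto simp: cf_sum coeff_grading)
qed

lemma homogeneous_0 [simp]: "homogeneous a b c d 0"
  by (simp add: homogeneous_iff_cf)

lemma homogeneous_mon: "wdeg a b c P = d \<Longrightarrow> homogeneous a b c d (mon u P)"
  by (simp add: homogeneous_iff_cf)

lemma homogeneous_1: "homogeneous a b c 0 1"
  using homogeneous_mon[of a b c "(0,0,0)" 0 1] by (simp add: wdeg_def)

lemma homogeneous_add: "homogeneous a b c d F \<Longrightarrow> homogeneous a b c d G \<Longrightarrow> homogeneous a b c d (F + G)"
  unfolding homogeneous_iff_cf by (metis add.right_neutral cf_add)

lemma homogeneous_minus: "homogeneous a b c d F \<Longrightarrow> homogeneous a b c d (- F)"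
  by (simp add: homogeneous_iff_cf)

lemma homogeneous_diff: "homogeneous a b c d F \<Longrightarrow> homogeneous a b c d G \<Longrightarrow> homogeneous a b c d (F - G)"
  using homogeneous_add[OF _ homogeneous_minus, of a b c d F G] by simp

lemma homogeneous_sum: "(\<And>i. i \<in> A \<Longrightarrow> homogeneous a b c d (F i)) \<Longrightarrow> homogeneous a b c d (\<Sum>i\<in>A. F i)"
  by (induction A rule: infinite_finite_induct) (auto intro: homogeneous_add)

lemma homogeneous_mult:
  assumes "homogeneous a b c d F" "homogeneous a b c d' G"
  shows "homogeneous a b c (d + d') (F * G)"
proof -
  interpret comm_ring_hom "grading a b c" by (rule comm_ring_hom_grading)
  show ?thesis using assms by (simp add: homogeneous_iff_grading hom_mult mult_monom)
qed

lemma homogeneous_power: "homogeneous a b c d F \<Longrightarrow> homogeneous a b c (n * d) (F ^ n)"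
  by (induction n) (auto intro: homogeneous_1 homogeneous_mult)

lemma homogeneous_degree_unique:
  assumes "homogeneous a b c d F" "homogeneous a b c d' F" "F \<noteq> 0"
  shows "d = d'"
proof -
  obtain P where "cf F P \<noteq> 0" using assms(3) cf_eqI[of F 0] by (metis cf_0)
  then show ?thesis using assms by (auto simp: homogeneous_iff_cf)
qed

text \<open>Order at 0 and degree are both additive and agree on a nonzero monomial. Since the order
  never exceeds the degree, they agree on each factor as well.\<close>

lemma monom_mult_eq_monmD:
  fixes p q :: "'a::idom poly"
  assumes "p * q = monom u d" "u \<noteq> 0"
  shows "p = monom (coeff p (degree p)) (degree p)"
proof -
  have nz: "p \<noteq> 0" "q \<noteq> 0" "p * q \<noteq> 0" using assms by auto
  have "order 0 (p * q) = d" using assms by (simp add: order_0_monom)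
  then have "order 0 p + order 0 q = d" using order_mult[OF nz(3), of 0] by simp
  moreover have "degree p + degree q = d"
    using degree_mult_eq[OF nz(1,2)] assms by (simp add: degree_monom_eq)
  moreover have "order 0 p \<le> degree p" "order 0 q \<le> degree q" using nz by (simp_all add: order_degree)
  ultimately have "order 0 p = degree p" by linarith
  then have "monom 1 (degree p) dvd p" using order_1[of 0 p] by (simp add: monom_altdef)
  then have "coeff p k = 0" if "k < degree p" for k using that by (auto simp: monom_1_dvd_iff')
  then show ?thesis by (intro poly_eqI) (metis coeff_eq_0 coeff_monom linorder_neqE_nat)
qed

text \<open>Homogeneous polynomials are those that \<open>grading\<close> sends to monomials in the
  marking variable, and over a domain the factors of a monomial are monomials.\<close>

lemma homogeneous_factor:
  fixes F G :: "'k::field poly poly poly"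
  assumes "homogeneous a b c d (F * G)" "F * G \<noteq> 0"
  obtains d' d'' where "homogeneous a b c d' F" "homogeneous a b c d'' G" "d = d' + d''"
proof -
  interpret comm_ring_hom "grading a b c" by (rule comm_ring_hom_grading)
  have *: "grading a b c F * grading a b c G = monom (F * G) d"
    using assms by (simp add: homogeneous_iff_grading hom_mult)
  have hom: "homogeneous a b c d F" if "grading a b c F = monom u d" for F u d
  proof -
    have "u = F" using that sum_homogeneous_parts[of F a b c]
      by (cases "u = 0") (auto simp: degree_monom_eq if_distrib cong: if_cong)
    then show ?thesis using that by (simp add: homogeneous_iff_grading)
  qed
  from monom_mult_eq_monmD[OF *] assms(2) obtain d' where d': "homogeneous a b c d' F" using hom by blast
  have "grading a b c G * grading a b c F = monom (F * G) d" using * by (simp add: mult.commute)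
  from monom_mult_eq_monmD[OF this] assms(2) obtain d'' where d'': "homogeneous a b c d'' G" using hom by blast
  show ?thesis
    using that[OF d' d'' homogeneous_degree_unique[OF assms(1) homogeneous_mult[OF d' d''] assms(2)]] .
qed

subsection \<open>Multiplicity at the point (1,1,1)\<close>

definition shift :: "'k::comm_ring_1 poly poly poly \<Rightarrow> 'k poly poly poly" where
  "shift = subst3 (\<lambda>u. mon u (0,0,0)) (varx + 1) (vary + 1) (varz + 1)"

lemma comm_ring_hom_shift: "comm_ring_hom shift"
  unfolding shift_def by (intro comm_ring_hom_subst3 comm_ring_hom_mon)

lemma cf_mult_vars:
  "coeff (coeff (coeff ([:[:p:]:] * [:q:] * r) l) j) i =
    coeff (p * coeff (q * coeff r l) j) i" for p :: "'k::comm_ring_1 poly"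
proof -
  have "[:[:p:]:] * [:q:] * r = smult ([:p:] * q) r" by simp
  then show ?thesis by (simp add: ac_simps)
qed

lemma coeff_one_plus_power: "coeff ([:1, 1:] ^ n) k = (of_nat (n choose k) :: 'a::comm_ring_1)"
proof (cases "k \<le> n")
  case True
  then show ?thesis using coeff_linear_poly_power[of k n 1 1] by simp
next
  case False
  have "degree ([:1, 1:] ^ n :: 'a poly) \<le> n"
    using degree_power_le[of "[:1,1:] :: 'a poly" n] by simp
  then show ?thesis using False by (simp add: coeff_eq_0 binomial_eq_0)
qed

lemma cf_shift_mon:
  "cf (shift (mon u (i,j,l))) (p,q,r) = u * of_nat (i choose p) * of_nat (j choose q) * of_nat (l choose r)"
proof -
  have x: "varx + 1 = [:[:[:1,1:]:]:]" and y: "vary + 1 = [:[:1,1:]:]" and z: "varz + 1 = [:1,1:]"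
    by (intro poly_eqI; auto simp: mon_def monom_altdef coeff_pCons coeff_1 split: nat.splits)+
  have "shift (mon u (i,j,l)) = [:[:smult u ([:1,1:] ^ i):]:] * [:[:1,1:] ^ j:] * [:1,1:] ^ l"
    unfolding shift_def subst3_mon[OF comm_ring_hom_mon] x y z
    by (simp add: mon_const poly_const_pow ac_simps)
  then have "cf (shift (mon u (i,j,l))) (p,q,r) =
      coeff (coeff (coeff ([:[:smult u ([:1,1:] ^ i):]:] * [:[:1,1:] ^ j:] * [:1,1:] ^ l) r) q) p"
    by (simp only: cf_def case_prod_conv)
  also have "\<dots> = coeff (smult u ([:1,1:] ^ i) * coeff ([:1,1:] ^ j * coeff ([:1,1:] ^ l) r) q) p"
    by (rule cf_mult_vars)
  also have "coeff ([:1,1:] ^ l) r = (of_nat (l choose r) :: 'a poly poly)" by (rule coeff_one_plus_power)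
  also have "coeff ([:1,1:] ^ j * of_nat (l choose r)) q = (of_nat (j choose q) * of_nat (l choose r) :: 'a poly)"
    by (simp add: of_nat_poly coeff_one_plus_power[unfolded pCons_one] mult.commute)
  finally show ?thesis by (simp add: of_nat_poly coeff_one_plus_power[unfolded pCons_one] ac_simps)
qed

text \<open>The link between geometry and linear algebra: Taylor coefficients at (1,1,1) are
  binomial moments of the coefficients. The index set may be larger than the support.\<close>

lemma cf_shift:
  assumes "finite A" "supp F \<subseteq> A"
  shows "cf (shift F) (p,q,r) =
    (\<Sum>(i,j,l)\<in>A. cf F (i,j,l) * of_nat (i choose p) * of_nat (j choose q) * of_nat (l choose r))"
proof -
  interpret comm_ring_hom shift by (rule comm_ring_hom_shift)
  have "shift F = (\<Sum>P\<in>A. shift (mon (cf F P) P))"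
    by (subst sum_mon_superset[OF assms]) (rule hom_sum)
  then show ?thesis by (simp add: cf_sum case_prod_unfold cf_shift_mon[of _ "fst P" "fst (snd P)" "snd (snd P)" for P, simplified])
qed

lemma shift_inj: "shift F = 0 \<Longrightarrow> F = 0"
proof -
  define unshift :: "'a poly poly poly \<Rightarrow> 'a poly poly poly" where
    "unshift = subst3 (\<lambda>u. mon u (0,0,0)) (varx - 1) (vary - 1) (varz - 1)"
  have h: "comm_ring_hom unshift"
    unfolding unshift_def by (intro comm_ring_hom_subst3 comm_ring_hom_mon)
  interpret u: comm_ring_hom unshift by (rule h)
  have "unshift (shift F) = F"
  proof (rule hom_eqI[OF comm_ring_hom_comp[OF h comm_ring_hom_shift] comm_ring_hom_id])
    fix v :: 'a and P :: "nat \<times> nat \<times> nat"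
    obtain i j l where P: "P = (i,j,l)" by (cases P)
    have vars: "unshift (mon w (0,0,0)) = mon w (0,0,0)" "unshift varx = varx - 1" "unshift vary = vary - 1"
      "unshift varz = varz - 1" for w
      unfolding unshift_def subst3_mon[OF comm_ring_hom_mon] by simp_all
    show "unshift (shift (mon v P)) = mon v P"
      unfolding shift_def P subst3_mon[OF comm_ring_hom_mon]
      by (simp only: u.hom_mult u.hom_power u.hom_add u.hom_one vars diff_add_cancel mon_vars)
  qed
  moreover assume "shift F = 0"
  ultimately show "F = 0" by simp
qed

text \<open>The lowest degree in the Taylor expansion at (1,1,1). A homogeneous polynomial is
  constant along the orbit of (1,1,1) up to nonzero factors, so this multiplicity in affine space is
  also that of the plane curve at the identity point. As an order in the marking variable it is
  multiplicative by \<open>order_mult\<close>.\<close>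

definition mult_one :: "'k::idom poly poly poly \<Rightarrow> nat" where
  "mult_one F = order 0 (grading 1 1 1 (shift F))"

lemma le_mult_one_iff:
  assumes "F \<noteq> 0"
  shows "m \<le> mult_one F \<longleftrightarrow> (\<forall>p q r. p + q + r < m \<longrightarrow> cf (shift F) (p,q,r) = 0)"
proof -
  let ?G = "grading 1 1 1 (shift F)"
  have nz: "?G \<noteq> 0"
  proof
    assume "?G = 0"
    then have "shift F = 0" using sum_homogeneous_parts[of "shift F" 1 1 1] by simp
    then show False using shift_inj assms by blast
  qed
  have "m \<le> mult_one F \<longleftrightarrow> monom 1 m dvd ?G"
    unfolding mult_one_def using order_divides[of 0 m ?G] nz by (simp add: monom_altdef)
  also have "\<dots> \<longleftrightarrow> (\<forall>k<m. coeff ?G k = 0)" by (simp add: monom_1_dvd_iff')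
  also have "\<dots> \<longleftrightarrow> (\<forall>p q r. p + q + r < m \<longrightarrow> cf (shift F) (p,q,r) = 0)"
  proof safe
    fix p q r assume *: "\<forall>k<m. coeff ?G k = 0" "p + q + r < m"
    then have "cf (coeff ?G (p + q + r)) (p,q,r) = 0" by simp
    then show "cf (shift F) (p,q,r) = 0" by (simp add: coeff_grading wdeg_def)
  next
    fix k assume *: "\<forall>p q r. p + q + r < m \<longrightarrow> cf (shift F) (p,q,r) = 0" "k < m"
    show "coeff ?G k = 0"
      by (rule cf_eqI) (use * in \<open>auto simp: coeff_grading wdeg_def\<close>)
  qed
  finally show ?thesis .
qed

lemma mult_one_mult:
  assumes "F \<noteq> 0" "G \<noteq> 0"
  shows "mult_one (F * G) = mult_one F + mult_one G"
proof -
  interpret s: comm_ring_hom shift by (rule comm_ring_hom_shift)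
  interpret g: comm_ring_hom "grading 1 1 1" by (rule comm_ring_hom_grading)
  have "grading 1 1 1 (shift (F * G)) \<noteq> 0"
  proof
    assume "grading 1 1 1 (shift (F * G)) = 0"
    then have "shift (F * G) = 0" using sum_homogeneous_parts[of "shift (F * G)" 1 1 1] by simp
    then show False using shift_inj[of "F * G"] assms by simp
  qed
  then show ?thesis unfolding mult_one_def s.hom_mult g.hom_mult by (rule order_mult)
qed

lemma mult_one_add:
  assumes "F \<noteq> 0" "G \<noteq> 0" "F + G \<noteq> 0"
  shows "min (mult_one F) (mult_one G) \<le> mult_one (F + G)"
proof -
  interpret s: comm_ring_hom shift by (rule comm_ring_hom_shift)
  have "m \<le> mult_one (F + G)" if "m \<le> mult_one F" "m \<le> mult_one G" for m
    using that unfolding le_mult_one_iff[OF assms(1)] le_mult_one_iff[OF assms(2)] le_mult_one_iff[OF assms(3)]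
    by (simp add: s.hom_add)
  then show ?thesis by simp
qed

lemma eval3_mon: "eval3 (mon u (i,j,l)) x y z = u * x ^ i * y ^ j * z ^ l"
proof -
  have 1: "[:p:] ^ n = [:p ^ n:]" for p :: "'x::comm_ring_1" and n by (simp add: poly_const_pow)
  show ?thesis by (simp add: eval3_def mon_def poly_monom 1)
qed

lemma comm_ring_hom_eval3: "comm_ring_hom (\<lambda>F. eval3 F x y z)"
  by unfold_locales (simp_all add: eval3_def)

lemma mult_one_pos_iff: "F \<noteq> 0 \<Longrightarrow> 1 \<le> mult_one F \<longleftrightarrow> eval3 F 1 1 1 = 0"
proof -
  assume "F \<noteq> 0"
  then have "1 \<le> mult_one F \<longleftrightarrow> cf (shift F) (0,0,0) = 0"
    by (subst le_mult_one_iff) auto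
  also have "cf (shift F) (0,0,0) = (\<Sum>P\<in>supp F. cf F P)"
    by (subst cf_shift[of "supp F"]) (auto intro!: sum.cong)
  also have "\<dots> = eval3 F 1 1 1"
    using hom_sum_supp[OF comm_ring_hom_eval3[of 1 1 1], of F]
    by (simp add: eval3_mon[of _ "fst P" "fst (snd P)" "snd (snd P)" for P, simplified])
  finally show ?thesis .
qed

section \<open>Local rings in a field\<close>

text \<open>Subrings and, with \<open>prime_in\<close>, prime ideals are described by plain closure
  conditions. The algebraic structures in the definitions of the theorem are translated once, in
  \<open>primeideal_iff\<close>, \<open>Units_ring_on\<close> and
  \<open>max_ideal_eq\<close>.\<close>

definition subring_set :: "'r::comm_ring_1 set \<Rightarrow> bool" where
  "subring_set A \<longleftrightarrow> 1 \<in> A \<and> (\<forall>x\<in>A. \<forall>y\<in>A. x - y \<in> A \<and> x * y \<in> A)"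

lemma subring_setD:
  assumes "subring_set A"
  shows "0 \<in> A" "1 \<in> A" "x \<in> A \<Longrightarrow> y \<in> A \<Longrightarrow> x + y \<in> A" "x \<in> A \<Longrightarrow> y \<in> A \<Longrightarrow> x - y \<in> A"
    "x \<in> A \<Longrightarrow> y \<in> A \<Longrightarrow> x * y \<in> A" "x \<in> A \<Longrightarrow> - x \<in> A" "x \<in> A \<Longrightarrow> x ^ n \<in> A"
proof -
  have 1: "1 \<in> A" and d: "\<And>x y. x \<in> A \<Longrightarrow> y \<in> A \<Longrightarrow> x - y \<in> A"
    and m: "\<And>x y. x \<in> A \<Longrightarrow> y \<in> A \<Longrightarrow> x * y \<in> A"
    using assms unfolding subring_set_def by blast+
  show 0: "0 \<in> A" using d[OF 1 1] by simp
  show neg: "- x \<in> A" if "x \<in> A" for x using d[OF 0 that] by simp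
  show "x + y \<in> A" if "x \<in> A" "y \<in> A" using d[OF that(1) neg[OF that(2)]] by simp
  show "x ^ n \<in> A" if "x \<in> A" using that by (induction n) (auto intro: 1 m)
qed (use assms in \<open>auto simp: subring_set_def\<close>)

abbreviation ring_on :: "'r::comm_ring_1 set \<Rightarrow> 'r ring" where
  "ring_on A \<equiv> ring_of_type_algebra\<lparr>carrier := A\<rparr>"

lemma ring_on_UNIV: "ring_on UNIV = ring_of_type_algebra"
  by (simp add: ring_of_type_algebra_def)

lemma cring_ring_on:
  assumes "subring_set A"
  shows "cring (ring_on A)"
proof -
  note A = subring_setD[OF assms]
  have "\<exists>y\<in>A. y + x = 0 \<and> x + y = 0" if "x \<in> A" for x using A(6)[OF that] by (intro bexI[of _ "- x"]) auto
  then show ?thesis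
    by unfold_locales (use A in \<open>auto simp: ring_of_type_algebra_def Units_def algebra_simps\<close>)
qed

definition prime_in :: "'r::comm_ring_1 set \<Rightarrow> 'r set \<Rightarrow> bool" where
  "prime_in A P \<longleftrightarrow> P \<subseteq> A \<and> 0 \<in> P \<and> 1 \<notin> P \<and> (\<forall>x\<in>P. \<forall>y\<in>P. x + y \<in> P) \<and> (\<forall>x\<in>P. \<forall>r\<in>A. r * x \<in> P) \<and>
     (\<forall>x\<in>A. \<forall>y\<in>A. x * y \<in> P \<longrightarrow> x \<in> P \<or> y \<in> P)"

lemma prime_inD:
  assumes "prime_in A P"
  shows "P \<subseteq> A" "0 \<in> P" "1 \<notin> P" "x \<in> P \<Longrightarrow> y \<in> P \<Longrightarrow> x + y \<in> P" "x \<in> P \<Longrightarrow> r \<in> A \<Longrightarrow> r * x \<in> P"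
    "x \<in> A \<Longrightarrow> y \<in> A \<Longrightarrow> x * y \<in> P \<Longrightarrow> x \<in> P \<or> y \<in> P"
  using assms unfolding prime_in_def by blast+

lemma prime_in_powerD: "subring_set A \<Longrightarrow> prime_in A P \<Longrightarrow> x \<in> A \<Longrightarrow> x ^ n \<in> P \<Longrightarrow> x \<in> P"
proof (induction n)
  case (Suc n)
  have "x \<in> P \<or> x ^ n \<in> P"
    using prime_inD(6)[OF Suc.prems(2,3) subring_setD(7)[OF Suc.prems(1,3)]] Suc.prems(4) by simp
  then show ?case using Suc by blast
qed (simp add: prime_inD(3))

lemma primeideal_iff:
  assumes "subring_set A"
  shows "primeideal P (ring_on A) \<longleftrightarrow> prime_in A P"
proof
  assume "primeideal P (ring_on A)"
  then interpret P: primeideal P "ring_on A" .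
  have sub: "P \<subseteq> A" using P.a_subset by simp
  have "1 \<notin> P"
  proof
    assume "1 \<in> P"
    then have "P = carrier (ring_on A)" by (intro P.one_imp_carrier) (simp add: ring_of_type_algebra_def)
    then show False using P.I_notcarr by simp
  qed
  then show "prime_in A P"
    using sub additive_subgroup.zero_closed[OF P.is_additive_subgroup]
      additive_subgroup.a_closed[OF P.is_additive_subgroup] P.I_l_closed P.I_prime unfolding prime_in_def
    by (auto simp: ring_of_type_algebra_def)
next
  assume P: "prime_in A P"
  note A = subring_setD[OF assms] and PD = prime_inD[OF P]
  interpret cring "ring_on A" by (rule cring_ring_on[OF assms])
  have neg: "- x \<in> P" if "x \<in> P" for x using PD(5)[OF that A(6)[OF A(2)]] by simp
  have inv: "\<ominus>\<^bsub>ring_on A\<^esub> x = - x" if "x \<in> A" for x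
    by (rule minus_equality) (use that A(6) in \<open>auto simp: ring_of_type_algebra_def\<close>)
  have ideal: "ideal P (ring_on A)"
  proof (rule idealI[OF ring_axioms])
    show "subgroup P (add_monoid (ring_on A))"
    proof (rule add.subgroupI)
      show "\<ominus>\<^bsub>ring_on A\<^esub> x \<in> P" if "x \<in> P" for x
        using inv[of x] neg[OF that] PD(1) that by auto
    qed (use PD in \<open>auto simp: ring_of_type_algebra_def\<close>)
    show "r \<otimes>\<^bsub>ring_on A\<^esub> x \<in> P" if "x \<in> P" "r \<in> carrier (ring_on A)" for x r
      using PD(5)[of x r] that by (simp add: ring_of_type_algebra_def)
    show "x \<otimes>\<^bsub>ring_on A\<^esub> r \<in> P" if "x \<in> P" "r \<in> carrier (ring_on A)" for x r
      using PD(5)[of x r] that by (simp add: ring_of_type_algebra_def mult.commute)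
  qed
  have "carrier (ring_on A) \<noteq> P" using PD(3) A(2) by auto
  then show "primeideal P (ring_on A)"
    by (intro primeidealI[OF ideal cring_axioms])
      (use PD(6) in \<open>auto simp: ring_of_type_algebra_def\<close>)
qed

lemma Units_ring_on: "Units (ring_on A) = {u \<in> A. \<exists>v\<in>A. u * v = 1}"
  by (auto simp: Units_def ring_of_type_algebra_def mult.commute)

lemma max_ideal_eq: "max_ideal A = {x \<in> A. x = 0 \<or> inverse x \<notin> A}" for A :: "'f::field set"
proof -
  have "(\<exists>v\<in>A. u * v = 1) \<longleftrightarrow> u \<noteq> 0 \<and> inverse u \<in> A" for u :: 'f
    by (metis inverse_unique mult_zero_left right_inverse zero_neq_one)
  then show ?thesis by (auto simp: max_ideal_def Units_ring_on)
qed

lemma cgenideal_ring_on: "cgenideal (ring_on A) u = {x * u |x. x \<in> A}"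
  by (auto simp: cgenideal_def ring_of_type_algebra_def)

lemma prime_in_zero: "subring_set A \<Longrightarrow> prime_in A {0}" for A :: "'r::idom set"
  using subring_setD[of A] by (auto simp: prime_in_def)

text \<open>The criterion by which points of codimension at least two are excluded. A ring with
  infinitely many primes is covered too, its \<open>card\<close> being 0.\<close>

lemma not_two_primes:
  assumes "subring_set A" "prime_in A P1" "prime_in A P2" "prime_in A P3" "P1 \<noteq> P2" "P1 \<noteq> P3" "P2 \<noteq> P3"
  shows "card {P. primeideal P (ring_on A)} \<noteq> 2"
proof
  assume *: "card {P. primeideal P (ring_on A)} = 2"
  then have "finite {P. primeideal P (ring_on A)}" by (simp add: card_ge_0_finite)
  moreover have "{P1, P2, P3} \<subseteq> {P. primeideal P (ring_on A)}"
    using assms(2-4) by (simp add: primeideal_iff[OF assms(1)])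
  ultimately have "card {P1, P2, P3} \<le> 2" using card_mono * by metis
  then show False using assms(5-7) by simp
qed

subsection \<open>Discrete valuation rings\<close>

text \<open>The values may form any nonzero subgroup of the integers, as happens for multiplicities
  on fractions of degree zero. The value at 0 carries no meaning, so 0 is treated separately
  throughout; \<open>nontrivial\<close> prevents the valuation ring from being all of
  \<open>K\<close>.\<close>

locale discrete_valuation =
  fixes K :: "'f::field set" and W :: "'f \<Rightarrow> int"
  assumes K: "subring_set K" and K_inverse: "x \<in> K \<Longrightarrow> inverse x \<in> K"
    and W_mult: "x \<in> K \<Longrightarrow> y \<in> K \<Longrightarrow> x \<noteq> 0 \<Longrightarrow> y \<noteq> 0 \<Longrightarrow> W (x * y) = W x + W y"
    and W_add: "x \<in> K \<Longrightarrow> y \<in> K \<Longrightarrow> x \<noteq> 0 \<Longrightarrow> y \<noteq> 0 \<Longrightarrow> x + y \<noteq> 0 \<Longrightarrow> min (W x) (W y) \<le> W (x + y)"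
    and nontrivial: "\<exists>x\<in>K. x \<noteq> 0 \<and> W x \<noteq> 0"
begin

definition O_ring :: "'f set" where
  "O_ring = {x \<in> K. x = 0 \<or> W x \<ge> 0}"

lemma W_1: "W 1 = 0"
  using W_mult[of 1 1] subring_setD(2)[OF K] by simp

lemma W_minus: "x \<in> K \<Longrightarrow> x \<noteq> 0 \<Longrightarrow> W (- x) = W x"
proof -
  assume x: "x \<in> K" "x \<noteq> 0"
  have "W (- 1) + W (- 1) = W 1"
    using W_mult[of "- 1" "- 1"] subring_setD(2,6)[OF K] by simp
  then have "W (- 1) = 0" by (simp add: W_1)
  then show ?thesis using W_mult[of "- 1" x] x subring_setD(2,6)[OF K] by simp
qed

lemma W_inverse: "x \<in> K \<Longrightarrow> x \<noteq> 0 \<Longrightarrow> W (inverse x) = - W x"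
  using W_mult[of x "inverse x"] K_inverse[of x] by (simp add: W_1)

lemma W_power: "x \<in> K \<Longrightarrow> x \<noteq> 0 \<Longrightarrow> W (x ^ n) = int n * W x"
  by (induction n) (auto simp: W_1 W_mult subring_setD(7)[OF K] algebra_simps)

lemma K_powi: "x \<in> K \<Longrightarrow> x powi i \<in> K"
  by (cases "i \<ge> 0") (auto simp: power_int_def K_inverse subring_setD(7)[OF K])

lemma W_powi: "x \<in> K \<Longrightarrow> x \<noteq> 0 \<Longrightarrow> W (x powi i) = i * W x"
  by (auto simp: power_int_def W_power K_inverse W_inverse subring_setD(7)[OF K])

lemma subring_O: "subring_set O_ring"
proof -
  have "x - y \<in> O_ring" if "x \<in> O_ring" "y \<in> O_ring" for x y
  proof (cases "x = 0 \<or> y = 0 \<or> x - y = 0")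
    case True
    then show ?thesis using that W_minus by (auto simp: O_ring_def subring_setD[OF K])
  next
    case False
    then have "min (W x) (W (- y)) \<le> W (x + (- y))"
      using that by (intro W_add) (auto simp: O_ring_def subring_setD[OF K])
    then show ?thesis using False that W_minus[of y] by (auto simp: O_ring_def subring_setD[OF K])
  qed
  moreover have "x * y \<in> O_ring" if "x \<in> O_ring" "y \<in> O_ring" for x y
    using that W_mult[of x y] by (cases "x = 0 \<or> y = 0") (auto simp: O_ring_def subring_setD[OF K])
  ultimately show ?thesis by (auto simp: subring_set_def O_ring_def W_1 subring_setD[OF K])
qed

lemma mem_O: "x \<in> O_ring \<longleftrightarrow> x \<in> K \<and> (x = 0 \<or> W x \<ge> 0)"
  by (simp add: O_ring_def)

lemma mem_max: "x \<in> max_ideal O_ring \<longleftrightarrow> x \<in> K \<and> (x = 0 \<or> W x > 0)"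
proof (cases "x \<in> K \<and> x \<noteq> 0")
  case True
  then show ?thesis using W_inverse[of x] K_inverse[of x] by (auto simp: max_ideal_eq mem_O)
next
  case False
  then show ?thesis by (auto simp: max_ideal_eq mem_O)
qed

lemma Units_O: "Units (ring_on O_ring) = {x \<in> K. x \<noteq> 0 \<and> W x = 0}"
proof -
  have eq: "Units (ring_on O_ring) = O_ring - max_ideal O_ring"
    unfolding max_ideal_def using Units_ring_on[of O_ring] by blast
  show ?thesis
  proof (rule Set.set_eqI)
    show "x \<in> Units (ring_on O_ring) \<longleftrightarrow> x \<in> {x \<in> K. x \<noteq> 0 \<and> W x = 0}" for x
      unfolding eq Diff_iff mem_max mem_O mem_Collect_eq by linarith
  qed
qed

text \<open>If \<open>x\<close> is a nonzero element of a prime and \<open>y\<close> has positive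
  value, then a sufficiently high power of \<open>y\<close> is a multiple of \<open>x\<close>, and
  so \<open>y\<close> lies in the prime.\<close>

lemma prime_in_O_iff: "prime_in O_ring P \<longleftrightarrow> P = {0} \<or> P = max_ideal O_ring"
proof
  assume P: "prime_in O_ring P"
  note PD = prime_inD[OF P]
  show "P = {0} \<or> P = max_ideal O_ring"
  proof (cases "P = {0}")
    case False
    then obtain x where x: "x \<in> P" "x \<noteq> 0" using PD(2) by auto
    then have xK: "x \<in> K" using PD(1) by (auto simp: mem_O)
    have "P \<subseteq> max_ideal O_ring"
    proof
      fix y assume y: "y \<in> P"
      show "y \<in> max_ideal O_ring"
      proof (rule ccontr)
        assume "y \<notin> max_ideal O_ring"
        then have "y \<noteq> 0" "inverse y \<in> O_ring" using y PD(1) by (auto simp: max_ideal_eq)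
        then have "1 \<in> P" using PD(5)[OF y, of "inverse y"] by simp
        then show False using PD(3) by simp
      qed
    qed
    moreover have "max_ideal O_ring \<subseteq> P"
    proof
      fix y assume y: "y \<in> max_ideal O_ring"
      show "y \<in> P"
      proof (cases "y = 0")
        case True
        then show ?thesis using PD(2) by simp
      next
        case y0: False
        then have yK: "y \<in> K" "W y > 0" using y by (auto simp: mem_max)
        define n where "n = nat (W x)"
        have "int n * 1 \<le> int n * W y" using yK by (intro mult_left_mono) auto
        moreover have "W x \<le> int n" by (simp add: n_def)
        ultimately have "W x \<le> W (y ^ n)" using W_power[OF yK(1) y0, of n] by simp
        moreover have "W (y ^ n * inverse x) = W (y ^ n) - W x"
          using W_mult[of "y ^ n" "inverse x"] xK yK x y0 by (simp add: W_inverse K_inverse subring_setD(7)[OF K])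
        ultimately have "y ^ n * inverse x \<in> O_ring"
          using xK yK by (simp add: mem_O K_inverse subring_setD[OF K])
        from PD(5)[OF x(1) this] have "y ^ n \<in> P" using x(2) by (simp add: mult.assoc)
        moreover have "y \<in> O_ring" using yK by (simp add: mem_O)
        ultimately show ?thesis using prime_in_powerD[OF subring_O P] by blast
      qed
    qed
    ultimately show ?thesis by blast
  qed simp
next
  assume "P = {0} \<or> P = max_ideal O_ring"
  moreover have "prime_in O_ring (max_ideal O_ring)"
  proof -
    note O = subring_setD[OF subring_O]
    have "x + y \<in> max_ideal O_ring" if "x \<in> max_ideal O_ring" "y \<in> max_ideal O_ring" for x y
      using that W_add[of x y] unfolding mem_max
      by (cases "x = 0 \<or> y = 0 \<or> x + y = 0") (auto simp: subring_setD[OF K])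
    moreover have "r * x \<in> max_ideal O_ring" if "x \<in> max_ideal O_ring" "r \<in> O_ring" for r x
      using that W_mult[of r x] unfolding mem_max mem_O
      by (cases "x = 0 \<or> r = 0") (auto simp: subring_setD[OF K])
    moreover have "x \<in> max_ideal O_ring \<or> y \<in> max_ideal O_ring"
      if "x \<in> O_ring" "y \<in> O_ring" "x * y \<in> max_ideal O_ring" for x y
      using that W_mult[of x y] unfolding mem_max mem_O
      by (cases "x = 0 \<or> y = 0") auto
    ultimately show ?thesis unfolding prime_in_def
      by (auto simp: mem_max mem_O W_1 subring_setD[OF K])
  qed
  ultimately show "prime_in O_ring P" using prime_in_zero[OF subring_O] by blast
qed

lemma two_primes: "card {P. primeideal P (ring_on O_ring)} = 2"
proof -
  obtain x where x: "x \<in> K" "x \<noteq> 0" "W x \<noteq> 0" using nontrivial by blast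
  have "\<exists>y\<in>K. y \<noteq> 0 \<and> W y > 0"
    using x W_inverse[of x] K_inverse[of x] by (cases "W x > 0") (auto intro: bexI[of _ "inverse x"])
  then have "{0} \<noteq> max_ideal O_ring" using mem_max by blast
  moreover have "{P. primeideal P (ring_on O_ring)} = {{0}, max_ideal O_ring}"
    by (auto simp: primeideal_iff[OF subring_O] prime_in_O_iff)
  ultimately show ?thesis by simp
qed

text \<open>The factor \<open>r\<close> is the least positive value: division with remainder shows
  that all values are multiples of it, and an element of value \<open>r\<close> is a uniformizer.
  The \<open>THE\<close> in \<open>ord_along\<close> ranges over all uniformizers, so the proof also
  checks that every generator of the maximal ideal has value \<open>r\<close>.\<close>

lemma ord_along_O: "\<exists>r>0. \<forall>x\<in>K - {0}. W x = r * ord_along O_ring x"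
proof -
  define Q where "Q k \<longleftrightarrow> k > 0 \<and> (\<exists>y\<in>K. y \<noteq> 0 \<and> W y = int k)" for k :: nat
  obtain x where x: "x \<in> K" "x \<noteq> 0" "W x \<noteq> 0" using nontrivial by blast
  have "\<exists>y\<in>K. y \<noteq> 0 \<and> W y = int (nat \<bar>W x\<bar>)"
    using x W_inverse[of x] K_inverse[of x] by (cases "W x > 0") (auto intro: bexI[of _ "inverse x"])
  then have "Q (nat \<bar>W x\<bar>)" using x by (simp add: Q_def)
  then have Q: "Q (LEAST k. Q k)" by (rule LeastI)
  define r where "r = int (LEAST k. Q k)"
  obtain \<pi> where \<pi>: "\<pi> \<in> K" "\<pi> \<noteq> 0" "W \<pi> = r" and r: "r > 0" using Q by (auto simp: Q_def r_def)
  have min: "r \<le> W y" if "y \<in> K" "y \<noteq> 0" "W y > 0" for y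
  proof -
    have "Q (nat (W y))" using that by (auto simp: Q_def)
    then have "(LEAST k. Q k) \<le> nat (W y)" by (rule Least_le)
    then show ?thesis using that by (simp add: r_def)
  qed
  have "W y = r * ord_along O_ring y" if y: "y \<in> K" "y \<noteq> 0" for y
  proof -
    define n where "n = W y div r"
    have Wy': "W (y * \<pi> powi (- n)) = W y - n * r"
      using W_mult[of y "\<pi> powi (- n)"] y \<pi> K_powi[of \<pi>] W_powi[of \<pi>] by simp
    have "W y - n * r = W y mod r" unfolding n_def by (simp add: minus_div_mult_eq_mod)
    moreover have "\<not> W y mod r > 0"
    proof
      assume "W y mod r > 0"
      then have "r \<le> W y mod r"
        using min[of "y * \<pi> powi (- n)"] Wy' y \<pi> K_powi[of \<pi>] calculation by (auto simp: subring_setD[OF K])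
      then show False using r pos_mod_bound[of r "W y"] by linarith
    qed
    ultimately have 0: "W y - n * r = 0" using r pos_mod_sign[of r "W y"] by linarith
    have max: "max_ideal O_ring = cgenideal (ring_on O_ring) \<pi>"
      unfolding cgenideal_ring_on
    proof safe
      fix z assume "z \<in> max_ideal O_ring"
      then have z: "z \<in> K" "z = 0 \<or> W z > 0" by (auto simp: mem_max)
      have "z * inverse \<pi> \<in> O_ring"
        using z \<pi> min[of z] W_mult[of z "inverse \<pi>"] W_inverse[of \<pi>] K_inverse[of \<pi>]
        by (cases "z = 0") (auto simp: mem_O subring_setD[OF K])
      then show "\<exists>x. z = x * \<pi> \<and> x \<in> O_ring" using \<pi> by (intro exI[of _ "z * inverse \<pi>"]) simp
    next
      fix x assume "x \<in> O_ring"
      then show "x * \<pi> \<in> max_ideal O_ring"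
        using \<pi> r W_mult[of x \<pi>] by (cases "x = 0") (auto simp: mem_O mem_max subring_setD[OF K])
    qed
    have "ord_along O_ring y = n" unfolding ord_along_def
    proof (rule the_equality)
      have "y = y * \<pi> powi (- n) * \<pi> powi n" using \<pi> by (simp add: power_int_minus)
      moreover have "y * \<pi> powi (- n) \<in> Units (ring_on O_ring)"
        using Wy' 0 y \<pi> K_powi[of \<pi>] by (auto simp: Units_O subring_setD[OF K])
      moreover have "\<pi> \<in> O_ring" using \<pi> r by (simp add: mem_O)
      ultimately show "\<exists>\<pi>\<in>O_ring. \<exists>u\<in>Units (ring_on O_ring).
          max_ideal O_ring = PIdl\<^bsub>ring_on O_ring\<^esub> \<pi> \<and> y = u * \<pi> powi n"
        using max by blast
    next
      fix n' assume "\<exists>\<pi>\<in>O_ring. \<exists>u\<in>Units (ring_on O_ring).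
          max_ideal O_ring = PIdl\<^bsub>ring_on O_ring\<^esub> \<pi> \<and> y = u * \<pi> powi n'"
      then obtain \<pi>' u where \<pi>': "\<pi>' \<in> O_ring" "max_ideal O_ring = {x * \<pi>' |x. x \<in> O_ring}" and
        u: "u \<in> K" "u \<noteq> 0" "W u = 0" "y = u * \<pi>' powi n'"
        unfolding cgenideal_ring_on Units_O by blast
      have "\<pi> \<in> max_ideal O_ring" using \<pi> r by (simp add: mem_max)
      then obtain x where x: "x \<in> O_ring" "\<pi> = x * \<pi>'" using \<pi>'(2) by blast
      then have nz: "x \<noteq> 0" "\<pi>' \<noteq> 0" using \<pi> by auto
      have "W \<pi> = W x + W \<pi>'" using x nz \<pi>' by (auto simp: mem_O intro!: W_mult)
      then have "W \<pi>' \<le> r" using x nz \<pi> by (simp add: mem_O)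
      moreover have "1 * \<pi>' \<in> max_ideal O_ring" using \<pi>'(2) subring_setD(2)[OF subring_O] by blast
      then have "r \<le> W \<pi>'" using nz by (intro min) (auto simp: mem_max)
      ultimately have "W \<pi>' = r" by simp
      moreover have "\<pi>' \<in> K" using \<pi>' by (simp add: mem_O)
      ultimately have "W y = n' * r" using u nz W_mult[of u "\<pi>' powi n'"] K_powi[of \<pi>'] W_powi[of \<pi>'] by simp
      then show "n' = n" using 0 r by simp
    qed
    then show ?thesis using 0 by (simp add: mult.commute)
  qed
  then show ?thesis using r by blast
qed

end

subsection \<open>Localizations\<close>

lemma subring_localization:
  fixes B :: "'f::field set"
  assumes B: "subring_set B" and Q: "prime_in B Q"
  shows "subring_set (localization B Q)"
proof -
  note BD = subring_setD[OF B] and QD = prime_inD[OF Q]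
  have s: "s * s' \<in> B - Q" if "s \<in> B - Q" "s' \<in> B - Q" for s s' using that BD(5) QD(6) by blast
  have "1 \<in> localization B Q" unfolding localization_def
    by (intro CollectI exI[of _ 1]) (use BD(2) QD(3) in auto)
  moreover have "x - y \<in> localization B Q \<and> x * y \<in> localization B Q"
    if xy: "x \<in> localization B Q" "y \<in> localization B Q" for x y
  proof -
    obtain r s r' s' where x: "x = r / s" "r \<in> B" "s \<in> B - Q" and y: "y = r' / s'" "r' \<in> B" "s' \<in> B - Q"
      using xy unfolding localization_def by blast
    have nz: "s \<noteq> 0" "s' \<noteq> 0" using x y QD(2) by auto
    have "x - y = (r * s' - r' * s) / (s * s')" "x * y = (r * r') / (s * s')"
      unfolding x(1) y(1) using nz by (simp_all add: field_simps)
    moreover have "r * s' - r' * s \<in> B" "r * r' \<in> B" using x y BD by auto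
    ultimately show ?thesis using s[OF x(3) y(3)] unfolding localization_def by blast
  qed
  ultimately show ?thesis by (simp add: subring_set_def)
qed

text \<open>Primes contained in \<open>Q\<close> can be recovered from their extensions to the
  localization through the numerators. The chain \<open>{0}\<close>, \<open>P\<close>,
  \<open>Q\<close> therefore survives as three distinct primes.\<close>

lemma localization_not_two_primes:
  fixes B :: "'f::field set"
  assumes B: "subring_set B" and Q: "prime_in B Q" and P: "prime_in B P" and "P \<subset> Q" "P \<noteq> {0}"
  shows "card {P. primeideal P (ring_on (localization B Q))} \<noteq> 2"
proof -
  note BD = subring_setD[OF B] and QD = prime_inD[OF Q]
  define L where "L = localization B Q"
  have L: "subring_set L" unfolding L_def by (rule subring_localization[OF B Q])
  define ext where "ext P = {p / s |p s. p \<in> P \<and> s \<in> B - Q}" for P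
  have s: "s * s' \<in> B - Q" if "s \<in> B - Q" "s' \<in> B - Q" for s s' using that BD(5) QD(6) by blast
  have contract: "r \<in> P" if P: "prime_in B P" "P \<subseteq> Q" and r: "r \<in> B" "s \<in> B - Q" "r / s \<in> ext P" for P r s
  proof -
    obtain p s' where p: "r / s = p / s'" "p \<in> P" "s' \<in> B - Q" using r(3) unfolding ext_def by blast
    have "s \<noteq> 0" "s' \<noteq> 0" using r p QD(2) by auto
    then have "r * s' = s * p" using p by (simp add: field_simps)
    then have "r * s' \<in> P" using prime_inD(5)[OF P(1) p(2)] r by auto
    then show ?thesis using prime_inD(6)[OF P(1)] r p P(2) by blast
  qed
  have prime: "prime_in L (ext P)" if P: "prime_in B P" "P \<subseteq> Q" for P
  proof -
    note PD = prime_inD[OF P(1)]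
    have 1: "1 \<in> B - Q" using BD(2) QD(3) by blast
    have "ext P \<subseteq> L" using PD(1) unfolding ext_def L_def localization_def by blast
    moreover have "0 \<in> ext P" unfolding ext_def using PD(2) 1 by (intro CollectI exI[of _ 0] exI[of _ 1]) auto
    moreover have "1 \<notin> ext P" using contract[OF P BD(2) 1] PD(3) by auto
    moreover have "x + y \<in> ext P" if xy: "x \<in> ext P" "y \<in> ext P" for x y
    proof -
      obtain p s' q s'' where x: "x = p / s'" "p \<in> P" "s' \<in> B - Q" and y: "y = q / s''" "q \<in> P" "s'' \<in> B - Q"
        using xy unfolding ext_def by blast
      have "s' \<noteq> 0" "s'' \<noteq> 0" using x y QD(2) by auto
      then have "x + y = (s'' * p + s' * q) / (s' * s'')" using x y by (simp add: field_simps)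
      moreover have "s'' * p + s' * q \<in> P" using PD(4,5) x y by blast
      ultimately show ?thesis unfolding ext_def using s[OF x(3) y(3)] by blast
    qed
    moreover have "r * x \<in> ext P" if rx: "x \<in> ext P" "r \<in> L" for r x
    proof -
      obtain p s' q s'' where x: "x = p / s'" "p \<in> P" "s' \<in> B - Q" and r: "r = q / s''" "q \<in> B" "s'' \<in> B - Q"
        using rx unfolding ext_def L_def localization_def by blast
      have "r * x = (q * p) / (s'' * s')" using x r by simp
      moreover have "q * p \<in> P" using PD(5) x r by blast
      ultimately show ?thesis unfolding ext_def using s[OF r(3) x(3)] by blast
    qed
    moreover have "x \<in> ext P \<or> y \<in> ext P" if xy: "x \<in> L" "y \<in> L" "x * y \<in> ext P" for x y
    proof -
      obtain p s' q s'' where x: "x = p / s'" "p \<in> B" "s' \<in> B - Q" and y: "y = q / s''" "q \<in> B" "s'' \<in> B - Q"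
        using xy(1,2) unfolding L_def localization_def by blast
      have "(p * q) / (s' * s'') \<in> ext P" using xy(3) x y by simp
      then have "p * q \<in> P" using contract[OF P BD(5)[OF x(2) y(2)] s[OF x(3) y(3)]] by blast
      then have "p \<in> P \<or> q \<in> P" using PD(6) x y by blast
      then show ?thesis using x y unfolding ext_def by blast
    qed
    ultimately show ?thesis by (simp add: prime_in_def)
  qed
  have inj: "P \<subseteq> P'" if "prime_in B P" "prime_in B P'" "P' \<subseteq> Q" "ext P = ext P'" for P P'
  proof
    fix x assume "x \<in> P"
    moreover have 1: "1 \<in> B - Q" using BD(2) QD(3) by blast
    ultimately have "x / 1 \<in> ext P'" using that(4) unfolding ext_def by blast
    then show "x \<in> P'" using contract[OF that(2,3) _ 1] \<open>x \<in> P\<close> prime_inD(1)[OF that(1)] by blast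
  qed
  have 0: "prime_in B {0}" by (rule prime_in_zero[OF B])
  have "ext {0} \<noteq> ext P" "ext {0} \<noteq> ext Q" "ext P \<noteq> ext Q"
    using inj[OF P 0] inj[OF Q 0] inj[OF Q P] assms(4,5) prime_inD(2)[OF P] QD(2) by auto
  then show ?thesis
    using not_two_primes[OF L prime[OF 0] prime[OF P] prime[OF Q]] assms(4) QD(2) unfolding L_def by auto
qed

section \<open>Valuations of the field of fractions\<close>

text \<open>A common frame for the two kinds of valuations that occur on the blowup: the
  multiplicity at (1,1,1) and the multiplicity of a prime polynomial.\<close>

locale poly_valuation =
  fixes w :: "'a::idom \<Rightarrow> nat"
  assumes w_mult: "G \<noteq> 0 \<Longrightarrow> H \<noteq> 0 \<Longrightarrow> w (G * H) = w G + w H"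
    and w_add: "G \<noteq> 0 \<Longrightarrow> H \<noteq> 0 \<Longrightarrow> G + H \<noteq> 0 \<Longrightarrow> min (w G) (w H) \<le> w (G + H)"

definition frac_val :: "('a::idom \<Rightarrow> nat) \<Rightarrow> 'a fract \<Rightarrow> int" where
  "frac_val w q = (SOME n. \<exists>G H. G \<noteq> 0 \<and> H \<noteq> 0 \<and> q = Fract G H \<and> n = int (w G) - int (w H))"

lemma Fract_eq_0_iff: "H \<noteq> 0 \<Longrightarrow> Fract G H = 0 \<longleftrightarrow> G = 0" for G H :: "'a::idom"
  by (simp add: Zero_fract_def eq_fract)

lemma Fract_nonzero_cases:
  fixes q :: "'a::idom fract"
  assumes "q \<noteq> 0"
  obtains G H where "q = Fract G H" "G \<noteq> 0" "H \<noteq> 0"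
proof -
  obtain G H where "q = Fract G H" "H \<noteq> 0" by (cases q)
  then show ?thesis using that assms by (cases "G = 0") (auto simp: Fract_eq_0_iff)
qed

context poly_valuation
begin

lemma frac_val_Fract:
  assumes "G \<noteq> 0" "H \<noteq> 0"
  shows "frac_val w (Fract G H) = int (w G) - int (w H)"
  unfolding frac_val_def
proof (rule some_equality)
  fix n assume "\<exists>G' H'. G' \<noteq> 0 \<and> H' \<noteq> 0 \<and> Fract G H = Fract G' H' \<and> n = int (w G') - int (w H')"
  then obtain G' H' where *: "G' \<noteq> 0" "H' \<noteq> 0" "Fract G H = Fract G' H'" "n = int (w G') - int (w H')" by blast
  then have "G * H' = G' * H" using assms by (simp add: eq_fract)
  then have "w (G * H') = w (G' * H)" by simp
  then show "n = int (w G) - int (w H)" using * assms by (simp add: w_mult)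
qed (use assms in blast)

lemma frac_val_mult:
  assumes "q \<noteq> 0" "q' \<noteq> 0"
  shows "frac_val w (q * q') = frac_val w q + frac_val w q'"
proof -
  obtain G H where q: "q = Fract G H" "G \<noteq> 0" "H \<noteq> 0" using Fract_nonzero_cases[OF assms(1)] .
  obtain G' H' where q': "q' = Fract G' H'" "G' \<noteq> 0" "H' \<noteq> 0" using Fract_nonzero_cases[OF assms(2)] .
  show ?thesis using q q' by (simp add: frac_val_Fract w_mult)
qed

lemma frac_val_add:
  assumes "q \<noteq> 0" "q' \<noteq> 0" "q + q' \<noteq> 0"
  shows "min (frac_val w q) (frac_val w q') \<le> frac_val w (q + q')"
proof -
  obtain G H where q: "q = Fract G H" "G \<noteq> 0" "H \<noteq> 0" using Fract_nonzero_cases[OF assms(1)] .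
  obtain G' H' where q': "q' = Fract G' H'" "G' \<noteq> 0" "H' \<noteq> 0" using Fract_nonzero_cases[OF assms(2)] .
  have sum: "q + q' = Fract (G * H' + G' * H) (H * H')" using q q' by simp
  have nz: "H * H' \<noteq> 0" using q q' by simp
  then have nz': "G * H' + G' * H \<noteq> 0" using assms(3) unfolding sum by (simp add: Fract_eq_0_iff)
  have "min (w (G * H')) (w (G' * H)) \<le> w (G * H' + G' * H)" using q q' nz' by (intro w_add) auto
  then have "min (w G + w H') (w G' + w H) \<le> w (G * H' + G' * H)" using q q' by (simp add: w_mult)
  moreover have "frac_val w (q + q') = int (w (G * H' + G' * H)) - int (w H + w H')"
    unfolding sum frac_val_Fract[OF nz' nz] using q q' by (simp add: w_mult)
  ultimately show ?thesis using q q' by (simp add: frac_val_Fract)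
qed

lemma w_1 [simp]: "w 1 = 0"
  using w_mult[of 1 1] by simp

lemma w_power: "G \<noteq> 0 \<Longrightarrow> w (G ^ n) = n * w G"
  by (induction n) (auto simp: w_mult)

end

subsection \<open>Order of vanishing along an irreducible polynomial\<close>

definition pmult :: "'a::comm_semiring_1 \<Rightarrow> 'a \<Rightarrow> nat" where
  "pmult F G = (GREATEST n. F ^ n dvd G)"

lemma prime_power_dvd_mult_prime:
  fixes F p G :: "'a::idom"
  assumes F: "prime_elem F" and p: "prime_elem p" and dvd: "F ^ Suc n dvd p * G"
  shows "F ^ n dvd G"
  using dvd
proof (induction n arbitrary: G)
  case (Suc n)
  show ?case
  proof (cases "F dvd p")
    case True
    then obtain u where u: "p = F * u" by (elim dvdE)
    have nz: "F \<noteq> 0" using F by auto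
    have dvd: "F ^ Suc n dvd u * G" using Suc.prems nz by (simp add: u ac_simps)
    have "u dvd 1"
      using Factorial_Ring.irreducibleD[OF prime_elem_imp_irreducible[OF p] u] prime_elem_not_unit[OF F] by blast
    then obtain v where v: "u * v = 1" by (metis dvdE)
    have "F ^ Suc n dvd v * (u * G)" by (rule dvd_mult[OF dvd])
    moreover have "v * (u * G) = u * v * G" by (simp only: ac_simps)
    ultimately have "F ^ Suc n dvd u * v * G" by (simp only:)
    then show ?thesis unfolding v by (simp only: mult_1_left)
  next
    case False
    have "F dvd p * G" using dvd_trans[OF _ Suc.prems, of F] by simp
    then have "F dvd G" using False prime_elem_dvd_mult_iff[OF F, of p G] by simp
    then obtain G' where G': "G = F * G'" by (elim dvdE)
    have "F \<noteq> 0" using F by auto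
    then have "F ^ Suc n dvd p * G'" using Suc.prems unfolding G' by (simp add: mult.left_commute)
    then have "F ^ n dvd G'" by (rule Suc.IH)
    then show ?thesis by (simp add: G')
  qed
qed simp

text \<open>Removing one prime factor from \<open>G\<close> costs at most one power of
  \<open>F\<close>, so the number of prime factors is a bound. This gives meaning to the
  \<open>GREATEST\<close> in \<open>pmult\<close>.\<close>

lemma prime_power_bounded:
  fixes F G :: "'a::ufd"
  assumes F: "prime_elem F" and G: "G \<noteq> 0"
  shows "\<exists>N. \<forall>n. F ^ n dvd G \<longrightarrow> n \<le> N"
proof (cases "G dvd 1")
  case True
  have "n = 0" if "F ^ n dvd G" for n
  proof (rule ccontr)
    assume "n \<noteq> 0"
    then have "F dvd F ^ n" by simp
    then have "F dvd 1" by (rule dvd_trans[OF dvd_trans[OF _ that] True])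
    then show False using prime_elem_not_unit[OF F] by blast
  qed
  then show ?thesis by blast
next
  case False
  then obtain M where M: "mset_factors M G" using mset_factors_exist[OF G] by blast
  have "\<forall>n. F ^ n dvd prod_mset M \<longrightarrow> n \<le> size M" if "\<And>p. p \<in># M \<Longrightarrow> prime_elem p" for M
    using that
  proof (induction M)
    case empty
    have "n = 0" if "F ^ n dvd 1" for n
    proof (rule ccontr)
      assume "n \<noteq> 0"
      then have "F dvd F ^ n" by simp
      then have "F dvd 1" using dvd_trans[OF _ that, of F] by blast
      then show False using prime_elem_not_unit[OF F] by blast
    qed
    then show ?case by simp
  next
    case (add p M)
    show ?case
    proof (intro allI impI)
      fix n assume n: "F ^ n dvd prod_mset (add_mset p M)"
      show "n \<le> size (add_mset p M)"
      proof (cases n)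
        case (Suc n')
        then have "F ^ n' dvd prod_mset M"
          using prime_power_dvd_mult_prime[OF F, of p n' "prod_mset M"] n add.prems by simp
        then show ?thesis using add Suc by simp
      qed simp
    qed
  qed
  then show ?thesis using M by (metis mset_factorsD(1,3) prime_elem_iff_irreducible)
qed

lemma power_dvd_iff_pmult:
  fixes F G :: "'a::ufd"
  assumes F: "prime_elem F" and G: "G \<noteq> 0"
  shows "F ^ n dvd G \<longleftrightarrow> n \<le> pmult F G"
proof -
  obtain N where N: "\<And>n. F ^ n dvd G \<Longrightarrow> n \<le> N" using prime_power_bounded[OF assms] by blast
  have "F ^ 0 dvd G" by simp
  then have "F ^ pmult F G dvd G" unfolding pmult_def using N by (rule GreatestI_nat) auto
  then have "F ^ n dvd G" if "n \<le> pmult F G" using that by (meson dvd_trans le_imp_power_dvd)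
  moreover have "n \<le> pmult F G" if "F ^ n dvd G" unfolding pmult_def using that N by (intro Greatest_le_nat) auto
  ultimately show ?thesis by blast
qed

lemma pmult_decompose:
  fixes F G :: "'a::ufd"
  assumes F: "prime_elem F" and G: "G \<noteq> 0"
  obtains G' where "G = F ^ pmult F G * G'" "\<not> F dvd G'"
proof -
  have "F ^ pmult F G dvd G" using power_dvd_iff_pmult[OF assms] by blast
  then obtain G' where G': "G = F ^ pmult F G * G'" by (elim dvdE)
  have "\<not> F dvd G'"
  proof
    assume "F dvd G'"
    then have "F ^ Suc (pmult F G) dvd G" by (subst G') (simp add: mult_dvd_mono mult.commute)
    then show False using power_dvd_iff_pmult[OF assms, of "Suc (pmult F G)"] by simp
  qed
  with G' show ?thesis using that by blast
qed

lemma pmult_eqI: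
  fixes F G :: "'a::ufd"
  assumes F: "prime_elem F" and G: "G = F ^ n * G'" "\<not> F dvd G'"
  shows "pmult F G = n"
proof -
  have nz: "F \<noteq> 0" "G' \<noteq> 0" using F G by auto
  then have G0: "G \<noteq> 0" using G by simp
  have "n \<le> pmult F G" using power_dvd_iff_pmult[OF F G0, of n] by (simp add: G(1))
  moreover have "\<not> Suc n \<le> pmult F G"
  proof
    assume "Suc n \<le> pmult F G"
    then have "F ^ Suc n dvd G" using power_dvd_iff_pmult[OF F G0] by blast
    then have "F ^ n * F dvd F ^ n * G'" unfolding G(1) by (simp add: mult.commute)
    then show False using nz G(2) by simp
  qed
  ultimately show ?thesis by simp
qed

lemma poly_valuation_pmult:
  fixes F :: "'a::ufd"
  assumes F: "prime_elem F"
  shows "poly_valuation (pmult F)"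
proof
  fix G H :: 'a assume nz: "G \<noteq> 0" "H \<noteq> 0"
  obtain G' where G': "G = F ^ pmult F G * G'" "\<not> F dvd G'" using pmult_decompose[OF F nz(1)] .
  obtain H' where H': "H = F ^ pmult F H * H'" "\<not> F dvd H'" using pmult_decompose[OF F nz(2)] .
  have "G * H = F ^ (pmult F G + pmult F H) * (G' * H')"
    by (subst G'(1), subst H'(1)) (simp add: power_add ac_simps)
  moreover have "\<not> F dvd G' * H'" using G'(2) H'(2) prime_elem_dvd_mult_iff[OF F, of G' H'] by simp
  ultimately show "pmult F (G * H) = pmult F G + pmult F H" by (rule pmult_eqI[OF F])
  assume nz': "G + H \<noteq> 0"
  have "F ^ min (pmult F G) (pmult F H) dvd G + H"
    by (intro dvd_add) (simp_all add: power_dvd_iff_pmult[OF F nz(1)] power_dvd_iff_pmult[OF F nz(2)])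
  then show "min (pmult F G) (pmult F H) \<le> pmult F (G + H)"
    by (rule power_dvd_iff_pmult[OF F nz', THEN iffD1])
qed

lemma poly_valuation_mult_one: "poly_valuation mult_one"
  by (rule poly_valuation.intro) (rule mult_one_mult mult_one_add; assumption)+

section \<open>The weighted projective plane\<close>

lemma Fract_mult_cancel: "G \<noteq> 0 \<Longrightarrow> H \<noteq> 0 \<Longrightarrow> Fract (G * F) (G * H) = Fract F H" for F G H :: "'a::idom"
  by (simp add: eq_fract)

lemma homogeneous_cancel_left:
  fixes F G :: "'k::field poly3"
  assumes "homogeneous a b c d (F * G)" "homogeneous a b c d' F" "F \<noteq> 0"
  shows "homogeneous a b c (d - d') G"
proof (cases "G = 0")
  case False
  then have "F * G \<noteq> 0" using assms by simp
  then obtain d1 d2 where *: "homogeneous a b c d1 F" "homogeneous a b c d2 G" "d = d1 + d2"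
    using homogeneous_factor[OF assms(1)] by metis
  then have "d1 = d'" using homogeneous_degree_unique assms by blast
  then show ?thesis using * by simp
qed simp

text \<open>With the weights (1,0,0), (0,1,0) and (0,0,1), degree 0 means that \<open>x\<close>,
  \<open>y\<close> or \<open>z\<close> does not occur. In this way the factor lemma for homogeneous
  polynomials also controls which variables a divisor can contain.\<close>

lemma unit_if_no_variables:
  fixes F :: "'k::field poly3"
  assumes "homogeneous 1 0 0 0 F" "homogeneous 0 1 0 0 F" "homogeneous 0 0 1 0 F" "F \<noteq> 0"
  shows "F dvd 1"
proof -
  define u where "u = cf F (0,0,0)"
  have *: "F = mon u (0,0,0)"
  proof (rule cf_eqI)
    fix P
    have "cf F P \<noteq> 0 \<Longrightarrow> P = (0,0,0)"
      using assms(1-3) by (cases P) (auto simp: homogeneous_iff_cf wdeg_def)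
    then show "cf F P = cf (mon u (0,0,0)) P" by (auto simp: u_def)
  qed
  then have "u \<noteq> 0" using assms(4) by auto
  then have "F * mon (inverse u) (0,0,0) = 1" by (simp add: * mon_mult)
  then show ?thesis by (metis dvd_triv_left)
qed

lemma factor_mon:
  fixes F :: "'k::field poly3"
  assumes "F dvd mon u P" "u \<noteq> 0" "wdeg a b c P = 0"
  shows "homogeneous a b c 0 F"
proof -
  obtain G where G: "mon u P = F * G" using assms(1) by (elim dvdE)
  have "mon u P \<noteq> 0"
  proof
    assume "mon u P = 0"
    then have "cf (mon u P) P = 0" by simp
    then show False using assms(2) by simp
  qed
  moreover have "homogeneous a b c 0 (F * G)" unfolding G[symmetric] by (rule homogeneous_mon[OF assms(3)])
  ultimately obtain d1 d2 where "homogeneous a b c d1 F" "0 = d1 + d2"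
    using homogeneous_factor[of a b c 0 F G] G by metis
  then show ?thesis by simp
qed

lemma prime_not_dvd_two_variables:
  fixes F :: "'k::field poly3"
  assumes "prime_elem F"
  shows "\<not> (F dvd varx \<and> F dvd vary)" "\<not> (F dvd varx \<and> F dvd varz)" "\<not> (F dvd vary \<and> F dvd varz)"
proof -
  have F: "F \<noteq> 0" "\<not> F dvd 1" using assms prime_elem_not_unit by auto
  show "\<not> (F dvd varx \<and> F dvd vary)"
    using unit_if_no_variables[OF _ _ _ F(1)] F(2)
      factor_mon[of F 1 "(1,0,0)" 0 1 0] factor_mon[of F 1 "(0,1,0)" 1 0 0] factor_mon[of F 1 "(1,0,0)" 0 0 1]
    by (auto simp: wdeg_def)
  show "\<not> (F dvd varx \<and> F dvd varz)"
    using unit_if_no_variables[OF _ _ _ F(1)] F(2)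
      factor_mon[of F 1 "(1,0,0)" 0 1 0] factor_mon[of F 1 "(0,0,1)" 1 0 0] factor_mon[of F 1 "(1,0,0)" 0 0 1]
    by (auto simp: wdeg_def)
  show "\<not> (F dvd vary \<and> F dvd varz)"
    using unit_if_no_variables[OF _ _ _ F(1)] F(2)
      factor_mon[of F 1 "(0,0,1)" 0 1 0] factor_mon[of F 1 "(0,1,0)" 1 0 0] factor_mon[of F 1 "(0,1,0)" 0 0 1]
    by (auto simp: wdeg_def)
qed

lemma subring_UNIV: "subring_set UNIV"
  by (simp add: subring_set_def)

lemma primeideal_UNIV: "primeideal P ring_of_type_algebra \<longleftrightarrow> prime_in UNIV P"
  using primeideal_iff[OF subring_UNIV] by (simp add: ring_on_UNIV)

lemma prime_in_multiples: "prime_elem F \<Longrightarrow> prime_in UNIV {G. F dvd G}" for F :: "'r::idom"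
  by (auto simp: prime_in_def prime_elem_dvd_mult_iff prime_elem_not_unit)

lemma genideal_eqI:
  assumes "prime_in UNIV P" "T \<subseteq> P" "\<And>I. ideal I ring_of_type_algebra \<Longrightarrow> T \<subseteq> I \<Longrightarrow> P \<subseteq> I"
  shows "genideal ring_of_type_algebra T = P"
proof -
  interpret ring "ring_of_type_algebra :: 'a ring" by (rule ring_from_type_algebra)
  have T: "T \<subseteq> carrier ring_of_type_algebra" by (simp add: ring_of_type_algebra_def)
  have "ideal P ring_of_type_algebra"
    using assms(1) primeideal_UNIV primeideal.axioms(1) by blast
  then have "genideal ring_of_type_algebra T \<subseteq> P" using assms(2) by (rule genideal_minimal)
  moreover have "P \<subseteq> genideal ring_of_type_algebra T"
    using assms(3) genideal_ideal[OF T] genideal_self[OF T] by blast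
  ultimately show ?thesis by blast
qed

lemma ideal_type_algebraD:
  assumes "ideal I ring_of_type_algebra"
  shows "0 \<in> I" "x \<in> I \<Longrightarrow> y \<in> I \<Longrightarrow> x + y \<in> I" "x \<in> I \<Longrightarrow> r * x \<in> I"
proof -
  interpret ideal I ring_of_type_algebra by fact
  show "0 \<in> I" using additive_subgroup.zero_closed[OF is_additive_subgroup] by (simp add: ring_of_type_algebra_def)
  show "x \<in> I \<Longrightarrow> y \<in> I \<Longrightarrow> x + y \<in> I"
    using additive_subgroup.a_closed[OF is_additive_subgroup, of x y] by (simp add: ring_of_type_algebra_def)
  show "x \<in> I \<Longrightarrow> r * x \<in> I" using I_l_closed[of x r] by (simp add: ring_of_type_algebra_def)
qed

lemma ideal_type_algebra_sum:
  assumes "ideal I ring_of_type_algebra" "\<And>i. i \<in> A \<Longrightarrow> f i \<in> I"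
  shows "(\<Sum>i\<in>A. f i) \<in> I"
  using assms(2) by (induction A rule: infinite_finite_induct) (auto intro: ideal_type_algebraD[OF assms(1)])

section \<open>The function field and the valuation rings of curves\<close>

locale weighted_plane =
  fixes a b c :: nat and ty :: "'k::field itself"
  assumes abc: "a > 0" "b > 0" "c > 0" and gcd_abc: "gcd a (gcd b c) = 1"
begin

abbreviation hom :: "nat \<Rightarrow> 'k poly3 \<Rightarrow> bool" where
  "hom \<equiv> homogeneous a b c"

definition K :: "'k poly3 fract set" where
  "K = {Fract G H |G H d. hom d G \<and> hom d H \<and> H \<noteq> 0}"

lemma hom_vars: "hom a varx" "hom b vary" "hom c varz"
  by (rule homogeneous_mon; simp add: wdeg_def)+

lemma KI: "hom d G \<Longrightarrow> hom d H \<Longrightarrow> H \<noteq> 0 \<Longrightarrow> Fract G H \<in> K"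
  unfolding K_def by blast

lemma KE:
  assumes "q \<in> K"
  obtains G H d where "q = Fract G H" "hom d G" "hom d H" "H \<noteq> 0"
  using assms unfolding K_def by blast

lemma subring_K: "subring_set K"
proof -
  have "q - q' \<in> K \<and> q * q' \<in> K" if "q \<in> K" "q' \<in> K" for q q'
  proof -
    obtain G H d where q: "q = Fract G H" "hom d G" "hom d H" "H \<noteq> 0" using \<open>q \<in> K\<close> by (rule KE)
    obtain G' H' d' where q': "q' = Fract G' H'" "hom d' G'" "hom d' H'" "H' \<noteq> 0" using \<open>q' \<in> K\<close> by (rule KE)
    have "hom (d + d') (G * H' - G' * H)"
      using homogeneous_mult[OF q(2) q'(3)] homogeneous_mult[OF q'(2) q(3)] by (intro homogeneous_diff) (simp_all add: add.commute)
    then have "Fract (G * H' - G' * H) (H * H') \<in> K" using q q' by (intro KI[of "d + d'"] homogeneous_mult) auto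
    moreover have "Fract (G * G') (H * H') \<in> K" using q q' by (intro KI[of "d + d'"] homogeneous_mult) auto
    ultimately show ?thesis using q q' by simp
  qed
  moreover have "1 \<in> K" using KI[OF homogeneous_1 homogeneous_1] by (simp add: One_fract_def)
  ultimately show ?thesis by (simp add: subring_set_def)
qed

lemma K_inverse: "q \<in> K \<Longrightarrow> inverse q \<in> K"
proof (cases "q = 0")
  case True
  then show ?thesis using subring_setD(1)[OF subring_K] by simp
next
  case False
  assume "q \<in> K"
  then obtain G H d where q: "q = Fract G H" "hom d G" "hom d H" "H \<noteq> 0" by (rule KE)
  then have "G \<noteq> 0" using False by (auto simp: Fract_eq_0_iff)
  then show ?thesis using q by (auto intro: KI)
qed

text \<open>The power makes the degree of \<open>G\<close> divisible by the weight of the variable.\<close>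

definition dehom :: "nat \<Rightarrow> 'k poly3 \<Rightarrow> nat \<Rightarrow> 'k poly3 \<Rightarrow> 'k poly3 fract" where
  "dehom w T d G = Fract (G ^ w) (T ^ d)"

lemma dehom_in_K: "hom w T \<Longrightarrow> T \<noteq> 0 \<Longrightarrow> hom d G \<Longrightarrow> dehom w T d G \<in> K"
  unfolding dehom_def 
  using homogeneous_power[of a b c d G w] homogeneous_power[of a b c w T d]
  by (intro KI[of "w * d"]) (simp_all add: mult.commute)

lemma vars_nonzero: "varx \<noteq> (0 :: 'k poly3)" "vary \<noteq> (0 :: 'k poly3)" "varz \<noteq> (0 :: 'k poly3)"
  by (metis cf_mon cf_0 zero_neq_one)+

text \<open>Provides denominators for fractions of degree zero: \<open>T\<close> has positive degree
  and is not divisible by \<open>F\<close>. Its value 1 at (1,1,1) keeps it outside the ideal of the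
  identity point, too.\<close>

lemma variable_not_in:
  fixes F :: "'k poly3"
  assumes "prime_elem F"
  obtains w T where "w > 0" "hom w T" "T \<noteq> 0" "\<not> F dvd T" "eval3 T 1 1 1 = 1"
proof (cases "F dvd varx")
  case True
  then have "\<not> F dvd vary" using prime_not_dvd_two_variables(1)[OF assms] by blast
  then show ?thesis using that[of b vary] hom_vars abc vars_nonzero by (simp add: eval3_mon)
next
  case False
  then show ?thesis using that[of a varx] hom_vars abc vars_nonzero by (simp add: eval3_mon)
qed

lemma discrete_valuation_K:
  assumes "poly_valuation w" "\<exists>q\<in>K. q \<noteq> 0 \<and> frac_val w q \<noteq> 0"
  shows "discrete_valuation K (frac_val w)"
proof -
  interpret poly_valuation w by fact
  show ?thesis
    by (rule discrete_valuation.intro)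
      (use subring_K K_inverse frac_val_mult frac_val_add assms(2) in \<open>simp_all only: mult_ac\<close>)
qed

definition vring :: "('k poly3 \<Rightarrow> nat) \<Rightarrow> 'k poly3 fract set" where
  "vring w = {q \<in> K. q = 0 \<or> frac_val w q \<ge> 0}"

lemma vring_eq: "discrete_valuation K (frac_val w) \<Longrightarrow> discrete_valuation.O_ring K (frac_val w) = vring w"
  unfolding discrete_valuation.O_ring_def vring_def by simp

lemma discrete_valuation_pmult:
  assumes F: "prime_elem F" and hF: "hom d F"
  shows "discrete_valuation K (frac_val (pmult F))"
proof (rule discrete_valuation_K[OF poly_valuation_pmult[OF F]])
  interpret poly_valuation "pmult F" by (rule poly_valuation_pmult[OF F])
  obtain w T where T: "w > 0" "hom w T" "T \<noteq> 0" "\<not> F dvd T" by (rule variable_not_in[OF F])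
  have F0: "F \<noteq> 0" using F by auto
  have "pmult F F = 1" by (rule pmult_eqI[OF F, of _ _ 1]) (use prime_elem_not_unit[OF F] in auto)
  moreover have "pmult F T = 0" by (rule pmult_eqI[OF F, of _ _ T]) (use T in auto)
  ultimately have "frac_val (pmult F) (dehom w T d F) = w"
    unfolding dehom_def using T F0 by (subst frac_val_Fract) (auto simp: w_power)
  moreover have "dehom w T d F \<noteq> 0" unfolding dehom_def using T F0 by (simp add: Fract_eq_0_iff)
  ultimately show "\<exists>q\<in>K. q \<noteq> 0 \<and> frac_val (pmult F) q \<noteq> 0"
    using dehom_in_K[OF T(2,3) hF] T(1) by (intro bexI[of _ "dehom w T d F"]) auto
qed

text \<open>When the multiplicity of a fraction is nonnegative, the full power of \<open>F\<close>
  in the denominator also divides the numerator. Cancelling it leaves a homogeneous denominator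
  prime to \<open>F\<close>.\<close>

lemma proj_local_ring_prime_elem:
  assumes F: "prime_elem F" and hF: "hom dF F"
  shows "proj_local_ring a b c {G. F dvd G} = vring (pmult F)"
proof (intro equalityI subsetI)
  interpret poly_valuation "pmult F" by (rule poly_valuation_pmult[OF F])
  fix q assume "q \<in> proj_local_ring a b c {G. F dvd G}"
  then obtain G H d where q: "q = Fract G H" "hom d G" "hom d H" "\<not> F dvd H"
    unfolding proj_local_ring_def by blast
  then have H: "H \<noteq> 0" by auto
  have "pmult F H = 0" by (rule pmult_eqI[OF F, of _ _ H]) (use q in auto)
  then have "frac_val (pmult F) q \<ge> 0" if "q \<noteq> 0"
    using that q H by (cases "G = 0") (auto simp: frac_val_Fract Fract_eq_0_iff)
  then show "q \<in> vring (pmult F)" unfolding vring_def using KI[OF q(2,3) H] q(1) by auto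
next
  interpret poly_valuation "pmult F" by (rule poly_valuation_pmult[OF F])
  fix q assume q: "q \<in> vring (pmult F)"
  then obtain G H d where GH: "q = Fract G H" "hom d G" "hom d H" "H \<noteq> 0"
    unfolding vring_def by (auto elim: KE)
  have F0: "F \<noteq> 0" using F by auto
  obtain H' where H': "H = F ^ pmult F H * H'" "\<not> F dvd H'" using pmult_decompose[OF F GH(4)] .
  have "F ^ pmult F H dvd G"
  proof (cases "G = 0")
    case False
    then have "q \<noteq> 0" using GH by (simp add: Fract_eq_0_iff)
    then have "frac_val (pmult F) q \<ge> 0" using q unfolding vring_def by auto
    then show ?thesis using False GH by (simp add: power_dvd_iff_pmult[OF F False] frac_val_Fract)
  qed simp
  then obtain G' where G': "G = F ^ pmult F H * G'" by (elim dvdE)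
  have Fn: "hom (pmult F H * dF) (F ^ pmult F H)" "F ^ pmult F H \<noteq> 0" using F0 by (simp_all add: homogeneous_power hF)
  have "H' \<noteq> 0" using H' by auto
  then have "q = Fract G' H'" unfolding GH(1) by (subst G', subst H'(1)) (rule Fract_mult_cancel[OF Fn(2)])
  moreover have "hom (d - pmult F H * dF) G'" using GH(2) by (subst (asm) G') (rule homogeneous_cancel_left[OF _ Fn])
  moreover have "hom (d - pmult F H * dF) H'" using GH(3) by (subst (asm) H'(1)) (rule homogeneous_cancel_left[OF _ Fn])
  ultimately show "q \<in> proj_local_ring a b c {G. F dvd G}"
    using H'(2) unfolding proj_local_ring_def by blast
qed

end

lemma prime_in_UNIV_ideal: "prime_in UNIV P \<Longrightarrow> ideal P ring_of_type_algebra"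
  using primeideal_UNIV primeideal.axioms(1) by blast

lemma prime_in_kernel:
  fixes H :: "'r::comm_ring_1 \<Rightarrow> 's::idom"
  assumes "comm_ring_hom H"
  shows "prime_in UNIV {F. H F = 0}"
proof -
  interpret comm_ring_hom H by fact
  show ?thesis unfolding prime_in_def by (simp add: hom_add hom_mult)
qed

lemma finite_sum_in_prime:
  assumes "prime_in UNIV P" "\<And>i. i \<in> A \<Longrightarrow> f i \<in> P"
  shows "(\<Sum>i\<in>A. f i) \<in> P"
  by (rule ideal_type_algebra_sum[OF prime_in_UNIV_ideal[OF assms(1)] assms(2)])

lemma (in comm_monoid_mult) dvd_prod_msetD: "x \<in># M \<Longrightarrow> x dvd prod_mset M"
  by (metis dvd_triv_left insert_DiffM prod_mset.add_mset)

context weighted_plane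
begin

section \<open>Homogeneous primes, their local rings and codimension one\<close>

lemma variables_in_imp_irrelevant:
  assumes P: "prime_in UNIV P" and vars: "varx \<in> P" "vary \<in> P" "varz \<in> P"
  shows "irrelevant_ideal a b c \<subseteq> (P :: 'k poly3 set)"
proof -
  interpret ring "ring_of_type_algebra :: 'k poly3 ring" by (rule ring_from_type_algebra)
  note I = ideal_type_algebraD[OF prime_in_UNIV_ideal[OF P]]
  have "F \<in> P" if F: "hom d F" and d: "d > 0" for F d
  proof -
    have "mon u Q \<in> P" if "wdeg a b c Q = d" for Q u
    proof -
      obtain i j l where Q: "Q = (i,j,l)" by (cases Q)
      have "i > 0 \<or> j > 0 \<or> l > 0" using that d by (auto simp: Q wdeg_def)
      moreover have "mon u (i,j,l) = mon u (i - 1,j,l) * varx" if "i > 0" using that by (simp add: mon_mult)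
      moreover have "mon u (i,j,l) = mon u (i,j - 1,l) * vary" if "j > 0" using that by (simp add: mon_mult)
      moreover have "mon u (i,j,l) = mon u (i,j,l - 1) * varz" if "l > 0" using that by (simp add: mon_mult)
      ultimately show ?thesis unfolding Q using I(3)[OF vars(1)] I(3)[OF vars(2)] I(3)[OF vars(3)] by metis
    qed
    then have "(\<Sum>Q\<in>supp F. mon (cf F Q) Q) \<in> P"
      using F by (intro finite_sum_in_prime[OF P]) (auto simp: homogeneous_iff_cf supp_def)
    then show ?thesis using sum_mon[of F] by simp
  qed
  then show ?thesis unfolding irrelevant_ideal_def
    by (intro genideal_minimal prime_in_UNIV_ideal[OF P]) auto
qed

lemma proj_pointI:
  assumes P: "prime_in UNIV P" and gen: "\<And>I. ideal I ring_of_type_algebra \<Longrightarrow> {F \<in> P. \<exists>d. hom d F} \<subseteq> I \<Longrightarrow> P \<subseteq> I"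
    and T: "hom w T" "w > 0" "T \<notin> P"
  shows "P \<in> proj_points a b c"
proof -
  interpret ring "ring_of_type_algebra :: 'k poly3 ring" by (rule ring_from_type_algebra)
  have "{F. \<exists>d>0. hom d F} \<subseteq> irrelevant_ideal a b c"
    unfolding irrelevant_ideal_def by (rule genideal_self) (simp add: ring_of_type_algebra_def)
  then have "\<not> irrelevant_ideal a b c \<subseteq> P" using T by blast
  moreover have "genideal ring_of_type_algebra {F \<in> P. \<exists>d. hom d F} = P"
    by (rule genideal_eqI[OF P _ gen]) auto
  ultimately show ?thesis unfolding proj_points_def using P by (simp add: primeideal_UNIV)
qed

lemma proj_pointD:
  assumes "P \<in> proj_points a b c"
  shows "prime_in UNIV P" "ideal I ring_of_type_algebra \<Longrightarrow> {F \<in> P. \<exists>d. hom d F} \<subseteq> I \<Longrightarrow> P \<subseteq> I"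
    "\<exists>w T. w > 0 \<and> hom w T \<and> T \<notin> P"
proof -
  interpret ring "ring_of_type_algebra :: 'k poly3 ring" by (rule ring_from_type_algebra)
  have 1: "prime_in UNIV P" and 2: "P = genideal ring_of_type_algebra {F \<in> P. \<exists>d. hom d F}"
    and 3: "\<not> irrelevant_ideal a b c \<subseteq> P"
    using assms unfolding proj_points_def primeideal_UNIV by blast+
  show "prime_in UNIV P" by (rule 1)
  show "P \<subseteq> I" if "ideal I ring_of_type_algebra" "{F \<in> P. \<exists>d. hom d F} \<subseteq> I" for I
    by (subst 2) (rule genideal_minimal[OF that])
  have "varx \<notin> P \<or> vary \<notin> P \<or> varz \<notin> P" using variables_in_imp_irrelevant[OF 1] 3 by blast
  then show "\<exists>w T. w > 0 \<and> hom w T \<and> T \<notin> P" using hom_vars abc by blast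
qed

definition ext_ideal :: "'k poly3 set \<Rightarrow> 'k poly3 set \<Rightarrow> 'k poly3 fract set" where
  "ext_ideal P P1 = {Fract G H |G H d. hom d G \<and> hom d H \<and> G \<in> P1 \<and> H \<notin> P}"

lemma proj_local_ringE:
  assumes "q \<in> proj_local_ring a b c P"
  obtains G H d where "q = Fract G H" "hom d G" "hom d H" "H \<notin> P"
  using assms unfolding proj_local_ring_def by blast

lemma proj_local_ringI: "hom d G \<Longrightarrow> hom d H \<Longrightarrow> H \<notin> P \<Longrightarrow> Fract G H \<in> proj_local_ring a b c P"
  unfolding proj_local_ring_def by blast

lemma ext_idealE:
  assumes "q \<in> ext_ideal P P1"
  obtains G H d where "q = Fract G H" "hom d G" "hom d H" "G \<in> P1" "H \<notin> P"
  using assms unfolding ext_ideal_def by blast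

lemma ext_idealI: "hom d G \<Longrightarrow> hom d H \<Longrightarrow> G \<in> P1 \<Longrightarrow> H \<notin> P \<Longrightarrow> Fract G H \<in> ext_ideal P P1"
  unfolding ext_ideal_def by blast

lemma not_in_prime_mult: "prime_in UNIV P \<Longrightarrow> H \<notin> P \<Longrightarrow> H' \<notin> P \<Longrightarrow> H * H' \<notin> P"
  using prime_inD(6)[of UNIV P H H'] by blast

lemma hom_cross: "hom d G \<Longrightarrow> hom d H \<Longrightarrow> hom d' G' \<Longrightarrow> hom d' H' \<Longrightarrow> hom (d + d') (G * H' + G' * H)"
  using homogeneous_mult[of a b c d G d' H'] homogeneous_mult[of a b c d' G' d H]
  by (intro homogeneous_add) (simp_all add: add.commute)

lemma subring_proj_local_ring:
  assumes P: "prime_in UNIV (P :: 'k poly3 set)"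
  shows "subring_set (proj_local_ring a b c P)"
proof -
  have "q - q' \<in> proj_local_ring a b c P \<and> q * q' \<in> proj_local_ring a b c P"
    if qq: "q \<in> proj_local_ring a b c P" "q' \<in> proj_local_ring a b c P" for q q'
  proof -
    obtain G H d where q: "q = Fract G H" "hom d G" "hom d H" "H \<notin> P" using qq(1) by (rule proj_local_ringE)
    obtain G' H' d' where q': "q' = Fract G' H'" "hom d' G'" "hom d' H'" "H' \<notin> P" using qq(2) by (rule proj_local_ringE)
    have nz: "H \<noteq> 0" "H' \<noteq> 0" using q q' prime_inD(2)[OF P] by auto
    have H: "H * H' \<notin> P" by (rule not_in_prime_mult[OF P q(4) q'(4)])
    have "hom (d + d') (G * H' + (- G') * H)" by (intro hom_cross homogeneous_minus q q')
    then have "Fract (G * H' - G' * H) (H * H') \<in> proj_local_ring a b c P"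
      using q q' H by (intro proj_local_ringI[of "d + d'"] homogeneous_mult) auto
    moreover have "Fract (G * G') (H * H') \<in> proj_local_ring a b c P"
      using q q' H by (intro proj_local_ringI[of "d + d'"] homogeneous_mult) auto
    ultimately show ?thesis using q q' nz by simp
  qed
  moreover have "1 \<in> proj_local_ring a b c P"
    using proj_local_ringI[OF homogeneous_1 homogeneous_1 prime_inD(3)[OF P]] by (simp add: One_fract_def)
  ultimately show ?thesis by (simp add: subring_set_def)
qed

lemma ext_ideal_contract:
  assumes P: "prime_in UNIV P" and P1: "prime_in UNIV P1" "P1 \<subseteq> P" and "Fract G H \<in> ext_ideal P P1" "H \<notin> P"
  shows "G \<in> P1"
proof -
  obtain G' H' d where *: "Fract G H = Fract G' H'" "G' \<in> P1" "H' \<notin> P" using assms(4) by (rule ext_idealE)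
  have "H \<noteq> 0" "H' \<noteq> 0" using * assms(5) prime_inD(2)[OF P] by auto
  then have "G * H' = H * G'" using *(1) by (simp add: eq_fract mult.commute)
  then have "G * H' \<in> P1" using prime_inD(5)[OF P1(1) *(2), of H] by simp
  then show ?thesis using prime_inD(6)[OF P1(1), of G H'] *(3) P1(2) by blast
qed

lemma prime_in_ext_ideal:
  assumes P: "prime_in UNIV P" and P1: "prime_in UNIV P1" "P1 \<subseteq> P"
  shows "prime_in (proj_local_ring a b c P) (ext_ideal P P1)"
proof -
  note PD = prime_inD[OF P1(1)]
  have "ext_ideal P P1 \<subseteq> proj_local_ring a b c P" unfolding ext_ideal_def proj_local_ring_def by blast
  moreover have "Fract 0 1 \<in> ext_ideal P P1"
    by (rule ext_idealI[OF homogeneous_0 homogeneous_1 PD(2) prime_inD(3)[OF P]])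
  then have "0 \<in> ext_ideal P P1" by (simp add: Zero_fract_def)
  moreover have "1 \<notin> ext_ideal P P1"
    using ext_ideal_contract[OF P P1, of 1 1] PD(3) prime_inD(3)[OF P] by (auto simp: One_fract_def)
  moreover have "q + q' \<in> ext_ideal P P1" if qq: "q \<in> ext_ideal P P1" "q' \<in> ext_ideal P P1" for q q'
  proof -
    obtain G H d where q: "q = Fract G H" "hom d G" "hom d H" "G \<in> P1" "H \<notin> P" using qq(1) by (rule ext_idealE)
    obtain G' H' d' where q': "q' = Fract G' H'" "hom d' G'" "hom d' H'" "G' \<in> P1" "H' \<notin> P" using qq(2) by (rule ext_idealE)
    have nz: "H \<noteq> 0" "H' \<noteq> 0" using q q' prime_inD(2)[OF P] by auto
    have "G * H' + G' * H \<in> P1"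
      using PD(4,5)[of "H' * G" "H * G'"] PD(5)[OF q(4), of H'] PD(5)[OF q'(4), of H] by (simp add: mult.commute)
    then have "Fract (G * H' + G' * H) (H * H') \<in> ext_ideal P P1"
      using not_in_prime_mult[OF P q(5) q'(5)] q q'
      by (intro ext_idealI[of "d + d'"] hom_cross homogeneous_mult) auto
    then show ?thesis using q q' nz by simp
  qed
  moreover have "r * q \<in> ext_ideal P P1" if qr: "q \<in> ext_ideal P P1" "r \<in> proj_local_ring a b c P" for q r
  proof -
    obtain G H d where q: "q = Fract G H" "hom d G" "hom d H" "G \<in> P1" "H \<notin> P" using qr(1) by (rule ext_idealE)
    obtain G' H' d' where r: "r = Fract G' H'" "hom d' G'" "hom d' H'" "H' \<notin> P" using qr(2) by (rule proj_local_ringE)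
    have "Fract (G' * G) (H' * H) \<in> ext_ideal P P1"
      using not_in_prime_mult[OF P r(4) q(5)] q r PD(5)[OF q(4), of G']
      by (intro ext_idealI[of "d' + d"] homogeneous_mult) auto
    then show ?thesis using q r by simp
  qed
  moreover have "q \<in> ext_ideal P P1 \<or> r \<in> ext_ideal P P1"
    if qr: "q \<in> proj_local_ring a b c P" "r \<in> proj_local_ring a b c P" "q * r \<in> ext_ideal P P1" for q r
  proof -
    obtain G H d where q: "q = Fract G H" "hom d G" "hom d H" "H \<notin> P" using qr(1) by (rule proj_local_ringE)
    obtain G' H' d' where r: "r = Fract G' H'" "hom d' G'" "hom d' H'" "H' \<notin> P" using qr(2) by (rule proj_local_ringE)
    have "Fract (G * G') (H * H') \<in> ext_ideal P P1" using qr(3) q r by simp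
    then have "G * G' \<in> P1" by (rule ext_ideal_contract[OF P P1 _ not_in_prime_mult[OF P q(4) r(4)]])
    then have "G \<in> P1 \<or> G' \<in> P1" using PD(6)[of G G'] by blast
    then show ?thesis using q r ext_idealI by blast
  qed
  ultimately show ?thesis by (simp add: prime_in_def)
qed

lemma not_in_prime_power: "prime_in UNIV P \<Longrightarrow> T \<notin> P \<Longrightarrow> T ^ n \<notin> P"
  using prime_in_powerD[OF subring_UNIV, of P T n] by blast

text \<open>The chain \<open>{0}\<close>, \<open>P1\<close>, \<open>P\<close> extends to the local
  ring. The homogeneous witnesses for its strictness become the fractions
  \<open>G ^ w / T ^ d\<close> of degree zero, where \<open>T\<close> is invertible at
  \<open>P\<close>.\<close>

lemma proj_not_two_primes:
  assumes P: "prime_in UNIV P" and P1: "prime_in UNIV P1" "P1 \<subseteq> P"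
    and T: "hom w T" "w > 0" "T \<notin> P"
    and G1: "hom d1 G1" "G1 \<in> P1" "G1 \<noteq> 0" and G2: "hom d2 G2" "G2 \<in> P" "G2 \<notin> P1"
  shows "card {Q. primeideal Q (ring_on (proj_local_ring a b c P))} \<noteq> 2"
proof -
  have P0: "prime_in UNIV {0 :: 'k poly3}" by (rule prime_in_zero[OF subring_UNIV])
  have P0': "{0} \<subseteq> P" using prime_inD(2)[OF P] by simp
  have deh: "hom (w * d) (G ^ w)" "hom (w * d) (T ^ d)" "T ^ d \<notin> P" if "hom d G" for d G
    using homogeneous_power[OF that, of w] homogeneous_power[OF T(1), of d] not_in_prime_power[OF P T(3)]
    by (simp_all add: mult.commute)
  have pow: "G ^ w \<in> Q" if "prime_in UNIV Q" "G \<in> Q" for G Q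
    using prime_inD(5)[OF that, of "G ^ (w - 1)"] T(2) by (cases w) (simp_all add: mult.commute)
  have 1: "Fract (G1 ^ w) (T ^ d1) \<in> ext_ideal P P1" "Fract (G1 ^ w) (T ^ d1) \<notin> ext_ideal P {0}"
    using ext_idealI[OF deh(1,2)[OF G1(1)] pow[OF P1(1) G1(2)] deh(3)[OF G1(1)]]
      ext_ideal_contract[OF P P0 P0' _ deh(3)[OF G1(1)], of "G1 ^ w"] G1(3) by auto
  have 2: "Fract (G1 ^ w) (T ^ d1) \<in> ext_ideal P P"
    using ext_idealI[OF deh(1,2)[OF G1(1)] pow[OF P] deh(3)[OF G1(1)]] G1(2) P1(2) by blast
  have 3: "Fract (G2 ^ w) (T ^ d2) \<in> ext_ideal P P" "Fract (G2 ^ w) (T ^ d2) \<notin> ext_ideal P P1"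
    using ext_idealI[OF deh(1,2)[OF G2(1)] pow[OF P G2(2)] deh(3)[OF G2(1)]]
      ext_ideal_contract[OF P P1 _ deh(3)[OF G2(1)], of "G2 ^ w"]
      prime_in_powerD[OF subring_UNIV P1(1), of G2 w] G2(3) by auto
  show ?thesis
    by (rule not_two_primes[OF subring_proj_local_ring[OF P] prime_in_ext_ideal[OF P P0 P0']
          prime_in_ext_ideal[OF P P1] prime_in_ext_ideal[OF P P order_refl]])
      (use 1 2 3 in blast)+
qed

lemma proj_local_ring_zero: "proj_local_ring a b c {0} = K"
  unfolding proj_local_ring_def K_def by simp

lemma zero_proj_point: "({0} :: 'k poly3 set) \<in> proj_points a b c"
  by (rule proj_pointI[OF prime_in_zero[OF subring_UNIV] _ hom_vars(1) abc(1)])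
    (use vars_nonzero in \<open>auto simp: subset_iff intro: homogeneous_0\<close>)

lemma prime_elem_proj_point:
  assumes F: "prime_elem F" and hF: "hom d F"
  shows "{G. F dvd G} \<in> proj_points a b c"
proof -
  obtain w T where T: "w > 0" "hom w T" "\<not> F dvd T" using variable_not_in[OF F] by blast
  show ?thesis
  proof (rule proj_pointI[OF prime_in_multiples[OF F] _ T(2,1)])
    fix I assume I: "ideal I ring_of_type_algebra" "{G \<in> {G. F dvd G}. \<exists>d. hom d G} \<subseteq> I"
    have "F \<in> I" by (rule subsetD[OF I(2)]) (use hF in auto)
    then have "H * F \<in> I" for H by (rule ideal_type_algebraD(3)[OF I(1)])
    then have "F * H \<in> I" for H by (simp only: mult.commute[of F])
    then show "{G. F dvd G} \<subseteq> I" unfolding dvd_def by force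
  qed (use T in simp)
qed

text \<open>A nonzero homogeneous element of \<open>P\<close> has a prime factor \<open>F\<close> in
  \<open>P\<close>, and \<open>F\<close> is homogeneous as a factor. A homogeneous element of
  \<open>P\<close> outside the multiples of \<open>F\<close> would produce three primes. For
  \<open>P = {0}\<close> the local ring is the field \<open>K\<close>, which has only one.\<close>

lemma proj_point_two_primes:
  assumes P: "P \<in> proj_points a b c" and two: "card {Q. primeideal Q (ring_on (proj_local_ring a b c P))} = 2"
  obtains F d where "prime_elem F" "hom d F" "P = {G. F dvd G}"
proof -
  note PD = proj_pointD[OF P]
  obtain w T where T: "w > 0" "hom w T" "T \<notin> P" using PD(3) by blast
  show ?thesis
  proof (cases "P = {0}")
    case True
    have "Q = {0}" if Q: "prime_in K Q" for Q
    proof (rule ccontr)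
      assume "Q \<noteq> {0}"
      then obtain x where x: "x \<in> Q" "x \<noteq> 0" using prime_inD(2)[OF Q] by (metis singletonD singletonI subsetI subset_antisym)
      have "x \<in> K" by (rule subsetD[OF prime_inD(1)[OF Q] x(1)])
      then have "inverse x * x \<in> Q" by (intro prime_inD(5)[OF Q x(1)] K_inverse)
      then show False using x(2) prime_inD(3)[OF Q] by simp
    qed
    then have "{Q. primeideal Q (ring_on K)} \<subseteq> {{0}}" unfolding primeideal_iff[OF subring_K] by blast
    then have "card {Q. primeideal Q (ring_on K)} \<le> card {{0 :: 'k poly3 fract}}" by (rule card_mono[rotated]) simp
    then show ?thesis using two unfolding True proj_local_ring_zero by simp
  next
    case False
    have "\<exists>G d. hom d G \<and> G \<in> P \<and> G \<noteq> 0"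
    proof (rule ccontr)
      assume *: "\<nexists>G d. hom d G \<and> G \<in> P \<and> G \<noteq> 0"
      have "P \<subseteq> {0}"
        by (rule PD(2)[OF prime_in_UNIV_ideal[OF prime_in_zero[OF subring_UNIV]]]) (use * in blast)
      then show False using False prime_inD(2)[OF PD(1)] by blast
    qed
    then obtain G d where G: "hom d G" "G \<in> P" "G \<noteq> 0" by blast
    have "\<not> G dvd 1"
    proof
      assume "G dvd 1"
      then obtain H where "1 = G * H" by (elim dvdE)
      then have "1 \<in> P" using prime_inD(5)[OF PD(1) G(2), of H] by (simp add: mult.commute)
      then show False using prime_inD(3)[OF PD(1)] by blast
    qed
    then obtain M where M: "mset_factors M G" using mset_factors_exist[OF G(3)] by blast
    have "\<exists>F\<in>#M. F \<in> P" if "prod_mset M \<in> P" for M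
      using that
    proof (induction M)
      case empty
      then show ?case using prime_inD(3)[OF PD(1)] by simp
    next
      case (add F M)
      then show ?case using prime_inD(6)[OF PD(1), of F "prod_mset M"] by auto
    qed
    then obtain F where F: "F \<in># M" "F \<in> P" using mset_factorsD(3)[OF M] G(2) by auto
    have pF: "prime_elem F" using mset_factorsD(1)[OF M F(1)] by simp
    have "F dvd G" using dvd_prod_msetD[OF F(1)] mset_factorsD(3)[OF M] by simp
    then obtain H where "G = F * H" by (elim dvdE)
    then obtain dF where hF: "hom dF F" using homogeneous_factor[of a b c d F H] G by metis
    have sub: "{G. F dvd G} \<subseteq> P"
    proof
      fix G assume "G \<in> {G. F dvd G}"
      then obtain H where H: "G = F * H" by (metis dvdE mem_Collect_eq)
      show "G \<in> P" using prime_inD(5)[OF PD(1) F(2), of H] unfolding H by (simp only: mult.commute[of F] UNIV_I simp_thms)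
    qed
    have "P = {G. F dvd G}"
    proof (rule ccontr)
      assume ne: "P \<noteq> {G. F dvd G}"
      have "\<exists>G2 d2. hom d2 G2 \<and> G2 \<in> P \<and> \<not> F dvd G2"
      proof (rule ccontr)
        assume *: "\<nexists>G2 d2. hom d2 G2 \<and> G2 \<in> P \<and> \<not> F dvd G2"
        have "P \<subseteq> {G. F dvd G}"
          by (rule PD(2)[OF prime_in_UNIV_ideal[OF prime_in_multiples[OF pF]]]) (use * in blast)
        then show False using sub ne by blast
      qed
      then obtain G2 d2 where G2: "hom d2 G2" "G2 \<in> P" "\<not> F dvd G2" by blast
      have F0: "F \<noteq> 0" using pF by auto
      show False
        using proj_not_two_primes[OF PD(1) prime_in_multiples[OF pF] sub T(2,1,3) hF _ F0 G2(1,2)] two G2(3) by simp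
    qed
    then show ?thesis by (rule that[OF pF hF])
  qed
qed

subsection \<open>The identity point of the torus\<close>

lemma eval3_diff: "eval3 (F - G) x y z = eval3 F x y z - eval3 G x y z"
  and eval3_mult: "eval3 (F * G) x y z = eval3 F x y z * eval3 G x y z"
  by (simp_all add: eval3_def)

text \<open>The kernel of the substitution \<open>F(u^a, u^b, u^c)\<close>, that is, the ideal of
  the orbit of (1,1,1). A kernel of a homomorphism to a domain is prime, and by
  \<open>grading\<close> it visibly consists of the polynomials whose homogeneous parts vanish at
  (1,1,1).\<close>

definition pt :: "'k poly3 set" where
  "pt = {F. map_poly (\<lambda>G. eval3 G 1 1 1) (grading a b c F) = 0}"

lemma prime_pt: "prime_in UNIV pt"
proof -
  interpret ev: comm_ring_hom "\<lambda>G. eval3 G 1 1 (1::'k)" by (rule comm_ring_hom_eval3)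
  interpret map: map_poly_comm_ring_hom "\<lambda>G. eval3 G 1 1 (1::'k)" ..
  interpret g: comm_ring_hom "grading a b c" by (rule comm_ring_hom_grading)
  show ?thesis unfolding pt_def
    by (intro prime_in_kernel) (unfold_locales; simp add: g.hom_add g.hom_mult map.hom_add map.hom_mult)
qed

lemma mem_pt_hom: "hom d G \<Longrightarrow> G \<in> pt \<longleftrightarrow> eval3 G 1 1 1 = 0"
proof -
  interpret ev: comm_ring_hom "\<lambda>G. eval3 G 1 1 (1::'k)" by (rule comm_ring_hom_eval3)
  assume "hom d G"
  then show ?thesis by (simp add: pt_def homogeneous_iff_grading)
qed

lemma pt_generated:
  assumes I: "ideal I ring_of_type_algebra" "{F. (\<exists>d. hom d F) \<and> eval3 F 1 1 1 = 0} \<subseteq> I"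
  shows "pt \<subseteq> I"
proof
  interpret ev: comm_ring_hom "\<lambda>G. eval3 G 1 1 (1::'k)" by (rule comm_ring_hom_eval3)
  fix F assume F: "F \<in> pt"
  have "coeff (grading a b c F) d \<in> I" for d
  proof -
    have "coeff (map_poly (\<lambda>G. eval3 G 1 1 1) (grading a b c F)) d = 0" using F by (simp add: pt_def)
    then have "eval3 (coeff (grading a b c F) d) 1 1 1 = 0" by simp
    then show ?thesis using I(2) homogeneous_part by blast
  qed
  then have "(\<Sum>d\<le>degree (grading a b c F). coeff (grading a b c F) d) \<in> I"
    by (intro ideal_type_algebra_sum[OF I(1)])
  then show "F \<in> I" using sum_homogeneous_parts[of F a b c] by simp
qed

lemma point_ideal_eq: "point_ideal a b c 1 1 1 = pt"
  unfolding point_ideal_def using mem_pt_hom by (intro genideal_eqI[OF prime_pt _ pt_generated]) auto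

lemma varx_notin_pt: "varx \<notin> pt"
  using mem_pt_hom[OF hom_vars(1)] by (simp add: eval3_mon)

lemma pt_proj_point: "pt \<in> proj_points a b c"
  by (rule proj_pointI[OF prime_pt pt_generated hom_vars(1) abc(1) varx_notin_pt]) (use mem_pt_hom in auto)

text \<open>A generator would divide \<open>x^b - y^a\<close>, hence be free of \<open>z\<close>,
  and \<open>x^c - z^a\<close>, hence be free of \<open>y\<close>. Being homogeneous it would be a
  unit or a multiple of a positive power of \<open>x\<close>; the latter vanishes at (0,1,1), where
  \<open>x^b - y^a\<close> does not.\<close>

lemma pt_not_principal: "prime_elem F \<Longrightarrow> hom d F \<Longrightarrow> pt \<noteq> {G. F dvd G}"
proof
  assume F: "prime_elem F" "hom d F" and eq: "pt = {G. F dvd G}"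
  let ?A = "mon 1 (b,0,0) - mon 1 (0,a,0) :: 'k poly3" and ?B = "mon 1 (c,0,0) - mon 1 (0,0,a) :: 'k poly3"
  have "hom (a * b) ?A" "hom (a * c) ?B"
    by (intro homogeneous_diff homogeneous_mon; simp add: wdeg_def mult.commute)+
  then have "?A \<in> pt" "?B \<in> pt"
    using mem_pt_hom by (auto simp: eval3_mon eval3_diff)
  then obtain G H where G: "?A = F * G" and H: "?B = F * H" unfolding eq by (auto elim!: dvdE)
  have "cf ?A (0,a,0) \<noteq> 0" "cf ?B (0,0,a) \<noteq> 0" using abc by auto
  then have nz: "F * G \<noteq> 0" "F * H \<noteq> 0" unfolding G[symmetric] H[symmetric] by (metis cf_0)+
  have "homogeneous 0 0 1 0 (F * G)" unfolding G[symmetric]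
    by (intro homogeneous_diff homogeneous_mon) (simp_all add: wdeg_def)
  then have z: "homogeneous 0 0 1 0 F" using homogeneous_factor[OF _ nz(1)] by (metis add_is_0)
  have "homogeneous 0 1 0 0 (F * H)" unfolding H[symmetric]
    by (intro homogeneous_diff homogeneous_mon) (simp_all add: wdeg_def)
  then have y: "homogeneous 0 1 0 0 F" using homogeneous_factor[OF _ nz(2)] by (metis add_is_0)
  have F0: "F \<noteq> 0" using F by auto
  show False
  proof (cases "d = 0")
    case True
    then have "homogeneous 1 0 0 0 F" using F(2) abc by (auto simp: homogeneous_iff_cf wdeg_def)
    then show False using unit_if_no_variables[OF _ y z F0] prime_elem_not_unit[OF F(1)] by blast
  next
    case False
    have "eval3 (mon (cf F P) P) 0 1 1 = 0" if "P \<in> supp F" for P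
    proof -
      obtain i j l where P: "P = (i,j,l)" by (cases P)
      have "cf F (i,j,l) \<noteq> 0" using that by (simp add: supp_def P)
      then have "j = 0" "l = 0" "a * i + b * j + c * l = d" using y z F(2) by (auto simp: homogeneous_iff_cf wdeg_def)
      then show ?thesis using False by (cases i) (auto simp: P eval3_mon)
    qed
    then have "eval3 F 0 1 1 = 0" by (subst hom_sum_supp[OF comm_ring_hom_eval3]) simp
    then have "eval3 ?A 0 1 1 = 0" unfolding G by (simp add: eval3_mult)
    moreover have "eval3 ?A 0 1 1 = - 1"
      using abc by (auto simp: eval3_mon eval3_diff)
    ultimately show False by simp
  qed
qed

lemma pt_not_two_primes: "card {Q. primeideal Q (ring_on (proj_local_ring a b c pt))} \<noteq> 2"
  using proj_point_two_primes[OF pt_proj_point] pt_not_principal by metis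

end

section \<open>The blowup of the identity point\<close>

lemma generate_ring_subring:
  fixes E :: "'r::comm_ring_1 set"
  shows "subring_set (generate_ring ring_of_type_algebra E)" "E \<subseteq> generate_ring ring_of_type_algebra E"
proof -
  let ?R = "ring_of_type_algebra :: 'r ring"
  interpret ring ?R by (rule ring_from_type_algebra)
  have minus: "\<ominus>\<^bsub>?R\<^esub> x = - x" for x by (rule minus_equality) (auto simp: ring_of_type_algebra_def)
  have "1 \<in> generate_ring ?R E" using generate_ring.one[of ?R E] by (simp add: ring_of_type_algebra_def)
  moreover have "x - y \<in> generate_ring ?R E \<and> x * y \<in> generate_ring ?R E"
    if "x \<in> generate_ring ?R E" "y \<in> generate_ring ?R E" for x y
    using generate_ring.eng_add[OF that(1) generate_ring.a_inv[OF that(2)]] generate_ring.eng_mult[OF that]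
    unfolding minus by (simp add: ring_of_type_algebra_def)
  ultimately show "subring_set (generate_ring ?R E)" by (simp add: subring_set_def)
  show "E \<subseteq> generate_ring ?R E" using generate_ring.incl[of _ E ?R] by blast
qed

lemma generate_ring_least:
  fixes E :: "'r::comm_ring_1 set"
  assumes D: "subring_set D" "E \<subseteq> D"
  shows "generate_ring ring_of_type_algebra E \<subseteq> D"
proof
  let ?R = "ring_of_type_algebra :: 'r ring"
  interpret ring ?R by (rule ring_from_type_algebra)
  have minus: "\<ominus>\<^bsub>?R\<^esub> x = - x" for x by (rule minus_equality) (auto simp: ring_of_type_algebra_def)
  fix x assume "x \<in> generate_ring ?R E"
  then show "x \<in> D"
  proof (induction rule: generate_ring.induct)
    case (eng_add h1 h2)
    then show ?case using subring_setD(3)[OF D(1)] by (simp add: ring_of_type_algebra_def)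
  next
    case (eng_mult h1 h2)
    then show ?case using subring_setD(5)[OF D(1)] by (simp add: ring_of_type_algebra_def)
  next
    case (a_inv h)
    then show ?case using subring_setD(6)[OF D(1)] unfolding minus by blast
  qed (use D subring_setD[OF D(1)] in \<open>auto simp: minus ring_of_type_algebra_def\<close>)
qed

lemma Fract_add_same: "H \<noteq> 0 \<Longrightarrow> Fract x H + Fract y H = Fract (x + y) H"
  and Fract_diff_same: "H \<noteq> 0 \<Longrightarrow> Fract x H - Fract y H = Fract (x - y) H" for H :: "'a::idom"
  by (simp_all add: eq_fract algebra_simps)

lemma one_plus_power_minus_one:
  fixes n :: nat
  obtains s :: "'r::comm_ring_1 poly" where "[:1, 1:] ^ n - 1 = [:0, 1:] * s" "coeff s 0 = of_nat n"
proof -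
  define p where "p = ([:1, 1:] ^ n - 1 :: 'r poly)"
  have "coeff p 0 = 0" unfolding p_def using coeff_one_plus_power[of n 0] by simp
  then have 1: "p = [:0, 1:] * poly_shift 1 p"
    by (intro poly_eqI) (auto simp: coeff_pCons coeff_poly_shift split: nat.splits)
  have "coeff (poly_shift 1 p) 0 = of_nat n" unfolding p_def
    using coeff_one_plus_power[of n 1] by (simp add: coeff_poly_shift)
  then show ?thesis using that[of "poly_shift 1 p"] 1 unfolding p_def by blast
qed

lemma homogeneous_coeff_0_power:
  "coeff (([:0, 1:] * s) ^ n) k = (if k < n then 0 else if k = n then coeff s 0 ^ n else coeff (s ^ n) (k - n))"
  for s :: "'r::comm_ring_1 poly"
proof -
  have "([:0, 1:] * s) ^ n = monom 1 n * s ^ n"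
    by (simp only: power_mult_distrib x_as_monom x_pow_n)
  then show ?thesis by (simp add: coeff_monom_mult coeff_0_power)
qed

locale weighted_plane_char_0 = weighted_plane a b c ty
  for a b c :: nat and ty :: "'k::field_char_0 itself"
begin

abbreviation "A \<equiv> proj_local_ring a b c pt"
abbreviation "ord_pt \<equiv> frac_val (mult_one :: 'k poly3 \<Rightarrow> nat)"

definition const :: "'k \<Rightarrow> 'k poly3 fract" where "const u = Fract (mon u (0,0,0)) 1"
text \<open>Local parameters at the identity point. The characters \<open>x^c / z^a\<close> and
  \<open>y^c / z^b\<close> generate a subgroup of finite index in the character lattice of the
  torus, which is enough in characteristic 0.\<close>

definition \<xi> :: "'k poly3 fract" where "\<xi> = Fract (mon 1 (c,0,0) - mon 1 (0,0,a)) (mon 1 (0,0,a))"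
definition \<eta> :: "'k poly3 fract" where "\<eta> = Fract (mon 1 (0,c,0) - mon 1 (0,0,b)) (mon 1 (0,0,b))"

sublocale E: poly_valuation "mult_one :: 'k poly3 \<Rightarrow> nat" by (rule poly_valuation_mult_one)

lemma mon_nonzero: "u \<noteq> 0 \<Longrightarrow> mon u P \<noteq> 0"
  by (metis cf_mon cf_0)

lemma subring_A: "subring_set A"
  by (rule subring_proj_local_ring[OF prime_pt])

lemmas A_closed = subring_setD[OF subring_A]

lemma pt_iff_mult_one: "hom d G \<Longrightarrow> G \<noteq> 0 \<Longrightarrow> G \<in> pt \<longleftrightarrow> mult_one G \<noteq> 0"
  using mem_pt_hom mult_one_pos_iff[of G] by (metis One_nat_def Suc_leI le_zero_eq neq0_conv not_less_eq_eq)

lemma A_E: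
  assumes "q \<in> A"
  obtains G H d where "q = Fract G H" "hom d G" "hom d H" "H \<notin> pt" "H \<noteq> 0" "mult_one H = 0"
proof -
  obtain G H d where *: "q = Fract G H" "hom d G" "hom d H" "H \<notin> pt" using assms by (rule proj_local_ringE)
  moreover have "H \<noteq> 0" using * prime_inD(2)[OF prime_pt] by blast
  ultimately show ?thesis using that pt_iff_mult_one by metis
qed

lemma A_subset_K: "A \<subseteq> K"
  unfolding proj_local_ring_def K_def using prime_inD(2)[OF prime_pt] by blast

lemma ord_pt_A: "q \<in> A \<Longrightarrow> q \<noteq> 0 \<Longrightarrow> ord_pt q \<ge> 0"
proof -
  assume "q \<in> A" "q \<noteq> 0"
  obtain G H d where *: "q = Fract G H" "hom d G" "hom d H" "H \<notin> pt" "H \<noteq> 0" "mult_one H = 0"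
    using \<open>q \<in> A\<close> by (rule A_E)
  then have "G \<noteq> 0" using \<open>q \<noteq> 0\<close> by (auto simp: Fract_eq_0_iff)
  then show ?thesis using * by (simp add: E.frac_val_Fract)
qed

lemma max_ideal_A: "max_ideal A = {q \<in> A. q = 0 \<or> ord_pt q > 0}"
proof -
  have "inverse q \<notin> A \<longleftrightarrow> ord_pt q > 0" if q: "q \<in> A" "q \<noteq> 0" for q
  proof
    assume inv: "inverse q \<notin> A"
    obtain G H d where *: "q = Fract G H" "hom d G" "hom d H" "H \<notin> pt" "H \<noteq> 0" "mult_one H = 0"
      using q(1) by (rule A_E)
    then have G: "G \<noteq> 0" using q by (auto simp: Fract_eq_0_iff)
    have "G \<in> pt"
    proof (rule ccontr)
      assume "G \<notin> pt"
      then have "Fract H G \<in> A" using * by (intro proj_local_ringI)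
      then show False using inv * G by simp
    qed
    then show "ord_pt q > 0" using * G pt_iff_mult_one[OF *(2) G] by (simp add: E.frac_val_Fract)
  next
    assume pos: "ord_pt q > 0"
    have "ord_pt (q * inverse q) = ord_pt q + ord_pt (inverse q)" using q by (intro E.frac_val_mult) auto
    moreover have "ord_pt (q * inverse q) = 0" using q E.frac_val_Fract[of 1 1] by (simp add: One_fract_def)
    ultimately show "inverse q \<notin> A" using ord_pt_A[of "inverse q"] q pos by auto
  qed
  then show ?thesis unfolding max_ideal_eq by blast
qed

lemma const_add: "const (u + u') = const u + const u'" and const_mult: "const (u * u') = const u * const u'"
  and const_0: "const 0 = 0" and const_1: "const 1 = 1"
proof -
  have "mon (u + u') (0,0,0) = mon u (0,0,0) + mon u' (0,0,0)" by (rule cf_eqI) simp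
  then show "const (u + u') = const u + const u'" by (simp add: const_def)
  show "const (u * u') = const u * const u'" by (simp add: const_def mon_mult)
  show "const 0 = 0" by (simp add: const_def Fract_eq_0_iff)
  show "const 1 = 1" by (simp add: const_def One_fract_def)
qed

lemma const_A: "const u \<in> A"
  unfolding const_def using prime_inD(3)[OF prime_pt]
  by (intro proj_local_ringI[of 0] homogeneous_mon homogeneous_1) (simp_all add: wdeg_def)

lemma notin_pt: "hom d G \<Longrightarrow> eval3 G 1 1 1 \<noteq> 0 \<Longrightarrow> G \<notin> pt"
  using mem_pt_hom by blast

lemma hom_xi: "hom (a * c) (mon 1 (c,0,0))" "hom (a * c) (mon 1 (0,0,a))"
  and hom_eta: "hom (b * c) (mon 1 (0,c,0))" "hom (b * c) (mon 1 (0,0,b))"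
  by (rule homogeneous_mon; simp add: wdeg_def)+

lemma xi_A: "\<xi> \<in> A" and eta_A: "\<eta> \<in> A"
  unfolding \<xi>_def \<eta>_def
  by (intro proj_local_ringI[of "a * c"] proj_local_ringI[of "b * c"] homogeneous_diff hom_xi hom_eta
      notin_pt[OF hom_xi(2)] notin_pt[OF hom_eta(2)]; simp add: eval3_mon)+

section \<open>Powers of the ideal \<open>(\<xi>, \<eta>)\<close> and the order of vanishing at the
  identity point\<close>

fun mpow :: "nat \<Rightarrow> 'k poly3 fract set" where
  "mpow 0 = A"
| "mpow (Suc n) = {\<xi> * p + \<eta> * q |p q. p \<in> mpow n \<and> q \<in> mpow n}"

lemma mpow_sub_A: "mpow n \<subseteq> A"
  by (induction n) (auto intro!: A_closed xi_A eta_A)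

lemma mpow_add: "p \<in> mpow n \<Longrightarrow> q \<in> mpow n \<Longrightarrow> p + q \<in> mpow n"
proof (induction n arbitrary: p q)
  case 0
  then show ?case by (simp add: A_closed)
next
  case (Suc n)
  then obtain p1 p2 q1 q2 where "p = \<xi> * p1 + \<eta> * p2" "q = \<xi> * q1 + \<eta> * q2"
    "p1 \<in> mpow n" "p2 \<in> mpow n" "q1 \<in> mpow n" "q2 \<in> mpow n" by auto
  then show ?case using Suc.IH
    by (simp, intro exI[of _ "p1 + q1"] exI[of _ "p2 + q2"]) (simp add: algebra_simps)
qed

lemma mpow_scale: "p \<in> mpow n \<Longrightarrow> r \<in> A \<Longrightarrow> r * p \<in> mpow n"
proof (induction n arbitrary: p)
  case 0
  then show ?case by (simp add: A_closed)
next
  case (Suc n)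
  then obtain p1 p2 where "p = \<xi> * p1 + \<eta> * p2" "p1 \<in> mpow n" "p2 \<in> mpow n" by auto
  then show ?case using Suc.IH Suc.prems(2)
    by (simp, intro exI[of _ "r * p1"] exI[of _ "r * p2"]) (simp add: algebra_simps)
qed

lemma mpow_0: "0 \<in> mpow n"
proof (induction n)
  case (Suc n)
  then show ?case by (simp, intro exI[of _ 0]) simp
qed (simp add: A_closed)

declare mpow.simps [simp del]

lemma mpow_sum: "(\<And>i. i \<in> I \<Longrightarrow> f i \<in> mpow n) \<Longrightarrow> (\<Sum>i\<in>I. f i) \<in> mpow n"
  by (induction I rule: infinite_finite_induct) (auto intro: mpow_0 mpow_add)

lemma xi_mpow_1: "\<xi> \<in> mpow 1" and eta_mpow_1: "\<eta> \<in> mpow 1"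
proof -
  show "\<xi> \<in> mpow 1" unfolding One_nat_def mpow.simps
    by (intro CollectI exI[of _ 1] exI[of _ 0]) (simp add: A_closed)
  show "\<eta> \<in> mpow 1" unfolding One_nat_def mpow.simps
    by (intro CollectI exI[of _ 0] exI[of _ 1]) (simp add: A_closed)
qed

text \<open>The ratio of two monomials of the same degree is a unit of \<open>A\<close> whose \<open>c\<close>-th power is a
  monomial in \<open>1 + \<xi>\<close> and \<open>1 + \<eta>\<close>; in characteristic 0 it is therefore congruent to 1 modulo
  \<open>\<xi>\<close> and \<open>\<eta>\<close>.\<close>

lemma monomial_difference_mpow:
  assumes P: "wdeg a b c P = d" and Q: "wdeg a b c Q = d" and H: "hom d H" "H \<notin> pt"
  shows "Fract (mon 1 P - mon 1 Q) H \<in> mpow 1"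
proof -
  let ?Z = "mon 1 (0,0,d) :: 'k poly3"
  have cong: "Fract (mon 1 P ^ c) ?Z - 1 \<in> mpow 1" if P: "wdeg a b c P = d" for P
  proof -
    obtain i j l where ijl: "P = (i,j,l)" by (cases P)
    have nz: "mon 1 (0,0,a) \<noteq> (0::'k poly3)" "mon 1 (0,0,b) \<noteq> (0::'k poly3)" "?Z \<noteq> 0" by (simp_all add: mon_nonzero)
    have a1: "1 + \<xi> = Fract (mon 1 (c,0,0)) (mon 1 (0,0,a))" and b1: "1 + \<eta> = Fract (mon 1 (0,c,0)) (mon 1 (0,0,b))"
      unfolding \<xi>_def \<eta>_def One_fract_def using nz by (simp_all add: eq_fract)
    have pow: "Fract G G' ^ n = Fract (G ^ n) (G' ^ n)" for G G' :: "'k poly3" and n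
      by (induction n) (simp_all add: One_fract_def)
    have "a * i + b * j + c * l = d" using P by (simp add: ijl wdeg_def)
    then have "mon 1 P ^ c * (mon 1 (0,0,a) ^ i * mon 1 (0,0,b) ^ j) =
        mon 1 (c,0,0) ^ i * mon 1 (0,c,0) ^ j * ?Z"
      by (simp add: ijl mon_power mon_mult algebra_simps)
    then have eq: "Fract (mon 1 P ^ c) ?Z = (1 + \<xi>) ^ i * (1 + \<eta>) ^ j"
      unfolding a1 b1 pow using nz by (simp add: eq_fract)
    have one: "x * y - 1 \<in> mpow 1" if "x \<in> A" "x - 1 \<in> mpow 1" "y - 1 \<in> mpow 1" for x y
    proof -
      have "x * y - 1 = x * (y - 1) + (x - 1)" by (simp add: algebra_simps)
      then show ?thesis using mpow_add[OF mpow_scale[OF that(3,1)] that(2)] by (simp only:)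
    qed
    have powA: "x ^ n - 1 \<in> mpow 1" if "x \<in> A" "x - 1 \<in> mpow 1" for x n
      by (induction n) (use that in \<open>auto intro!: one mpow_0 simp del: One_nat_def\<close>)
    have A1: "1 + \<xi> \<in> A" and A2: "1 + \<eta> \<in> A" by (intro A_closed xi_A eta_A)+
    have p1: "(1 + \<xi>) ^ i - 1 \<in> mpow 1" by (rule powA[OF A1]) (use xi_mpow_1 in simp)
    have p2: "(1 + \<eta>) ^ j - 1 \<in> mpow 1" by (rule powA[OF A2]) (use eta_mpow_1 in simp)
    show ?thesis unfolding eq by (rule one[OF A_closed(7)[OF A1] p1 p2])
  qed
  \<comment> \<open>The cofactor in \<open>P^c - Q^c = (P - Q) S\<close>. Its value at (1,1,1) is
    \<open>c\<close>, so in characteristic 0 it is invertible at the identity point and the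
    congruence of the \<open>c\<close>-th powers descends to \<open>P - Q\<close>.\<close>
  define S where "S = (\<Sum>k<c. mon 1 P ^ k * mon 1 Q ^ (c - Suc k) :: 'k poly3)"
  have hS: "hom (d * (c - 1)) S" unfolding S_def
  proof (rule homogeneous_sum)
    fix k assume "k \<in> {..<c}"
    then have "k + (c - Suc k) = c - 1" by simp
    moreover have "k * d + (c - Suc k) * d = (k + (c - Suc k)) * d" by (rule add_mult_distrib[symmetric])
    ultimately have "k * d + (c - Suc k) * d = d * (c - 1)" by (simp only: mult.commute)
    moreover have "hom (k * d + (c - Suc k) * d) (mon 1 P ^ k * mon 1 Q ^ (c - Suc k))"
      by (intro homogeneous_mult homogeneous_power homogeneous_mon P Q)
    ultimately show "hom (d * (c - 1)) (mon 1 P ^ k * mon 1 Q ^ (c - Suc k))" by simp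
  qed
  interpret ev: comm_ring_hom "\<lambda>G. eval3 G 1 1 (1::'k)" by (rule comm_ring_hom_eval3)
  have "eval3 (mon 1 P) 1 1 (1::'k) = 1" for P by (cases P) (simp add: eval3_mon)
  then have "eval3 S 1 1 1 = of_nat c" by (simp add: S_def ev.hom_sum ev.hom_mult ev.hom_power)
  then have S: "S \<notin> pt" using abc notin_pt[OF hS] by simp
  have HS: "S * H \<notin> pt" by (rule not_in_prime_mult[OF prime_pt S H(2)])
  have cd: "d * (c - 1) + d = c * d" using abc by (cases c) simp_all
  have "Fract ?Z (S * H) \<in> A"
    using homogeneous_mult[OF hS H(1)] unfolding cd
    by (intro proj_local_ringI[of "c * d"] HS homogeneous_mon) (simp_all add: wdeg_def)
  moreover have "Fract (mon 1 P ^ c) ?Z - Fract (mon 1 Q ^ c) ?Z \<in> mpow 1"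
  proof -
    have "(Fract (mon 1 P ^ c) ?Z - 1) + (- 1) * (Fract (mon 1 Q ^ c) ?Z - 1) \<in> mpow 1"
      by (intro mpow_add mpow_scale cong P Q A_closed)
    moreover have "(x - 1) + (- 1) * (y - 1) = x - y" for x y :: "'k poly3 fract" by simp
    ultimately show ?thesis by (simp only:)
  qed
  ultimately have "Fract ?Z (S * H) * (Fract (mon 1 P ^ c) ?Z - Fract (mon 1 Q ^ c) ?Z) \<in> mpow 1"
    by (intro mpow_scale)
  moreover have "Fract ?Z (S * H) * (Fract (mon 1 P ^ c) ?Z - Fract (mon 1 Q ^ c) ?Z) = Fract (mon 1 P - mon 1 Q) H"
  proof -
    have nz: "?Z \<noteq> 0" "H \<noteq> 0" "S \<noteq> 0" using S H prime_inD(2)[OF prime_pt] by (auto simp: mon_nonzero)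
    have "mon 1 P ^ c - mon 1 Q ^ c = (mon 1 P - mon 1 Q) * S"
      unfolding S_def power_diff_sumr2 by (simp only: mult.commute)
    then show ?thesis unfolding Fract_diff_same[OF nz(1)] using nz by (simp add: eq_fract ac_simps)
  qed
  ultimately show ?thesis by simp
qed

text \<open>The coefficients of a numerator that vanishes at (1,1,1) have sum 0. The numerator is
  therefore a combination of differences between its monomials and a fixed monomial of the same
  degree.\<close>

lemma max_ideal_mpow: "max_ideal A \<subseteq> mpow 1"
proof
  fix q assume q: "q \<in> max_ideal A"
  then have qA: "q \<in> A" by (simp add: max_ideal_A)
  obtain G H d where *: "q = Fract G H" "hom d G" "hom d H" "H \<notin> pt" "H \<noteq> 0" "mult_one H = 0"
    using qA by (rule A_E)
  show "q \<in> mpow 1"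
  proof (cases "G = 0")
    case True
    then have "q = 0" using * by (simp only: Fract_eq_0_iff[OF *(5)])
    then show ?thesis by (simp only: mpow_0)
  next
    case False
    then have "q \<noteq> 0" using * by (simp add: Fract_eq_0_iff)
    then have "ord_pt q > 0" using q by (simp add: max_ideal_A)
    then have "G \<in> pt" using * False pt_iff_mult_one[OF *(2) False] by (simp add: E.frac_val_Fract)
    then have ev0: "eval3 G 1 1 1 = 0" using mem_pt_hom[OF *(2)] by blast
    have "(\<Sum>P\<in>supp G. cf G P) = eval3 G 1 1 1"
      using hom_sum_supp[OF comm_ring_hom_eval3[of 1 1 1], of G]
      by (simp add: eval3_mon[of _ "fst P" "fst (snd P)" "snd (snd P)" for P, simplified])
    then have sum0: "(\<Sum>P\<in>supp G. cf G P) = 0" using ev0 by simp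
    obtain Q where Q: "cf G Q \<noteq> 0" using False cf_eqI[of G 0] by (metis cf_0)
    have Fsum: "Fract (\<Sum>i\<in>I. f i) H = (\<Sum>i\<in>I. Fract (f i) H)" for I :: "(nat \<times> nat \<times> nat) set" and f
      by (induction I rule: infinite_finite_induct) (use *(5) in \<open>auto simp: Fract_eq_0_iff Fract_add_same[symmetric] simp del: add_fract\<close>)
    have mon_scale: "mon u P = mon u (0,0,0) * mon 1 P" for u :: 'k and P by (cases P) (simp add: mon_mult)
    have "(\<Sum>P\<in>supp G. mon (cf G P) (0,0,0)) = (mon (\<Sum>P\<in>supp G. cf G P) (0,0,0) :: 'k poly3)"
      by (rule cf_eqI) (simp add: cf_sum)
    then have z: "(\<Sum>P\<in>supp G. mon (cf G P) (0,0,0)) = (0 :: 'k poly3)" using sum0 by simp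
    have "(\<Sum>P\<in>supp G. mon (cf G P) (0,0,0) * (mon 1 P - mon 1 Q)) =
        (\<Sum>P\<in>supp G. mon (cf G P) (0,0,0) * mon 1 P) - (\<Sum>P\<in>supp G. mon (cf G P) (0,0,0)) * mon 1 Q"
      by (simp add: right_diff_distrib sum_subtractf sum_distrib_right)
    also have "\<dots> = (\<Sum>P\<in>supp G. mon (cf G P) P)" unfolding z mon_scale[symmetric] by simp
    also have "\<dots> = G" by (rule sum_mon[symmetric])
    finally have "q = (\<Sum>P\<in>supp G. Fract (mon (cf G P) (0,0,0) * (mon 1 P - mon 1 Q)) H)"
      unfolding *(1) Fsum[symmetric] by (rule arg_cong[of _ _ "\<lambda>G. Fract G H", OF sym])
    also have "\<dots> = (\<Sum>P\<in>supp G. const (cf G P) * Fract (mon 1 P - mon 1 Q) H)" by (simp add: const_def)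
    also have "\<dots> \<in> mpow 1"
    proof (rule mpow_sum)
      fix P assume "P \<in> supp G"
      then have "wdeg a b c P = d" "wdeg a b c Q = d" using *(2) Q by (auto simp: homogeneous_iff_cf supp_def)
      then show "const (cf G P) * Fract (mon 1 P - mon 1 Q) H \<in> mpow 1"
        using *(3,4) by (intro mpow_scale const_A monomial_difference_mpow)
    qed
    finally show ?thesis .
  qed
qed

abbreviation leading :: "(nat \<Rightarrow> 'k) \<Rightarrow> nat \<Rightarrow> 'k poly3 fract" where
  "leading u N \<equiv> (\<Sum>i\<le>N. const (u i) * (\<xi> ^ i * \<eta> ^ (N - i)))"

lemma value_at_point: "q \<in> A \<Longrightarrow> \<exists>u. q - const u \<in> mpow 1"
proof -
  assume "q \<in> A"
  then obtain G H d where *: "q = Fract G H" "hom d G" "hom d H" "H \<notin> pt" "H \<noteq> 0" by (rule A_E)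
  define u where "u = eval3 G 1 1 1 / eval3 H 1 1 (1::'k)"
  have ev: "eval3 H 1 1 1 \<noteq> (0::'k)" using * mem_pt_hom by blast
  let ?N = "G - mon u (0,0,0) * H"
  have "hom (0 + d) (mon u (0,0,0) * H)" by (intro homogeneous_mult homogeneous_mon *) (simp add: wdeg_def)
  then have hN: "hom d ?N" using * by (intro homogeneous_diff) auto
  have eq: "q - const u = Fract ?N H" unfolding *(1) const_def using *(5) by (simp add: eq_fract algebra_simps)
  have "eval3 ?N 1 1 1 = 0" using ev by (simp add: eval3_diff eval3_mult eval3_mon u_def)
  then have N: "?N \<in> pt" using mem_pt_hom[OF hN] by simp
  have "q - const u \<in> max_ideal A"
  proof (cases "?N = 0")
    case True
    then have "q - const u = 0" unfolding eq using Fract_eq_0_iff[OF *(5), of ?N] by blast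
    then show ?thesis using A_closed(1) by (simp only: max_ideal_A mem_Collect_eq simp_thms)
  next
    case False
    have "ord_pt (Fract ?N H) > 0"
      using N pt_iff_mult_one[OF hN False] pt_iff_mult_one[OF *(3,5)] *(4) E.frac_val_Fract[OF False *(5)] by linarith
    moreover have "Fract ?N H \<in> A" by (rule proj_local_ringI[OF hN *(3,4)])
    ultimately show ?thesis unfolding eq max_ideal_A by blast
  qed
  then show ?thesis using max_ideal_mpow by blast
qed

text \<open>The residue field consists of constants, so the coefficients of a form of degree
  \<open>N\<close> in \<open>\<xi>\<close> and \<open>\<eta>\<close> may be replaced by constants at
  the cost of an element of the next power.\<close>

lemma mpow_leading: "h \<in> mpow N \<Longrightarrow> \<exists>u. h - leading u N \<in> mpow (Suc N)"
proof (induction N arbitrary: h)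
  case 0
  then obtain u where "h - const u \<in> mpow 1" using value_at_point by (auto simp: mpow.simps(1))
  then show ?case by (intro exI[of _ "\<lambda>_. u"]) simp
next
  case (Suc N)
  then obtain p q where pq: "h = \<xi> * p + \<eta> * q" "p \<in> mpow N" "q \<in> mpow N" by (auto simp: mpow.simps(2))
  obtain u where u: "p - leading u N \<in> mpow (Suc N)" using Suc.IH[OF pq(2)] by blast
  obtain w where w: "q - leading w N \<in> mpow (Suc N)" using Suc.IH[OF pq(3)] by blast
  define t where "t i = (if i = 0 then 0 else u (i - 1)) + (if i \<le> N then w i else 0)" for i
  have "leading t (Suc N) = (\<Sum>i\<le>Suc N. const (if i = 0 then 0 else u (i - 1)) * (\<xi> ^ i * \<eta> ^ (Suc N - i))) +
      (\<Sum>i\<le>Suc N. const (if i \<le> N then w i else 0) * (\<xi> ^ i * \<eta> ^ (Suc N - i)))"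
    by (simp only: t_def const_add distrib_right sum.distrib)
  also have "(\<Sum>i\<le>Suc N. const (if i = 0 then 0 else u (i - 1)) * (\<xi> ^ i * \<eta> ^ (Suc N - i))) = \<xi> * leading u N"
    by (subst sum.atMost_Suc_shift) (simp add: const_0 sum_distrib_left ac_simps)
  also have "(\<Sum>i\<le>Suc N. const (if i \<le> N then w i else 0) * (\<xi> ^ i * \<eta> ^ (Suc N - i))) = \<eta> * leading w N"
    by (simp add: const_0 sum_distrib_left Suc_diff_le ac_simps)
  finally have "h - leading t (Suc N) = \<xi> * (p - leading u N) + \<eta> * (q - leading w N)"
    unfolding pq(1) by (simp add: algebra_simps)
  then have "h - leading t (Suc N) \<in> mpow (Suc (Suc N))" unfolding mpow.simps(2)[of "Suc N"] using u w by blast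
  then show ?case by blast
qed

lemma K_closed: "const u \<in> K" "\<xi> \<in> K" "\<eta> \<in> K"
  using const_A xi_A eta_A A_subset_K by blast+

text \<open>The summand with index \<open>i\<close> has the denominator
  \<open>z^(a i + b (N - i))\<close>. The additional power of \<open>z\<close> in the numerator
  brings all of them to the common denominator \<open>z^((a + b) N)\<close>.\<close>

lemma leading_eq_Fract:
  "leading u N = Fract (\<Sum>i\<le>N. mon (u i) (0,0,0) * ((mon 1 (c,0,0) - mon 1 (0,0,a)) ^ i *
      (mon 1 (0,c,0) - mon 1 (0,0,b)) ^ (N - i) * mon 1 (0,0,b * i + a * (N - i)))) (mon 1 (0,0,(a + b) * N))"
proof -
  let ?D = "mon 1 (0,0,(a + b) * N) :: 'k poly3"
  have D: "?D \<noteq> 0" by (simp add: mon_nonzero)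
  have pow: "Fract G G' ^ n = Fract (G ^ n) (G' ^ n)" for G G' :: "'k poly3" and n
    by (induction n) (simp_all add: One_fract_def)
  have "const (u i) * (\<xi> ^ i * \<eta> ^ (N - i)) = Fract (mon (u i) (0,0,0) * ((mon 1 (c,0,0) - mon 1 (0,0,a)) ^ i *
      (mon 1 (0,c,0) - mon 1 (0,0,b)) ^ (N - i) * mon 1 (0,0,b * i + a * (N - i)))) ?D" if "i \<le> N" for i
  proof -
    have e: "(a + b) * N = (a * i + b * (N - i)) + (b * i + a * (N - i))"
    proof -
      have "(a + b) * N = (a + b) * (i + (N - i))" using that by simp
      then show ?thesis by (simp only: distrib_left distrib_right ac_simps)
    qed
    have D': "?D = mon 1 (0,0,a) ^ i * mon 1 (0,0,b) ^ (N - i) * mon 1 (0,0,b * i + a * (N - i))"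
      unfolding e by (simp add: mon_power mon_mult mult.commute)
    have nz: "mon 1 (0,0,b * i + a * (N - i)) \<noteq> (0::'k poly3)" "mon 1 (0,0,a) ^ i * mon 1 (0,0,b) ^ (N - i) \<noteq> (0::'k poly3)"
      by (simp_all add: mon_nonzero)
    show ?thesis unfolding const_def \<xi>_def \<eta>_def pow D' using nz by (simp add: eq_fract ac_simps)
  qed
  then have "leading u N = (\<Sum>i\<le>N. Fract (mon (u i) (0,0,0) * ((mon 1 (c,0,0) - mon 1 (0,0,a)) ^ i *
      (mon 1 (0,c,0) - mon 1 (0,0,b)) ^ (N - i) * mon 1 (0,0,b * i + a * (N - i)))) ?D)"
    by (intro sum.cong) auto
  moreover have "Fract (\<Sum>i\<in>I. f i) ?D = (\<Sum>i\<in>I. Fract (f i) ?D)" for I :: "nat set" and f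
    by (induction I rule: infinite_finite_induct)
      (simp_all add: Fract_eq_0_iff[OF D] Fract_add_same[OF D, symmetric] del: add_fract)
  ultimately show ?thesis by simp
qed

text \<open>The polynomial \<open>F(1 + x, 1 + y, 1)\<close>. The plane \<open>z = 1\<close> is
  transversal to the orbit of (1,1,1), so that multiplicities of homogeneous polynomials remain
  visible in it, while powers of \<open>z\<close> disappear.\<close>

definition slice :: "'k poly3 \<Rightarrow> 'k poly poly" where
  "slice F = coeff (shift F) 0"

lemma comm_ring_hom_slice: "comm_ring_hom slice"
proof -
  interpret s: comm_ring_hom shift by (rule comm_ring_hom_shift)
  show ?thesis unfolding slice_def
    by unfold_locales (simp_all add: s.hom_add s.hom_mult coeff_mult_0)
qed

lemma slice_mon: "slice (mon u (i,j,l)) = smult ([:u:] * [:1,1:] ^ i) ([:1,1:] ^ j)"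
proof (intro poly_eqI)
  fix q p
  have "coeff (coeff (slice (mon u (i,j,l))) q) p = cf (shift (mon u (i,j,l))) (p,q,0)"
    by (simp add: slice_def cf_def)
  also have "\<dots> = u * of_nat (i choose p) * of_nat (j choose q)" by (simp add: cf_shift_mon)
  also have "\<dots> = coeff (coeff (smult ([:u:] * [:1,1:] ^ i) ([:1,1:] ^ j)) q) p"
    unfolding coeff_smult coeff_one_plus_power of_nat_poly by (simp add: coeff_one_plus_power[unfolded pCons_one] ac_simps)
  finally show "coeff (coeff (slice (mon u (i,j,l))) q) p = coeff (coeff (smult ([:u:] * [:1,1:] ^ i) ([:1,1:] ^ j)) q) p" .
qed

text \<open>The restriction of the numerator of \<open>leading u N\<close> to the plane \<open>z = 1\<close>, in coordinates centred at the
  point, has lowest homogeneous part \<open>c ^ N * (\<Sum>i. u i * x ^ i * y ^ (N - i))\<close>.\<close>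

lemma leading_nonzero:
  assumes "leading u N = 0 \<or> ord_pt (leading u N) \<ge> int N + 1" and i0: "i0 \<le> N"
  shows "u i0 = 0"
proof -
  define P :: "'k poly3" where "P = (\<Sum>i\<le>N. mon (u i) (0,0,0) * ((mon 1 (c,0,0) - mon 1 (0,0,a)) ^ i *
      (mon 1 (0,c,0) - mon 1 (0,0,b)) ^ (N - i) * mon 1 (0,0,b * i + a * (N - i))))"
  let ?D = "mon 1 (0,0,(a + b) * N) :: 'k poly3"
  have D: "?D \<noteq> 0" by (simp add: mon_nonzero)
  have lead: "leading u N = Fract P ?D" unfolding P_def by (rule leading_eq_Fract)
  have "mult_one ?D = 0"
    using mult_one_pos_iff[OF D] by (simp add: eval3_mon)
  then have z: "P \<noteq> 0 \<Longrightarrow> ord_pt (Fract P ?D) = int (mult_one P)" using E.frac_val_Fract[OF _ D, of P] by simp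
  have "P = 0 \<or> N + 1 \<le> mult_one P"
  proof (cases "P = 0")
    case False
    then have "ord_pt (Fract P ?D) \<ge> int N + 1" using assms(1) Fract_eq_0_iff[OF D, of P] unfolding lead by blast
    then show ?thesis using z[OF False] by linarith
  qed simp
  then have "cf (shift P) (i0, N - i0, 0) = 0"
  proof
    assume "P = 0"
    then show ?thesis using comm_ring_hom.axioms(1)[OF comm_ring_hom_shift] by (simp add: cf_shift[of "{}"] supp_def)
  next
    assume "N + 1 \<le> mult_one P"
    then show ?thesis using i0 le_mult_one_iff[of P "N + 1"] by (cases "P = 0") (auto simp: cf_shift[of "{}"] supp_def)
  qed
  then have 0: "coeff (coeff (slice P) (N - i0)) i0 = 0" by (simp add: slice_def cf_def)
  \<comment> \<open>The factor \<open>(1 + x)^c - 1\<close> starts with \<open>c x\<close>. In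
    characteristic 0 the coefficient \<open>c\<close> is nonzero, so the lowest part of each summand
    is a nonzero multiple of \<open>u i * x^i * y^(N - i)\<close>.\<close>
  obtain s :: "'k poly" where s: "[:1, 1:] ^ c - 1 = [:0, 1:] * s" "coeff s 0 = of_nat c" by (rule one_plus_power_minus_one)
  obtain s' :: "'k poly poly" where s': "[:1, 1:] ^ c - 1 = [:0, 1:] * s'" "coeff s' 0 = of_nat c" by (rule one_plus_power_minus_one)
  interpret sl: comm_ring_hom slice by (rule comm_ring_hom_slice)
  have const_minus: "[:p:] - 1 = [:p - 1:]" for p :: "'k poly" by (metis diff_pCons diff_zero pCons_one)
  have sx: "slice (mon 1 (c,0,0) - mon 1 (0,0,a)) = [:[:0, 1:] * s:]"
    unfolding sl.hom_minus slice_mon s(1)[symmetric] by (simp add: const_minus)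
  have sy: "slice (mon 1 (0,c,0) - mon 1 (0,0,b)) = [:0, 1:] * s'"
    unfolding sl.hom_minus slice_mon s'(1)[symmetric] by simp
  have sz: "slice (mon w (0,0,k)) = [:[:w:]:]" for w k unfolding slice_mon by simp
  have summand: "[:[:w:]:] * ([:p:] ^ i * q * [:[:1:]:]) = smult (smult w (p ^ i)) q" for w :: 'k and p q i
    by (simp add: poly_const_pow)
  have "slice P = (\<Sum>i\<le>N. smult (smult (u i) (([:0, 1:] * s) ^ i)) (([:0, 1:] * s') ^ (N - i)))"
    unfolding P_def sl.hom_sum sl.hom_mult sl.hom_power sx sy sz
    by (intro sum.cong refl summand)
  then have "coeff (coeff (slice P) (N - i0)) i0 =
      (\<Sum>i\<le>N. coeff (smult (u i) (([:0, 1:] * s) ^ i) * coeff (([:0, 1:] * s') ^ (N - i)) (N - i0)) i0)"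
    by (simp add: coeff_sum del: mult_pCons_left)
  also have "\<dots> = (\<Sum>i\<le>N. if i = i0 then u i0 * of_nat c ^ N else 0)"
  proof (intro sum.cong refl)
    fix i assume i: "i \<in> {..N}"
    consider "i < i0" | "i = i0" | "i > i0" by linarith
    then show "coeff (smult (u i) (([:0, 1:] * s) ^ i) * coeff (([:0, 1:] * s') ^ (N - i)) (N - i0)) i0 =
        (if i = i0 then u i0 * of_nat c ^ N else 0)"
    proof cases
      case 1
      then have "coeff (([:0, 1:] * s') ^ (N - i)) (N - i0) = 0"
        unfolding homogeneous_coeff_0_power using i i0 by auto
      then show ?thesis using 1 by simp
    next
      case 2
      have 1: "coeff (([:0, 1:] * s') ^ (N - i)) (N - i0) = [:of_nat c ^ (N - i):]"
        unfolding homogeneous_coeff_0_power s' 2 by (simp add: of_nat_poly poly_const_pow)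
      have "coeff (([:0, 1:] * s) ^ i) i0 = of_nat c ^ i" unfolding homogeneous_coeff_0_power s 2 by simp
      then show ?thesis unfolding 1 using 2 i by (simp add: power_add[symmetric] ac_simps del: mult_pCons_left)
    next
      case 3
      have "coeff (([:0, 1:] * s) ^ i * r) i0 = 0" for r
      proof -
        have eq: "([:0, 1:] * s) ^ i * r = monom 1 i * (s ^ i * r)"
          by (simp only: power_mult_distrib x_as_monom x_pow_n mult.assoc)
        show ?thesis unfolding eq using 3 by (simp add: coeff_monom_mult)
      qed
      then show ?thesis using 3 by (simp del: mult_pCons_left)
    qed
  qed
  also have "\<dots> = u i0 * of_nat c ^ N" using i0 by simp
  finally show ?thesis using 0 abc by simp
qed

lemma mpow_ord: "h \<in> mpow N \<Longrightarrow> h \<noteq> 0 \<Longrightarrow> ord_pt h \<ge> int N"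
proof (induction N arbitrary: h)
  case 0
  then show ?case using ord_pt_A by (simp add: mpow.simps(1))
next
  case (Suc N)
  then obtain p q where pq: "h = \<xi> * p + \<eta> * q" "p \<in> mpow N" "q \<in> mpow N" by (auto simp: mpow.simps(2))
  have ev: "eval3 (mon 1 (c,0,0) - mon 1 (0,0,a)) 1 1 1 = (0::'k)" "eval3 (mon 1 (0,c,0) - mon 1 (0,0,b)) 1 1 1 = (0::'k)"
    by (simp_all add: eval3_diff eval3_mon)
  have "cf (mon 1 (c,0,0) - mon 1 (0,0,a)) (c,0,0) \<noteq> (0::'k)" "cf (mon 1 (0,c,0) - mon 1 (0,0,b)) (0,c,0) \<noteq> (0::'k)"
    using abc by auto
  then have nz: "mon 1 (c,0,0) - mon 1 (0,0,a) \<noteq> (0::'k poly3)" "mon 1 (0,c,0) - mon 1 (0,0,b) \<noteq> (0::'k poly3)"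
    by (metis cf_0)+
  have z: "mult_one (mon 1 (0,0,l) :: 'k poly3) = 0" for l
  proof -
    have "\<not> 1 \<le> mult_one (mon 1 (0,0,l) :: 'k poly3)"
      unfolding mult_one_pos_iff[OF mon_nonzero[OF one_neq_zero]] by (simp add: eval3_mon)
    then show ?thesis by linarith
  qed
  have nzz: "mon 1 (0,0,l) \<noteq> (0::'k poly3)" for l by (simp add: mon_nonzero)
  have ord: "ord_pt \<xi> \<ge> 1" "ord_pt \<eta> \<ge> 1" "\<xi> \<noteq> 0" "\<eta> \<noteq> 0"
    using mult_one_pos_iff[OF nz(1), THEN iffD2, OF ev(1)] mult_one_pos_iff[OF nz(2), THEN iffD2, OF ev(2)]
      Fract_eq_0_iff[OF nzz] nz
    unfolding \<xi>_def \<eta>_def E.frac_val_Fract[OF nz(1) nzz] E.frac_val_Fract[OF nz(2) nzz] z by auto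
  have 1: "ord_pt (\<xi> * p) \<ge> int N + 1" if "p \<noteq> 0" using Suc.IH[OF pq(2) that] ord that by (simp add: E.frac_val_mult)
  have 2: "ord_pt (\<eta> * q) \<ge> int N + 1" if "q \<noteq> 0" using Suc.IH[OF pq(3) that] ord that by (simp add: E.frac_val_mult)
  show ?case
  proof (cases "p = 0 \<or> q = 0")
    case True
    then show ?thesis using 1 2 Suc.prems pq by auto
  next
    case False
    then have "min (ord_pt (\<xi> * p)) (ord_pt (\<eta> * q)) \<le> ord_pt h"
      unfolding pq(1) using ord Suc.prems pq(1) by (intro E.frac_val_add) auto
    then show ?thesis using 1 2 False by simp
  qed
qed

text \<open>This is the regularity of the local ring. If an element of the \<open>N\<close>-th power
  has order greater than \<open>N\<close>, then so has its leading form of degree \<open>N\<close>,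
  whose coefficients must vanish by \<open>leading_nonzero\<close>; the element thus lies in the
  next power.\<close>

lemma ord_pt_imp_mpow:
  assumes "h \<in> A" "h = 0 \<or> ord_pt h \<ge> int N"
  shows "h \<in> mpow N"
  using assms(2)
proof (induction N)
  case 0
  then show ?case using assms(1) by (simp add: mpow.simps(1))
next
  case (Suc N)
  then have "h \<in> mpow N" by auto
  then obtain u where u: "h - leading u N \<in> mpow (Suc N)" using mpow_leading by blast
  have "leading u N = 0 \<or> ord_pt (leading u N) \<ge> int N + 1"
  proof (cases "leading u N = 0")
    case False
    let ?r = "h - leading u N"
    have r: "?r = 0 \<or> ord_pt ?r \<ge> int N + 1" using mpow_ord[OF u] by auto
    have neg: "ord_pt (- q) = ord_pt q" if "q \<noteq> 0" for q
    proof -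
      have "ord_pt (- q) + ord_pt (- q) = ord_pt q + ord_pt q"
        using E.frac_val_mult[of "- q" "- q"] E.frac_val_mult[of q q] that by simp
      then show ?thesis by simp
    qed
    show ?thesis
    proof (cases "h = 0 \<or> ?r = 0")
      case True
      then show ?thesis
      proof
        assume "h = 0"
        then show ?thesis using r False neg[of ?r] by auto
      next
        assume "?r = 0"
        then show ?thesis using Suc.prems False by auto
      qed
    next
      case c: False
      have "min (ord_pt h) (ord_pt (- ?r)) \<le> ord_pt (h + (- ?r))"
        using c False by (intro E.frac_val_add) auto
      then show ?thesis using c r neg[of ?r] Suc.prems by auto
    qed
  qed simp
  then have "u i = 0" if "i \<le> N" for i using leading_nonzero that by blast
  then have "leading u N = 0" by (simp add: const_0)
  then show ?case using u by simp
qed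

lemma mem_mpow_iff: "h \<in> mpow N \<longleftrightarrow> h \<in> A \<and> (h = 0 \<or> ord_pt h \<ge> int N)"
  using mpow_sub_A mpow_ord ord_pt_imp_mpow by blast

lemma xi_nonzero: "\<xi> \<noteq> 0" and ord_pt_xi: "ord_pt \<xi> = 1"
proof -
  have lead: "leading (\<lambda>i. if i = 1 then 1 else 0) 1 = \<xi>" by (simp add: const_0 const_1)
  have *: "\<not> (\<xi> = 0 \<or> ord_pt \<xi> \<ge> int 1 + 1)"
    using leading_nonzero[of "\<lambda>i. if i = 1 then 1 else 0" 1 1] unfolding lead by auto
  then show "\<xi> \<noteq> 0" by blast
  then show "ord_pt \<xi> = 1" using mpow_ord[OF xi_mpow_1] * by auto
qed

sublocale DE: discrete_valuation K ord_pt
  by (rule discrete_valuation_K[OF poly_valuation_mult_one]) (use xi_nonzero ord_pt_xi K_closed in auto)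

lemma vring_mult_one: "DE.O_ring = vring mult_one"
  by (rule vring_eq) unfold_locales

lemma mem_max_ideal_A: "h \<in> max_ideal A \<longleftrightarrow> h \<in> A \<and> (h = 0 \<or> ord_pt h \<ge> 1)"
  unfolding max_ideal_A by auto

section \<open>Charts of the blowup and the exceptional curve\<close>

lemma subring_chart: "subring_set (blowup_chart A f)"
  and A_sub_chart: "A \<subseteq> blowup_chart A f"
  and max_div_chart: "h \<in> max_ideal A \<Longrightarrow> h / f \<in> blowup_chart A f"
  using generate_ring_subring[of "A \<union> {h / f |h. h \<in> max_ideal A}"] unfolding blowup_chart_def by auto

lemma mpow_div_chart:
  assumes "f \<noteq> 0" "h \<in> mpow N"
  shows "h / f ^ N \<in> blowup_chart A f"
  using assms(2)
proof (induction N arbitrary: h)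
  case 0
  then show ?case using A_sub_chart by (auto simp: mpow.simps)
next
  case (Suc N)
  then obtain p q where pq: "h = \<xi> * p + \<eta> * q" "p \<in> mpow N" "q \<in> mpow N" by (auto simp: mpow.simps(2))
  note B = subring_setD[OF subring_chart[of f]]
  have "\<xi> \<in> max_ideal A" "\<eta> \<in> max_ideal A"
    using xi_mpow_1 eta_mpow_1 unfolding mem_mpow_iff mem_max_ideal_A by simp_all
  then have "(\<xi> / f) * (p / f ^ N) + (\<eta> / f) * (q / f ^ N) \<in> blowup_chart A f"
    by (intro B max_div_chart Suc.IH pq)
  moreover have "(\<xi> / f) * (p / f ^ N) + (\<eta> / f) * (q / f ^ N) = h / f ^ Suc N"
    unfolding pq(1) using assms(1) by (simp add: add_divide_distrib)
  ultimately show ?case by simp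
qed

lemma ord_pt_diff:
  assumes "p \<in> K" "q \<in> K" "p = 0 \<or> ord_pt p \<ge> n" "q = 0 \<or> ord_pt q \<ge> n"
  shows "p - q = 0 \<or> ord_pt (p - q) \<ge> n"
proof (cases "p = 0 \<or> q = 0 \<or> p - q = 0")
  case True
  then show ?thesis using assms DE.W_minus by auto
next
  case False
  then have "min (ord_pt p) (ord_pt (- q)) \<le> ord_pt (p + (- q))" by (intro E.frac_val_add) auto
  then show ?thesis using assms False DE.W_minus[of q] by auto
qed

text \<open>The fractions \<open>h / f ^ N\<close> with \<open>h\<close> of order at least
  \<open>N\<close> already form a ring, because the order is additive on products and
  \<open>f ^ N\<close> lies in the \<open>N\<close>-th power. This ring contains the generators of
  the chart.\<close>

lemma chart_elements:
  assumes f: "f \<in> max_ideal A" "f \<noteq> 0" and q: "q \<in> blowup_chart A f"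
  obtains h N where "q = h / f ^ N" "h \<in> mpow N"
proof -
  define D where "D = {h / f ^ N |h N. h \<in> mpow N}"
  have fA: "f \<in> A" "ord_pt f \<ge> 1" using f by (auto simp: mem_max_ideal_A)
  have fN: "f ^ N \<in> mpow N" for N
    using f(2) fA A_closed(7)[OF fA(1)] DE.W_power[of f N] A_subset_K
      mult_left_mono[of 1 "ord_pt f" "int N"] by (auto simp: mem_mpow_iff)
  have prod: "p * q \<in> mpow (N + M)" if "p \<in> mpow N" "q \<in> mpow M" for p q N M
    using that E.frac_val_mult[of p q] A_closed(5)[of p q] unfolding mem_mpow_iff by (cases "p = 0 \<or> q = 0") auto
  have diff: "p - q \<in> mpow N" if "p \<in> mpow N" "q \<in> mpow N" for p q N
    using that ord_pt_diff[of p q "int N"] A_closed(4)[of p q] A_subset_K unfolding mem_mpow_iff by blast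
  have "subring_set D" unfolding subring_set_def
  proof (intro conjI ballI)
    have "1 = 1 / f ^ 0" "1 \<in> mpow 0" using A_closed(2) by (simp_all add: mpow.simps)
    then show "1 \<in> D" unfolding D_def by blast
    fix x y assume "x \<in> D" "y \<in> D"
    then obtain h N h' N' where x: "x = h / f ^ N" "h \<in> mpow N" and y: "y = h' / f ^ N'" "h' \<in> mpow N'"
      unfolding D_def by blast
    have "x - y = (h * f ^ N' - f ^ N * h') / f ^ (N + N')" "x * y = (h * h') / f ^ (N + N')"
      unfolding x(1) y(1) using f(2) by (simp_all add: field_simps power_add)
    moreover have "h * f ^ N' - f ^ N * h' \<in> mpow (N + N')" "h * h' \<in> mpow (N + N')"
      using diff prod fN x(2) y(2) by blast+
    ultimately show "x - y \<in> D" "x * y \<in> D" unfolding D_def by blast+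
  qed
  moreover have "A \<union> {h / f |h. h \<in> max_ideal A} \<subseteq> D"
  proof
    fix x assume "x \<in> A \<union> {h / f |h. h \<in> max_ideal A}"
    then show "x \<in> D"
    proof
      assume "x \<in> A"
      then have "x = x / f ^ 0" "x \<in> mpow 0" by (simp_all add: mpow.simps)
      then show ?thesis unfolding D_def by blast
    next
      assume "x \<in> {h / f |h. h \<in> max_ideal A}"
      then obtain h where h: "x = h / f" "h \<in> max_ideal A" by blast
      then have "x = h / f ^ 1" "h \<in> mpow 1" by (simp_all add: mem_mpow_iff mem_max_ideal_A)
      then show ?thesis unfolding D_def by blast
    qed
  qed
  ultimately have "blowup_chart A f \<subseteq> D" unfolding blowup_chart_def by (rule generate_ring_least)
  then show ?thesis using q that unfolding D_def by blast
qed

text \<open>The ideal of the exceptional curve in the chart. If \<open>f\<close> has order 1 it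
  consists of the multiples of \<open>f\<close>.\<close>

definition exceptional_prime :: "'k poly3 fract \<Rightarrow> 'k poly3 fract set" where
  "exceptional_prime f = {q \<in> blowup_chart A f. q = 0 \<or> ord_pt q > 0}"

context
  fixes f assumes f: "f \<in> max_ideal A" "f \<noteq> 0" "ord_pt f = 1"
begin

lemma f_A: "f \<in> A" "f \<in> K"
  using f A_subset_K by (auto simp: mem_max_ideal_A)

lemma chart_sub_O: "blowup_chart A f \<subseteq> DE.O_ring"
proof
  fix q assume "q \<in> blowup_chart A f"
  then obtain h N where h: "q = h / f ^ N" "h \<in> mpow N" by (rule chart_elements[OF f(1,2)])
  then have hA: "h \<in> A" "h \<in> K" and ord: "h \<noteq> 0 \<Longrightarrow> ord_pt h \<ge> int N" using A_subset_K by (auto simp: mem_mpow_iff)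
  have fN: "f ^ N \<in> K" "f ^ N \<noteq> 0" "ord_pt (f ^ N) = int N"
    using f f_A subring_setD(7)[OF subring_K] DE.W_power by auto
  have inv: "inverse (f ^ N) \<in> K" "inverse (f ^ N) \<noteq> 0" "ord_pt (inverse (f ^ N)) = - int N"
    using fN K_inverse DE.W_inverse[of "f ^ N"] by auto
  have "q = h * inverse (f ^ N)" using h by (simp add: divide_inverse)
  then show "q \<in> DE.O_ring"
    using inv hA ord E.frac_val_mult[of h "inverse (f ^ N)"] subring_setD(5)[OF subring_K hA(2) inv(1)]
    unfolding DE.mem_O by (cases "h = 0") (auto simp del: inverse_nonzero_iff_nonzero)
qed

lemma prime_exceptional: "prime_in (blowup_chart A f) (exceptional_prime f)"
proof -
  let ?B = "blowup_chart A f"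
  note B = subring_setD[OF subring_chart[of f]]
  have eq: "exceptional_prime f = {q \<in> ?B. q \<in> max_ideal DE.O_ring}"
    unfolding exceptional_prime_def DE.mem_max using chart_sub_O DE.mem_O by blast
  have "prime_in DE.O_ring (max_ideal DE.O_ring)" using DE.prime_in_O_iff by blast
  note P = prime_inD[OF this]
  have sub: "x \<in> DE.O_ring" if "x \<in> ?B" for x using that chart_sub_O by blast
  show ?thesis unfolding prime_in_def eq
  proof (intro conjI ballI impI)
    show "0 \<in> {q \<in> ?B. q \<in> max_ideal DE.O_ring}" "1 \<notin> {q \<in> ?B. q \<in> max_ideal DE.O_ring}"
      using B(1) P(2,3) by simp_all
    show "x + y \<in> {q \<in> ?B. q \<in> max_ideal DE.O_ring}"
      if "x \<in> {q \<in> ?B. q \<in> max_ideal DE.O_ring}" "y \<in> {q \<in> ?B. q \<in> max_ideal DE.O_ring}" for x y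
      using that B(3)[of x y] P(4)[of x y] by simp
    show "r * x \<in> {q \<in> ?B. q \<in> max_ideal DE.O_ring}"
      if "x \<in> {q \<in> ?B. q \<in> max_ideal DE.O_ring}" "r \<in> ?B" for r x
      using that B(5)[of r x] P(5)[of x r] sub[of r] by simp
    show "x \<in> {q \<in> ?B. q \<in> max_ideal DE.O_ring} \<or> y \<in> {q \<in> ?B. q \<in> max_ideal DE.O_ring}"
      if "x \<in> ?B" "y \<in> ?B" "x * y \<in> {q \<in> ?B. q \<in> max_ideal DE.O_ring}" for x y
      using that P(6)[of x y] sub by simp
  qed blast
qed

text \<open>If \<open>h / f ^ N\<close> has positive order, then \<open>h\<close> lies in the power
  \<open>N + 1\<close>, and \<open>h / f ^ N\<close> is \<open>f\<close> times the chart element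
  \<open>h / f ^ Suc N\<close>.\<close>

lemma exceptional_prime_least:
  assumes Q: "prime_in (blowup_chart A f) Q" "max_ideal A \<subseteq> Q"
  shows "exceptional_prime f \<subseteq> Q"
proof
  fix q assume "q \<in> exceptional_prime f"
  then have q: "q \<in> blowup_chart A f" "q = 0 \<or> ord_pt q > 0" by (auto simp: exceptional_prime_def)
  obtain h N where h: "q = h / f ^ N" "h \<in> mpow N" using q(1) by (rule chart_elements[OF f(1,2)])
  then have hA: "h \<in> A" "h \<in> K" using A_subset_K by (auto simp: mem_mpow_iff)
  have "h \<in> mpow (Suc N)"
  proof (cases "h = 0")
    case False
    have "ord_pt h = ord_pt (q * f ^ N)" using h f by simp
    also have "\<dots> = ord_pt q + int N"
      using h f False f_A DE.W_power[of f N] by (subst E.frac_val_mult) auto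
    finally show ?thesis using q(2) h f False hA by (auto simp: mem_mpow_iff)
  qed (rule mpow_0[THEN back_subst[of "\<lambda>x. x \<in> mpow (Suc N)"]], simp)
  then have "h / f ^ Suc N \<in> blowup_chart A f" by (rule mpow_div_chart[OF f(2)])
  moreover have "f \<in> Q" using Q(2) f by blast
  ultimately have "h / f ^ Suc N * f \<in> Q" using prime_inD(5)[OF Q(1)] by blast
  moreover have "h / f ^ Suc N * f = q" using h f by simp
  ultimately show "q \<in> Q" by simp
qed

text \<open>For the harder inclusion, \<open>q = G / H\<close> is written as \<open>r / s\<close>
  with \<open>r = G H^(a - 1) / x^d\<close> and \<open>s = H^a / x^d\<close>, both regular at the
  identity point. If \<open>N\<close> is the order of \<open>s\<close>, the order of
  \<open>r\<close> is at least \<open>N\<close>; after division by \<open>f ^ N\<close> both lie in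
  the chart and the denominator has order 0.\<close>

lemma localization_exceptional: "localization (blowup_chart A f) (exceptional_prime f) = vring mult_one"
proof (intro equalityI subsetI)
  fix q assume "q \<in> localization (blowup_chart A f) (exceptional_prime f)"
  then obtain r s where *: "q = r / s" "r \<in> blowup_chart A f" "s \<in> blowup_chart A f - exceptional_prime f"
    unfolding localization_def by blast
  have r: "r \<in> DE.O_ring" using * chart_sub_O by blast
  have s: "s \<in> Units (ring_on DE.O_ring)"
    using * chart_sub_O unfolding DE.Units_O exceptional_prime_def DE.mem_O by (auto simp: DE.mem_O subset_iff)
  then have "inverse s \<in> DE.O_ring" unfolding DE.Units_O DE.mem_O using K_inverse DE.W_inverse by simp
  then have "r * inverse s \<in> DE.O_ring" by (intro subring_setD(5)[OF DE.subring_O] r)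
  then show "q \<in> vring mult_one" using * by (simp add: vring_mult_one divide_inverse)
next
  fix q assume "q \<in> vring mult_one"
  then have q: "q \<in> K" "q = 0 \<or> ord_pt q \<ge> 0" by (auto simp: vring_def)
  obtain G H d where GH: "q = Fract G H" "hom d G" "hom d H" "H \<noteq> 0" using q(1) by (rule KE)
  define T :: "'k poly3" where "T = varx ^ d"
  have hT: "hom (d * a) T" unfolding T_def by (rule homogeneous_power[OF hom_vars(1)])
  have T: "T \<notin> pt" unfolding T_def by (rule not_in_prime_power[OF prime_pt varx_notin_pt])
  have T0: "T \<noteq> 0" using T prime_inD(2)[OF prime_pt] by blast
  have deg: "hom (d * a) (H ^ a)" "hom (d * a) (G * H ^ (a - 1))"
  proof -
    show "hom (d * a) (H ^ a)" using homogeneous_power[OF GH(3), of a] by (simp add: mult.commute)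
    have "d + (a - 1) * d = d * a" using abc by (cases a) simp_all
    then show "hom (d * a) (G * H ^ (a - 1))"
      using homogeneous_mult[OF GH(2) homogeneous_power[OF GH(3), of "a - 1"]] by simp
  qed
  let ?r = "Fract (G * H ^ (a - 1)) T" and ?s = "Fract (H ^ a) T"
  have Ha: "H ^ a = H * H ^ (a - 1)" using abc by (cases a) simp_all
  have rA: "?r \<in> A" and sA: "?s \<in> A" using deg hT T by (auto intro: proj_local_ringI)
  have s0: "?s \<noteq> 0" using GH(4) by (simp add: Fract_eq_0_iff[OF T0])
  have qrs: "?r = q * ?s" unfolding GH(1) Ha using GH(4) T0 by (simp add: eq_fract ac_simps)
  define N where "N = nat (ord_pt ?s)"
  have N: "int N = ord_pt ?s" using ord_pt_A[OF sA s0] by (simp add: N_def)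
  have sN: "?s \<in> mpow N" using sA N by (simp add: mem_mpow_iff)
  have rN: "?r \<in> mpow N"
    unfolding mem_mpow_iff using rA q(2) E.frac_val_mult[of q ?s] s0 N unfolding qrs by auto
  note B = mpow_div_chart[OF f(2) rN] mpow_div_chart[OF f(2) sN]
  have fN: "f ^ N \<in> K" "f ^ N \<noteq> 0" "ord_pt (f ^ N) = int N"
    using f f_A subring_setD(7)[OF subring_K] DE.W_power by auto
  have "?s / f ^ N * f ^ N = ?s" by (metis fN(2) nonzero_divide_eq_eq)
  moreover have "ord_pt (?s / f ^ N * f ^ N) = ord_pt (?s / f ^ N) + ord_pt (f ^ N)"
    using s0 fN by (intro E.frac_val_mult) auto
  ultimately have "ord_pt ?s = ord_pt (?s / f ^ N) + ord_pt (f ^ N)" by (simp only:)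
  then have "ord_pt (?s / f ^ N) = 0" using fN(3) N by linarith
  moreover have "?s / f ^ N \<noteq> 0" using s0 fN by simp
  ultimately have "?s / f ^ N \<in> blowup_chart A f - exceptional_prime f" using B by (simp add: exceptional_prime_def)
  moreover have "q = (?r / f ^ N) / (?s / f ^ N)" unfolding qrs using s0 fN by simp
  ultimately show "q \<in> localization (blowup_chart A f) (exceptional_prime f)"
    using B unfolding localization_def by blast
qed

end

text \<open>For \<open>f\<close> of order at least 2, \<open>f = \<xi> p + \<eta> q\<close> with
  \<open>p\<close> and \<open>q\<close> in the maximal ideal. Dividing by \<open>f\<close> puts 1
  into the ideal generated by \<open>\<xi>\<close> and \<open>\<eta>\<close> in the chart, so that
  no point of this chart lies over the identity point.\<close>

lemma chart_ord_f:
  assumes f: "f \<in> max_ideal A - {0}" and Q: "prime_in (blowup_chart A f) Q" "max_ideal A \<subseteq> Q"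
  shows "ord_pt f = 1"
proof (rule ccontr)
  have f0: "f \<noteq> 0" "f \<in> A" "ord_pt f \<ge> 1" using f by (auto simp: mem_max_ideal_A)
  assume "ord_pt f \<noteq> 1"
  then have "f \<in> mpow (Suc 1)" using f0 by (simp add: mem_mpow_iff)
  then obtain p q where pq: "f = \<xi> * p + \<eta> * q" "p \<in> mpow 1" "q \<in> mpow 1" by (auto simp: mpow.simps(2)[of "Suc 0"])
  have in_max: "h \<in> max_ideal A" if "h \<in> mpow 1" for h using that by (simp add: mem_mpow_iff mem_max_ideal_A)
  have "\<xi> \<in> Q" "\<eta> \<in> Q" using in_max xi_mpow_1 eta_mpow_1 Q(2) by blast+
  moreover have "p / f \<in> blowup_chart A f" "q / f \<in> blowup_chart A f" using in_max pq by (auto intro: max_div_chart)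
  ultimately have "p / f * \<xi> + q / f * \<eta> \<in> Q" by (intro prime_inD(4,5)[OF Q(1)])
  moreover have "p / f * \<xi> + q / f * \<eta> = 1"
  proof -
    have "p / f * \<xi> + q / f * \<eta> = (\<xi> * p + \<eta> * q) / f" by (simp add: add_divide_distrib mult.commute)
    then show ?thesis using pq(1) f0 by simp
  qed
  ultimately show False using prime_inD(3)[OF Q(1)] by simp
qed

text \<open>Every prime over the identity point contains the exceptional prime. If it is different,
  then together with 0 there is a chain of three primes.\<close>

lemma chart_two_primes:
  assumes f: "f \<in> max_ideal A - {0}" and Q: "prime_in (blowup_chart A f) Q" "max_ideal A \<subseteq> Q"
    and two: "card {P. primeideal P (ring_on (localization (blowup_chart A f) Q))} = 2"
  shows "localization (blowup_chart A f) Q = vring mult_one"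
proof -
  have ord: "ord_pt f = 1" by (rule chart_ord_f[OF f Q])
  have f': "f \<in> max_ideal A" "f \<noteq> 0" using f by auto
  have "Q = exceptional_prime f"
  proof (rule ccontr)
    assume "Q \<noteq> exceptional_prime f"
    then have "exceptional_prime f \<subset> Q" using exceptional_prime_least[OF f' ord Q] by blast
    moreover have "f \<in> exceptional_prime f"
      using f' ord A_sub_chart[of f] by (auto simp: exceptional_prime_def mem_max_ideal_A)
    then have "exceptional_prime f \<noteq> {0}" using f' by blast
    ultimately show False
      using localization_not_two_primes[OF subring_chart Q(1) prime_exceptional[OF f' ord]] two by blast
  qed
  then show ?thesis using localization_exceptional[OF f' ord] by simp
qed

section \<open>Points, prime divisors and function field of the blowup\<close>

definition Bl :: "'k poly3 fract model" where
  "Bl = blowup (weighted_proj_plane a b c) (wpp_point a b c 1 1 1)"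

lemma wpp_point_eq: "wpp_point a b c 1 1 1 = A"
  unfolding wpp_point_def point_ideal_eq ..

lemma Bl_eq: "Bl = (weighted_proj_plane a b c - {A}) \<union>
     {localization (blowup_chart A f) Q |f Q. f \<in> max_ideal A - {0} \<and>
        prime_in (blowup_chart A f) Q \<and> max_ideal A \<subseteq> Q}"
  unfolding Bl_def blowup_def wpp_point_eq primeideal_iff[OF subring_chart] ..

lemma Bl_cases:
  assumes "D \<in> Bl"
  obtains P where "P \<in> proj_points a b c" "D = proj_local_ring a b c P"
  | f Q where "D = localization (blowup_chart A f) Q" "f \<in> max_ideal A - {0}"
      "prime_in (blowup_chart A f) Q" "max_ideal A \<subseteq> Q"
  using assms unfolding Bl_eq
proof (elim UnE)
  assume "D \<in> weighted_proj_plane a b c - {A}"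
  then have "D \<in> weighted_proj_plane a b c" by (rule DiffD1)
  then show thesis unfolding weighted_proj_plane_def using that(1) by (elim imageE) (rule that(1))
qed (elim CollectE exE conjE, rule that(2))

lemma exceptional_in_Bl: "vring mult_one \<in> Bl"
proof -
  have f: "\<xi> \<in> max_ideal A" "\<xi> \<noteq> 0" "ord_pt \<xi> = 1"
    using xi_A xi_nonzero ord_pt_xi by (auto simp: mem_max_ideal_A)
  have "max_ideal A \<subseteq> exceptional_prime \<xi>"
    using A_sub_chart[of \<xi>] by (auto simp: exceptional_prime_def mem_max_ideal_A)
  then have "localization (blowup_chart A \<xi>) (exceptional_prime \<xi>) \<in> Bl"
    using f prime_exceptional[OF f] unfolding Bl_eq by blast
  then show ?thesis by (simp add: localization_exceptional[OF f])
qed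

lemma two_primes_vring: "discrete_valuation K (frac_val w) \<Longrightarrow> card {P. primeideal P (ring_on (vring w))} = 2"
  using discrete_valuation.two_primes[of K "frac_val w"] vring_eq[of w] by simp

text \<open>Away from the identity point, codimension one means a homogeneous prime polynomial. The
  removed local ring is not of dimension one, so no curve is lost, and the only curve added over it
  is the exceptional one.\<close>

theorem prime_divisors_Bl:
  "prime_divisors Bl = insert (vring mult_one) {vring (pmult F) |F d. prime_elem F \<and> hom d F}"
proof (intro equalityI subsetI)
  fix R assume "R \<in> prime_divisors Bl"
  then have R: "R \<in> Bl" and two: "card {P. primeideal P (ring_on R)} = 2" by (auto simp: prime_divisors_def)
  show "R \<in> insert (vring mult_one) {vring (pmult F) |F d. prime_elem F \<and> hom d F}"
    using R
  proof (cases rule: Bl_cases)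
    case (1 P)
    obtain F d where F: "prime_elem F" "hom d F" "P = {G. F dvd G}"
      using proj_point_two_primes[OF 1(1)] two 1(2) by metis
    then have "R = vring (pmult F)" using proj_local_ring_prime_elem[OF F(1,2)] 1(2) by simp
    then show ?thesis using F(1,2) by (intro insertI2 CollectI exI conjI)
  next
    case (2 f Q)
    then show ?thesis using chart_two_primes[OF 2(2-4)] two by simp
  qed
next
  fix R assume "R \<in> insert (vring mult_one) {vring (pmult F) |F d. prime_elem F \<and> hom d F}"
  then show "R \<in> prime_divisors Bl"
  proof (elim insertE CollectE exE conjE)
    assume R: "R = vring mult_one"
    have "card {P. primeideal P (ring_on (vring mult_one))} = 2"
      by (rule two_primes_vring) (rule DE.discrete_valuation_axioms)
    then show ?thesis unfolding prime_divisors_def R using exceptional_in_Bl by (intro CollectI conjI)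
  next
    fix F d assume F: "R = vring (pmult F)" "prime_elem F" "hom d F"
    have two: "card {P. primeideal P (ring_on R)} = 2"
      unfolding F(1) by (rule two_primes_vring[OF discrete_valuation_pmult[OF F(2,3)]])
    have "R \<in> weighted_proj_plane a b c"
      using prime_elem_proj_point[OF F(2,3)] proj_local_ring_prime_elem[OF F(2,3)] F(1)
      unfolding weighted_proj_plane_def by blast
    moreover have "R \<noteq> A" using two pt_not_two_primes by auto
    ultimately show ?thesis using two by (simp add: prime_divisors_def Bl_eq)
  qed
qed

theorem function_field_Bl: "function_field Bl = K"
proof
  have "R \<subseteq> K" if "R \<in> Bl" for R
    using that
  proof (cases rule: Bl_cases)
    case (1 P)
    have "0 \<in> P" using prime_inD(2)[OF proj_pointD(1)[OF 1(1)]] .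
    then show ?thesis unfolding 1(2) proj_local_ring_def K_def by blast
  next
    case (2 f Q)
    have "f \<in> max_ideal A" "f \<noteq> 0" using 2(2) by auto
    then have "blowup_chart A f \<subseteq> K"
      using chart_sub_O[of f] chart_ord_f[OF 2(2-4)] DE.mem_O by blast
    then show ?thesis unfolding 2(1) localization_def
      using subring_setD(5)[OF subring_K] K_inverse by (auto simp: divide_inverse subset_iff)
  qed
  then show "function_field Bl \<subseteq> K" unfolding function_field_def by blast
  have "K \<noteq> A"
  proof
    assume "K = A"
    then have "inverse \<xi> \<in> A" using K_inverse K_closed(2) by blast
    then show False using ord_pt_A[of "inverse \<xi>"] DE.W_inverse[OF K_closed(2) xi_nonzero] xi_nonzero ord_pt_xi by simp
  qed
  moreover have "K \<in> weighted_proj_plane a b c"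
    using zero_proj_point proj_local_ring_zero unfolding weighted_proj_plane_def by blast
  ultimately have "K \<in> Bl" unfolding Bl_eq by blast
  then show "K \<subseteq> function_field Bl" unfolding function_field_def by blast
qed

end

section \<open>Divisors and sections on the blowup\<close>

lemma pmult_associated:
  assumes "F dvd F'" "F' dvd F"
  shows "pmult F = pmult (F' :: 'a::comm_semiring_1)"
proof -
  have "F ^ n dvd G \<longleftrightarrow> F' ^ n dvd G" for n G
    using dvd_power_same[OF assms(1), of n] dvd_power_same[OF assms(2), of n] dvd_trans by blast
  then show ?thesis unfolding pmult_def by presburger
qed

lemma prime_dvd_prime_symmetric:
  fixes F F' :: "'a::idom"
  assumes "prime_elem F" "prime_elem F'" "F dvd F'"
  shows "F' dvd F"
proof -
  obtain u where u: "F' = F * u" using assms(3) by (elim dvdE)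
  then have "u dvd 1"
    using Factorial_Ring.irreducibleD[OF prime_elem_imp_irreducible[OF assms(2)] u] prime_elem_not_unit[OF assms(1)] by blast
  then obtain v where "1 = u * v" by (elim dvdE)
  then have "F = F' * v" unfolding u by (simp add: mult.assoc)
  then show ?thesis by simp
qed

text \<open>Equations of divisors are homogeneous of any integral degree, so they leave the function
  field, which comprises degree zero only.\<close>

definition homfrac :: "nat \<Rightarrow> nat \<Rightarrow> nat \<Rightarrow> int \<Rightarrow> 'k::field poly3 fract \<Rightarrow> bool" where
  "homfrac a b c e q \<longleftrightarrow> (\<exists>G H d d'. q = Fract G H \<and> homogeneous a b c d G \<and> homogeneous a b c d' H \<and>
     G \<noteq> 0 \<and> H \<noteq> 0 \<and> e = int d - int d')"

lemma homfrac_mult: "homfrac a b c e q \<Longrightarrow> homfrac a b c e' q' \<Longrightarrow> homfrac a b c (e + e') (q * q')"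
proof -
  assume "homfrac a b c e q" "homfrac a b c e' q'"
  then obtain G H d1 d2 G' H' d1' d2' where
    "q = Fract G H" "homogeneous a b c d1 G" "homogeneous a b c d2 H" "G \<noteq> 0" "H \<noteq> 0" "e = int d1 - int d2"
    "q' = Fract G' H'" "homogeneous a b c d1' G'" "homogeneous a b c d2' H'" "G' \<noteq> 0" "H' \<noteq> 0" "e' = int d1' - int d2'"
    unfolding homfrac_def by blast
  then show ?thesis unfolding homfrac_def
    by (intro exI[of _ "G * G'"] exI[of _ "H * H'"] exI[of _ "d1 + d1'"] exI[of _ "d2 + d2'"])
      (auto intro: homogeneous_mult)
qed

lemma homfrac_inverse: "homfrac a b c e q \<Longrightarrow> homfrac a b c (- e) (inverse q)"
  unfolding homfrac_def by fastforce

lemma homfrac_1: "homfrac a b c 0 1"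
  unfolding homfrac_def One_fract_def
  by (intro exI[of _ 1] exI[of _ 0]) (simp add: homogeneous_1)

lemma homfrac_power: "homfrac a b c e q \<Longrightarrow> homfrac a b c (int n * e) (q ^ n)"
  by (induction n) (auto simp: homfrac_1 algebra_simps dest: homfrac_mult)

lemma homfrac_powi: "homfrac a b c e q \<Longrightarrow> homfrac a b c (i * e) (q powi i)"
  using homfrac_power[of a b c e q "nat i"] homfrac_power[OF homfrac_inverse, of a b c e q "nat (- i)"]
  by (cases "i \<ge> 0") (auto simp: power_int_def)

lemma homfrac_prod: "(\<And>i. i \<in> I \<Longrightarrow> homfrac a b c (e i) (q i)) \<Longrightarrow> homfrac a b c (\<Sum>i\<in>I. e i) (\<Prod>i\<in>I. q i)"
  by (induction I rule: infinite_finite_induct) (auto intro: homfrac_1 homfrac_mult)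

lemma (in poly_valuation) frac_val_1: "frac_val w 1 = 0"
  using frac_val_Fract[of 1 1] by (simp add: One_fract_def)

lemma (in poly_valuation) frac_val_inverse: "q \<noteq> 0 \<Longrightarrow> frac_val w (inverse q) = - frac_val w q"
  using frac_val_mult[of q "inverse q"] by (simp add: frac_val_1)

lemma (in poly_valuation) frac_val_power: "q \<noteq> 0 \<Longrightarrow> frac_val w (q ^ n) = int n * frac_val w q"
  by (induction n) (auto simp: frac_val_1 frac_val_mult algebra_simps)

lemma (in poly_valuation) frac_val_powi: "q \<noteq> 0 \<Longrightarrow> frac_val w (q powi i) = i * frac_val w q"
  by (auto simp: power_int_def frac_val_power frac_val_inverse)

lemma (in poly_valuation) frac_val_prod:
  "(\<And>i. i \<in> I \<Longrightarrow> q i \<noteq> 0) \<Longrightarrow> frac_val w (\<Prod>i\<in>I. q i) = (\<Sum>i\<in>I. frac_val w (q i))"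
  by (induction I rule: infinite_finite_induct) (auto simp: frac_val_1 frac_val_mult)

context weighted_plane_char_0
begin

text \<open>Multiplicities are known only along homogeneous primes. This suffices since all prime
  factors of a homogeneous product are homogeneous.\<close>

lemma hom_dvd_by_valuations:
  assumes "\<And>p. p \<in># M \<Longrightarrow> prime_elem p" "hom d (prod_mset M)" "hom d' G" "G \<noteq> 0"
    "\<And>F dF. prime_elem F \<Longrightarrow> hom dF F \<Longrightarrow> pmult F (prod_mset M) \<le> pmult F G"
  shows "prod_mset M dvd G"
  using assms
proof (induction M arbitrary: d d' G)
  case (add p M)
  have nz: "p \<noteq> 0" "prod_mset M \<noteq> 0" using add.prems(1) by auto
  have "hom d (p * prod_mset M)" using add.prems(2) by simp
  then obtain dp dM where hp: "hom dp p" and hM: "hom dM (prod_mset M)"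
    by (rule homogeneous_factor) (use nz in auto)
  have p: "prime_elem p" using add.prems(1) by simp
  interpret p: poly_valuation "pmult p" by (rule poly_valuation_pmult[OF p])
  have "pmult p p = 1" by (rule pmult_eqI[OF p, of _ _ 1]) (use prime_elem_not_unit[OF p] in auto)
  then have "1 \<le> pmult p G" using add.prems(5)[OF p hp] p.w_mult[OF nz] by simp
  then have "p ^ 1 dvd G" using power_dvd_iff_pmult[OF p add.prems(4)] by blast
  then obtain G' where G': "G = p * G'" by (auto elim: dvdE)
  then have nz': "G' \<noteq> 0" using add.prems by auto
  have "hom (d' - dp) G'" using add.prems(3) hp nz(1) unfolding G' by (rule homogeneous_cancel_left)
  moreover have "pmult F (prod_mset M) \<le> pmult F G'" if F: "prime_elem F" "hom dF F" for F dF
  proof -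
    interpret F: poly_valuation "pmult F" by (rule poly_valuation_pmult[OF F(1)])
    show ?thesis using add.prems(5)[OF F] F.w_mult[OF nz] F.w_mult[OF nz(1) nz'] by (simp add: G')
  qed
  ultimately have "prod_mset M dvd G'" using add.prems(1) hM nz' by (intro add.IH) auto
  then show ?case unfolding G' by simp
qed simp

lemma homfrac_polynomial:
  assumes q: "homfrac a b c e q" and val: "\<And>F d. prime_elem F \<Longrightarrow> hom d F \<Longrightarrow> frac_val (pmult F) q \<ge> 0"
  obtains P d where "q = Fract P 1" "hom d P" "P \<noteq> 0" "int d = e"
proof -
  obtain G H d d' where GH: "q = Fract G H" "hom d G" "hom d' H" "G \<noteq> 0" "H \<noteq> 0" "e = int d - int d'"
    using q unfolding homfrac_def by blast
  have le: "pmult F H \<le> pmult F G" if F: "prime_elem F" "hom dF F" for F dF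
  proof -
    interpret F: poly_valuation "pmult F" by (rule poly_valuation_pmult[OF F(1)])
    show ?thesis using val[OF F] unfolding GH(1) F.frac_val_Fract[OF GH(4,5)] by simp
  qed
  have "H dvd G"
  proof (cases "H dvd 1")
    case True
    then show ?thesis by (rule dvd_trans) simp
  next
    case False
    then obtain M where M: "mset_factors M H" using mset_factors_exist[OF GH(5)] by blast
    then have "prod_mset M dvd G"
      using mset_factorsD[OF M] GH le by (intro hom_dvd_by_valuations[of M d' d]) auto
    then show ?thesis using mset_factorsD(3)[OF M] by simp
  qed
  then obtain P where P: "G = H * P" by (elim dvdE)
  then have P0: "P \<noteq> 0" using GH by auto
  have hP: "hom (d - d') P" using GH(2,3,5) unfolding P by (rule homogeneous_cancel_left)
  have "hom (d' + (d - d')) (H * P)" by (rule homogeneous_mult[OF GH(3) hP])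
  then have "d' + (d - d') = d" using GH(2,4) homogeneous_degree_unique unfolding P by blast
  moreover have "q = Fract P 1" unfolding GH(1) P using GH(5) by (simp add: eq_fract)
  ultimately show ?thesis using that[OF _ hP P0] GH(6) by simp
qed

section \<open>Valuations and equations attached to prime divisors\<close>

abbreviation "E0 \<equiv> vring mult_one"

text \<open>The function \<open>T^d / F^w\<close> has a pole along \<open>F\<close>, and none along
  \<open>F'\<close> unless \<open>F'\<close> divides \<open>F\<close>.\<close>

lemma vring_pmult_eq_imp_dvd:
  assumes F: "prime_elem F" "hom d F" and F': "prime_elem F'" and eq: "vring (pmult F) = vring (pmult F')"
  shows "F' dvd F"
proof (rule ccontr)
  assume nd: "\<not> F' dvd F"
  interpret F: poly_valuation "pmult F" by (rule poly_valuation_pmult[OF F(1)])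
  interpret F': poly_valuation "pmult F'" by (rule poly_valuation_pmult[OF F'])
  obtain w T where T: "w > 0" "hom w T" "T \<noteq> 0" "\<not> F dvd T" "eval3 T 1 1 1 = 1" by (rule variable_not_in[OF F(1)])
  have F0: "F ^ w \<noteq> 0" "T ^ d \<noteq> 0" using F T by auto
  have "pmult F F = 1" by (rule pmult_eqI[OF F(1), of _ _ 1]) (use prime_elem_not_unit[OF F(1)] in auto)
  moreover have "pmult F T = 0" by (rule pmult_eqI[OF F(1), of _ _ T]) (use T in auto)
  moreover have "pmult F' F = 0" by (rule pmult_eqI[OF F', of _ _ F]) (use nd in auto)
  ultimately have "frac_val (pmult F) (Fract (T ^ d) (F ^ w)) < 0" "frac_val (pmult F') (Fract (T ^ d) (F ^ w)) \<ge> 0"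
    using F.frac_val_Fract[OF F0(2,1)] F'.frac_val_Fract[OF F0(2,1)] F0 T F.w_power F'.w_power by auto
  moreover have "inverse (dehom w T d F) \<in> K" by (intro K_inverse dehom_in_K T F)
  then have "Fract (T ^ d) (F ^ w) \<in> K" using F0 by (simp add: dehom_def)
  moreover have "Fract (T ^ d) (F ^ w) \<noteq> 0" using F0 by (simp add: Fract_eq_0_iff)
  ultimately have "Fract (T ^ d) (F ^ w) \<in> vring (pmult F')" "Fract (T ^ d) (F ^ w) \<notin> vring (pmult F)"
    unfolding vring_def by auto
  then show False using eq by simp
qed

text \<open>If the valuation rings agreed, the functions \<open>T^e / G^w\<close> would show that a
  homogeneous \<open>G\<close> is divisible by \<open>F\<close> precisely when it vanishes at
  (1,1,1). The ideal of the identity point would then be generated by \<open>F\<close>.\<close>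

lemma exceptional_ne:
  assumes F: "prime_elem F" "hom d F"
  shows "vring (pmult F) \<noteq> E0"
proof
  assume eq: "vring (pmult F) = E0"
  interpret F: poly_valuation "pmult F" by (rule poly_valuation_pmult[OF F(1)])
  obtain w T where T: "w > 0" "hom w T" "T \<noteq> 0" "\<not> F dvd T" "eval3 T 1 1 1 = 1" by (rule variable_not_in[OF F(1)])
  have T': "T \<notin> pt" using mem_pt_hom[OF T(2)] T(5) by simp
  have FT: "pmult F T = 0" by (rule pmult_eqI[OF F(1), of _ _ T]) (use T in auto)
  have ET: "mult_one T = 0" using pt_iff_mult_one[OF T(2,3)] T' by simp
  have vals: "frac_val (pmult F) (Fract (T ^ e) (G ^ w)) = - int (w * pmult F G)"
    "ord_pt (Fract (T ^ e) (G ^ w)) = - int (w * mult_one G)" if "G \<noteq> 0" for G e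
  proof -
    have "G ^ w \<noteq> 0" "T ^ e \<noteq> 0" using that T by auto
    then show "frac_val (pmult F) (Fract (T ^ e) (G ^ w)) = - int (w * pmult F G)"
      "ord_pt (Fract (T ^ e) (G ^ w)) = - int (w * mult_one G)"
      using F.frac_val_Fract[of "T ^ e" "G ^ w"] E.frac_val_Fract[of "T ^ e" "G ^ w"] T that
        F.w_power E.w_power FT ET by simp_all
  qed
  have mem: "Fract (T ^ e) (G ^ w) \<in> K \<and> Fract (T ^ e) (G ^ w) \<noteq> 0" if "hom e G" "G \<noteq> 0" for e G
  proof -
    have "inverse (dehom w T e G) \<in> K" by (intro K_inverse dehom_in_K T that)
    then show ?thesis using T that by (simp add: dehom_def Fract_eq_0_iff)
  qed
  have same: "pmult F G = 0 \<longleftrightarrow> mult_one G = 0" if G: "hom e G" "G \<noteq> 0" for G e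
  proof -
    have "Fract (T ^ e) (G ^ w) \<in> vring (pmult F) \<longleftrightarrow> Fract (T ^ e) (G ^ w) \<in> E0" unfolding eq ..
    moreover have "Fract (T ^ e) (G ^ w) \<in> vring (pmult F) \<longleftrightarrow> - int (w * pmult F G) \<ge> 0"
      "Fract (T ^ e) (G ^ w) \<in> E0 \<longleftrightarrow> - int (w * mult_one G) \<ge> 0"
      unfolding vring_def vals[OF G(2), of e, symmetric] using mem[OF G] by simp_all
    ultimately have "- int (w * pmult F G) \<ge> 0 \<longleftrightarrow> - int (w * mult_one G) \<ge> 0" by simp
    moreover have "- int (w * x) \<ge> 0 \<longleftrightarrow> x = 0" for x using T(1) by (simp add: mult_le_0_iff)
    ultimately show ?thesis by simp
  qed
  have F0: "F \<noteq> 0" using F by auto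
  have "pmult F F = 1" by (rule pmult_eqI[OF F(1), of _ _ 1]) (use prime_elem_not_unit[OF F(1)] in auto)
  then have "mult_one F \<noteq> 0" using same[OF F(2) F0] by simp
  then have "F \<in> pt" using pt_iff_mult_one[OF F(2) F0] by simp
  have "pt \<subseteq> {G. F dvd G}"
  proof (rule proj_pointD(2)[OF pt_proj_point prime_in_UNIV_ideal[OF prime_in_multiples[OF F(1)]]])
    show "{G \<in> pt. \<exists>d. hom d G} \<subseteq> {G. F dvd G}"
    proof clarify
      fix G e assume G: "G \<in> pt" "hom e G"
      show "F dvd G"
      proof (cases "G = 0")
        case False
        then have "pmult F G \<noteq> 0" using same[OF G(2) False] pt_iff_mult_one[OF G(2) False] G(1) by simp
        then show ?thesis using power_dvd_iff_pmult[OF F(1) False, of 1] by simp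
      qed simp
    qed
  qed
  moreover have "{G. F dvd G} \<subseteq> pt"
  proof
    fix G assume "G \<in> {G. F dvd G}"
    then obtain H where "G = H * F" by (metis dvdE mem_Collect_eq mult.commute)
    then show "G \<in> pt" using prime_inD(5)[OF prime_pt \<open>F \<in> pt\<close>, of H] by simp
  qed
  ultimately show False using pt_not_principal[OF F] by blast
qed

abbreviation "PD \<equiv> prime_divisors Bl"

definition rep :: "'k poly3 fract set \<Rightarrow> 'k poly3" where
  "rep R = (SOME F. prime_elem F \<and> (\<exists>d. hom d F) \<and> R = vring (pmult F))"

lemma rep:
  assumes "R \<in> PD" "R \<noteq> E0"
  shows "prime_elem (rep R)" "\<exists>d. hom d (rep R)" "R = vring (pmult (rep R))"
proof -
  have "R \<in> {vring (pmult F) |F d. prime_elem F \<and> hom d F}" using assms unfolding prime_divisors_Bl by simp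
  then have "\<exists>F. prime_elem F \<and> (\<exists>d. hom d F) \<and> R = vring (pmult F)"
    by (elim CollectE exE conjE) (intro exI conjI)
  note rep = someI_ex[OF this, folded rep_def]
  show "prime_elem (rep R)" using rep by (rule conjunct1)
  show "\<exists>d. hom d (rep R)" using rep by (elim conjE)
  show "R = vring (pmult (rep R))" using rep by (elim conjE)
qed

definition equation :: "'k poly3 fract set \<Rightarrow> 'k poly3" where
  "equation R = (if R = E0 then 1 else rep R)"

definition eq_deg :: "'k poly3 fract set \<Rightarrow> nat" where
  "eq_deg R = (SOME d. hom d (equation R))"

definition val :: "'k poly3 fract set \<Rightarrow> 'k poly3 fract \<Rightarrow> int" where
  "val R = frac_val (if R = E0 then mult_one else pmult (rep R))"

text \<open>
  A multiplicity need not take the value 1 on fractions of degree zero, whereas \<open>ord_along\<close> is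
  normalized.
\<close>

definition ram :: "'k poly3 fract set \<Rightarrow> int" where
  "ram R = (SOME r. r > 0 \<and> (\<forall>q\<in>K - {0}. val R q = r * ord_along R q))"

lemma equation: "R \<in> PD \<Longrightarrow> hom (eq_deg R) (equation R)" "R \<in> PD \<Longrightarrow> equation R \<noteq> 0"
proof -
  assume R: "R \<in> PD"
  have "\<exists>d. hom d (equation R)" 
  proof (cases "R = E0")
    case True
    then show ?thesis using homogeneous_1 by (auto simp: equation_def)
  next
    case False
    then show ?thesis using rep(2)[OF R] by (simp add: equation_def)
  qed
  then show "hom (eq_deg R) (equation R)" unfolding eq_deg_def by (rule someI_ex)
  show "equation R \<noteq> 0" using rep(1)[OF R] unfolding equation_def by auto
qed

lemma ram:
  assumes R: "R \<in> PD"
  shows "ram R > 0" "q \<in> K \<Longrightarrow> q \<noteq> 0 \<Longrightarrow> val R q = ram R * ord_along R q"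
proof -
  have "\<exists>r>0. \<forall>q\<in>K - {0}. val R q = r * ord_along R q"
  proof (cases "R = E0")
    case True
    then show ?thesis using DE.ord_along_O unfolding val_def vring_mult_one by simp
  next
    case False
    obtain d where d: "hom d (rep R)" using rep(2)[OF R False] by blast
    have dv: "discrete_valuation K (frac_val (pmult (rep R)))" by (rule discrete_valuation_pmult[OF rep(1)[OF R False] d])
    show ?thesis using discrete_valuation.ord_along_O[OF dv] False
      unfolding val_def vring_eq[OF dv] rep(3)[OF R False, symmetric] by simp
  qed
  then have "ram R > 0 \<and> (\<forall>q\<in>K - {0}. val R q = ram R * ord_along R q)"
    unfolding ram_def by (rule someI_ex)
  then show "ram R > 0" "q \<in> K \<Longrightarrow> q \<noteq> 0 \<Longrightarrow> val R q = ram R * ord_along R q" by auto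
qed

lemma val_mult: "R \<in> PD \<Longrightarrow> q \<noteq> 0 \<Longrightarrow> q' \<noteq> 0 \<Longrightarrow> val R (q * q') = val R q + val R q'"
  using poly_valuation.frac_val_mult[OF poly_valuation_pmult[OF rep(1)]] E.frac_val_mult unfolding val_def by auto

lemma ord_along_mult:
  assumes R: "R \<in> PD" and q: "q \<in> K" "q \<noteq> 0" "q' \<in> K" "q' \<noteq> 0"
  shows "ord_along R (q * q') = ord_along R q + ord_along R q'"
proof -
  have "ram R * ord_along R (q * q') = ram R * (ord_along R q + ord_along R q')"
    using val_mult[OF R q(2,4)] ram(2)[OF R q(1,2)] ram(2)[OF R q(3,4)]
      ram(2)[OF R subring_setD(5)[OF subring_K q(1,3)]] q by (simp add: distrib_left)
  then show ?thesis using ram(1)[OF R] by simp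
qed

end

section \<open>Degree, multiplicity and equation of a divisor\<close>

definition frag_lin :: "('a \<Rightarrow> int) \<Rightarrow> ('a \<Rightarrow>\<^sub>0 int) \<Rightarrow> int" where
  "frag_lin u D = (\<Sum>R\<in>Poly_Mapping.keys D. Poly_Mapping.lookup D R * u R)"

lemma frag_lin_superset:
  "finite S \<Longrightarrow> Poly_Mapping.keys D \<subseteq> S \<Longrightarrow> frag_lin u D = (\<Sum>R\<in>S. Poly_Mapping.lookup D R * u R)"
  unfolding frag_lin_def by (rule sum.mono_neutral_left) (auto simp: in_keys_iff)

lemma frag_lin_0 [simp]: "frag_lin u 0 = 0"
  by (simp add: frag_lin_def)

lemma frag_lin_of [simp]: "frag_lin u (frag_of R) = u R"
  by (simp add: frag_lin_def)

lemma frag_lin_add: "frag_lin u (D + D') = frag_lin u D + frag_lin u D'"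
proof -
  let ?S = "Poly_Mapping.keys D \<union> Poly_Mapping.keys D'"
  have "Poly_Mapping.keys (D + D') \<subseteq> ?S" by (rule Poly_Mapping.keys_add)
  then show ?thesis
    by (simp add: frag_lin_superset[of ?S] lookup_add distrib_right sum.distrib)
qed

lemma frag_lin_minus: "frag_lin u (- D) = - frag_lin u D"
  using frag_lin_add[of u D "- D"] by simp

lemma frag_lin_cmul: "frag_lin u (frag_cmul n D) = n * frag_lin u D"
  using frag_lin_superset[of "Poly_Mapping.keys D" "frag_cmul n D" u]
  by (simp add: frag_lin_def keys_cmul sum_distrib_left mult.assoc)

lemma keys_frag_combination:
  assumes "set Ds \<subseteq> {D. Poly_Mapping.keys D \<subseteq> S}"
  shows "Poly_Mapping.keys (\<Sum>i<length Ds. frag_cmul (n i) (Ds ! i)) \<subseteq> S"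
proof -
  have "Poly_Mapping.keys (frag_cmul (n i) (Ds ! i)) \<subseteq> S" if "i < length Ds" for i
    using assms nth_mem[OF that] keys_cmul[of "n i" "Ds ! i"] by blast
  then have "Poly_Mapping.keys (\<Sum>i\<in>{..<length Ds}. frag_cmul (n i) (Ds ! i)) \<subseteq>
      (\<Union>i\<in>{..<length Ds}. Poly_Mapping.keys (frag_cmul (n i) (Ds ! i)))"
    by (intro keys_sum)
  then show ?thesis using \<open>\<And>i. i < length Ds \<Longrightarrow> _\<close> by blast
qed

context weighted_plane_char_0
begin

text \<open>
  The exceptional curve has no equation in \<open>k[x,y,z]\<close>: it does not contribute to the degree, but its
  coefficient lowers the multiplicity that is required at \<open>(1,1,1)\<close>.
\<close>

definition divisor_deg :: "('k poly3 fract set \<Rightarrow>\<^sub>0 int) \<Rightarrow> int" where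
  "divisor_deg = frag_lin (\<lambda>R. ram R * int (eq_deg R))"

definition divisor_mult :: "('k poly3 fract set \<Rightarrow>\<^sub>0 int) \<Rightarrow> int" where
  "divisor_mult = frag_lin (\<lambda>R. if R = E0 then - ram R else ram R * int (mult_one (equation R)))"

definition divisor_eq :: "('k poly3 fract set \<Rightarrow>\<^sub>0 int) \<Rightarrow> 'k poly3 fract" where
  "divisor_eq D = (\<Prod>R\<in>Poly_Mapping.keys D. Fract (equation R) 1 powi (ram R * Poly_Mapping.lookup D R))"

lemma divisor_eq_superset: "finite S \<Longrightarrow> Poly_Mapping.keys D \<subseteq> S \<Longrightarrow>
    divisor_eq D = (\<Prod>R\<in>S. Fract (equation R) 1 powi (ram R * Poly_Mapping.lookup D R))"
  unfolding divisor_eq_def by (rule prod.mono_neutral_left) (auto simp: in_keys_iff)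

lemma Fract_equation: "R \<in> PD \<Longrightarrow> Fract (equation R) 1 \<noteq> 0"
  using equation(2) by (simp add: Fract_eq_0_iff)

lemma divisor_eq_nonzero: "Poly_Mapping.keys D \<subseteq> PD \<Longrightarrow> divisor_eq D \<noteq> 0"
  unfolding divisor_eq_def using Fract_equation by (auto simp: subset_iff)

lemma divisor_eq_add:
  assumes "Poly_Mapping.keys D \<subseteq> PD" "Poly_Mapping.keys D' \<subseteq> PD"
  shows "divisor_eq (D + D') = divisor_eq D * divisor_eq D'"
proof -
  let ?S = "Poly_Mapping.keys D \<union> Poly_Mapping.keys D'"
  have "Poly_Mapping.keys (D + D') \<subseteq> ?S" by (rule Poly_Mapping.keys_add)
  then have "divisor_eq (D + D') = (\<Prod>R\<in>?S. Fract (equation R) 1 powi (ram R * Poly_Mapping.lookup (D + D') R))"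
    by (simp add: divisor_eq_superset)
  also have "\<dots> = (\<Prod>R\<in>?S. Fract (equation R) 1 powi (ram R * Poly_Mapping.lookup D R) *
      Fract (equation R) 1 powi (ram R * Poly_Mapping.lookup D' R))"
  proof (intro prod.cong refl)
    fix R assume "R \<in> ?S"
    then have "R \<in> PD" using assms by blast
    then show "Fract (equation R) 1 powi (ram R * Poly_Mapping.lookup (D + D') R) =
      Fract (equation R) 1 powi (ram R * Poly_Mapping.lookup D R) * Fract (equation R) 1 powi (ram R * Poly_Mapping.lookup D' R)"
      by (simp add: lookup_add distrib_left power_int_add[OF disjI1[OF Fract_equation]])
  qed
  also have "\<dots> = divisor_eq D * divisor_eq D'"
    by (simp add: prod.distrib divisor_eq_superset[of ?S])
  finally show ?thesis .
qed

lemma divisor_eq_0 [simp]: "divisor_eq 0 = 1"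
  by (simp add: divisor_eq_def)

lemma homfrac_equation: "R \<in> PD \<Longrightarrow> homfrac a b c (int (eq_deg R)) (Fract (equation R) 1)"
  unfolding homfrac_def
  by (intro exI[of _ "equation R"] exI[of _ 1] exI[of _ "eq_deg R"] exI[of _ 0])
    (simp add: equation homogeneous_1)

lemma homfrac_divisor_eq:
  assumes "Poly_Mapping.keys D \<subseteq> PD"
  shows "homfrac a b c (divisor_deg D) (divisor_eq D)"
proof -
  have "homfrac a b c (\<Sum>R\<in>Poly_Mapping.keys D. ram R * Poly_Mapping.lookup D R * int (eq_deg R)) (divisor_eq D)"
    unfolding divisor_eq_def using assms by (intro homfrac_prod homfrac_powi homfrac_equation) auto
  then show ?thesis by (simp add: divisor_deg_def frag_lin_def ac_simps)
qed

lemma poly_valuation_val: "R \<in> PD \<Longrightarrow> poly_valuation (if R = E0 then mult_one else pmult (rep R))"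
  using E.poly_valuation_axioms poly_valuation_pmult[OF rep(1)] by simp

lemma val_Fract_1:
  assumes "R \<in> PD" "P \<noteq> 0"
  shows "val R (Fract P 1) = (if R = E0 then int (mult_one P) else int (pmult (rep R) P))"
proof -
  interpret poly_valuation "if R = E0 then mult_one else pmult (rep R)" by (rule poly_valuation_val[OF assms(1)])
  have "w' 1 = 0" if "poly_valuation w'" for w' :: "'k poly3 \<Rightarrow> nat"
    using poly_valuation.w_mult[OF that, of 1 1] by simp
  from this[OF poly_valuation_val[OF assms(1)]] show ?thesis
    unfolding val_def frac_val_Fract[OF assms(2) one_neq_zero] by simp
qed

lemma val_prod_powi:
  assumes R: "R \<in> PD" and q: "\<And>i. i \<in> I \<Longrightarrow> q i \<noteq> 0"
  shows "val R (\<Prod>i\<in>I. q i powi n i) = (\<Sum>i\<in>I. n i * val R (q i))"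
proof -
  interpret poly_valuation "if R = E0 then mult_one else pmult (rep R)" by (rule poly_valuation_val[OF R])
  show ?thesis unfolding val_def using q by (simp add: frac_val_prod frac_val_powi)
qed

lemma pmult_rep:
  assumes "R \<in> PD" "R \<noteq> E0" "S \<in> PD" "S \<noteq> E0"
  shows "pmult (rep R) (rep S) = (if R = S then 1 else 0)"
proof (cases "R = S")
  case True
  note F = rep(1)[OF assms(1,2)]
  have "pmult (rep R) (rep R) = 1" by (rule pmult_eqI[OF F, of _ _ 1]) (use prime_elem_not_unit[OF F] in auto)
  then show ?thesis using True by simp
next
  case False
  have "\<not> rep R dvd rep S"
  proof
    assume dvd: "rep R dvd rep S"
    have "pmult (rep R) = pmult (rep S)"
      by (rule pmult_associated[OF dvd prime_dvd_prime_symmetric[OF rep(1)[OF assms(1,2)] rep(1)[OF assms(3,4)] dvd]])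
    then show False using rep(3)[OF assms(1,2)] rep(3)[OF assms(3,4)] False by metis
  qed
  then show ?thesis using False
    by (auto intro!: pmult_eqI[OF rep(1)[OF assms(1,2)], of _ _ "rep S"])
qed

text \<open>Along a curve only its own equation contributes. Along \<open>E0\<close> every equation
  contributes its multiplicity, except that of \<open>E0\<close> itself, which is 1; the summand
  \<open>- ram E0\<close> in \<open>divisor_mult\<close> compensates for the term with the
  coefficient of \<open>E0\<close>.\<close>

lemma val_divisor_eq:
  assumes D: "Poly_Mapping.keys D \<subseteq> PD" and R: "R \<in> PD"
  shows "val R (divisor_eq D) = ram R * Poly_Mapping.lookup D R + (if R = E0 then divisor_mult D else 0)"
proof -
  let ?D = "Poly_Mapping.lookup D"
  let ?S = "insert R (Poly_Mapping.keys D)"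
  have S: "?S \<subseteq> PD" "finite ?S" using D R by auto
  have *: "val R (divisor_eq D) = (\<Sum>S\<in>?S. ram S * ?D S * val R (Fract (equation S) 1))"
    unfolding divisor_eq_superset[OF S(2) subset_insertI]
    by (rule val_prod_powi[OF R]) (use S Fract_equation in blast)
  have E: "val R (Fract (equation E0) 1) = 0" if "E0 \<in> PD"
    using val_Fract_1[OF R equation(2)[OF that]] poly_valuation.w_mult[OF poly_valuation_val[OF R], of 1 1]
    by (auto simp: equation_def split: if_splits)
  show ?thesis
  proof (cases "R = E0")
    case True
    have "ram S * ?D S * val R (Fract (equation S) 1) =
        (if S = R then ram R * ?D R else 0) + ?D S * (if S = E0 then - ram S else ram S * int (mult_one (equation S)))"
      if "S \<in> ?S" for S
      using E val_Fract_1[OF R equation(2)] S that R True by auto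
    then have "val R (divisor_eq D) = (\<Sum>S\<in>?S. (if S = R then ram R * ?D R else 0) +
        ?D S * (if S = E0 then - ram S else ram S * int (mult_one (equation S))))"
      unfolding * by (intro sum.cong refl)
    also have "\<dots> = ram R * ?D R + divisor_mult D"
      unfolding divisor_mult_def frag_lin_superset[OF S(2) subset_insertI] sum.distrib by simp
    finally show ?thesis using True by simp
  next
    case False
    have "ram S * ?D S * val R (Fract (equation S) 1) = (if S = R then ram R * ?D R else 0)"
      if "S \<in> ?S" for S
    proof (cases "S = E0")
      case True
      then show ?thesis using E that S False by auto
    next
      case S': False
      have SP: "S \<in> PD" using that S by blast
      have eq: "equation S = rep S" using S' by (simp add: equation_def)
      show ?thesis using val_Fract_1[OF R equation(2)[OF SP]] False pmult_rep[OF R False SP S']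
        unfolding eq by auto
    qed
    then have "val R (divisor_eq D) = (\<Sum>S\<in>?S. if S = R then ram R * ?D R else 0)"
      unfolding * by (intro sum.cong refl)
    then show ?thesis using False by simp
  qed
qed

lemma K_iff_homfrac: "q \<noteq> 0 \<Longrightarrow> q \<in> K \<longleftrightarrow> homfrac a b c 0 q"
proof
  assume q: "q \<noteq> 0" "q \<in> K"
  then obtain G H d where "q = Fract G H" "hom d G" "hom d H" "H \<noteq> 0" unfolding K_def by blast
  then show "homfrac a b c 0 q" using q unfolding homfrac_def
    by (intro exI[of _ G] exI[of _ H] exI[of _ d]) (auto simp: Fract_eq_0_iff)
next
  assume "homfrac a b c 0 q"
  then obtain G H d where "q = Fract G H" "hom d G" "hom d H" "H \<noteq> 0" unfolding homfrac_def by auto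
  then show "q \<in> K" unfolding K_def by blast
qed

lemma E0_in_PD: "E0 \<in> PD"
  unfolding prime_divisors_Bl by simp

lemma vring_pmult_in_PD: "prime_elem F \<Longrightarrow> hom d F \<Longrightarrow> vring (pmult F) \<in> PD"
  unfolding prime_divisors_Bl by (intro insertI2 CollectI exI conjI) (rule refl | assumption)+

lemma pmult_rep_vring:
  assumes "prime_elem F" "hom d F"
  shows "pmult (rep (vring (pmult F))) = pmult F"
proof -
  note R = vring_pmult_in_PD[OF assms] exceptional_ne[OF assms]
  have "rep (vring (pmult F)) dvd F" by (rule vring_pmult_eq_imp_dvd[OF assms rep(1)[OF R] rep(3)[OF R]])
  then show ?thesis
    using prime_dvd_prime_symmetric[OF rep(1)[OF R] assms(1)] by (intro pmult_associated)
qed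

lemma ord_along_ge_iff:
  assumes "R \<in> PD" "h \<in> K" "h \<noteq> 0"
  shows "ord_along R h + n \<ge> 0 \<longleftrightarrow> val R h + ram R * n \<ge> 0"
proof -
  have "val R h + ram R * n = ram R * (ord_along R h + n)"
    using ram(2)[OF assms] by (simp add: distrib_left)
  then show ?thesis using ram(1)[OF assms(1)] by (simp add: zero_le_mult_iff)
qed

lemma sections_Bl_iff:
  assumes D: "Poly_Mapping.keys D \<subseteq> PD"
  shows "h \<in> sections Bl D \<longleftrightarrow> h = 0 \<or> (\<exists>P d. h * divisor_eq D = Fract P 1 \<and> hom d P \<and> P \<noteq> 0 \<and>
    int d = divisor_deg D \<and> int (mult_one P) \<ge> divisor_mult D)" (is "_ \<longleftrightarrow> h = 0 \<or> ?R")
proof (cases "h = 0")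
  case True
  then show ?thesis using subring_setD(1)[OF subring_K] by (simp add: sections_def function_field_Bl)
next
  case h: False
  note s = divisor_eq_nonzero[OF D]
  \<comment> \<open>Scaling the inequality for \<open>ord_along\<close> by the positive
    \<open>ram R\<close> turns the conditions on \<open>h\<close> into lower bounds for its product
    with the equation: 0 along curves and \<open>divisor_mult D\<close> along
    \<open>E0\<close>.\<close>
  have cond: "val R (h * divisor_eq D) = (val R h + ram R * Poly_Mapping.lookup D R) + (if R = E0 then divisor_mult D else 0)"
    if "R \<in> PD" for R
    using val_mult[OF that h s] val_divisor_eq[OF D that] by simp
  have sec: "h \<in> sections Bl D \<longleftrightarrow> h \<in> K \<and> (\<forall>R\<in>PD. val R (h * divisor_eq D) \<ge> (if R = E0 then divisor_mult D else 0))"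
    unfolding sections_def function_field_Bl using h ord_along_ge_iff[OF _ _ h] cond by auto
  show ?thesis
  proof
    assume "h \<in> sections Bl D"
    then have hK: "h \<in> K" and val: "\<And>R. R \<in> PD \<Longrightarrow> val R (h * divisor_eq D) \<ge> (if R = E0 then divisor_mult D else 0)"
      using sec by auto
    have "homfrac a b c (0 + divisor_deg D) (h * divisor_eq D)"
      using hK h by (intro homfrac_mult homfrac_divisor_eq D) (simp add: K_iff_homfrac)
    then have hf: "homfrac a b c (divisor_deg D) (h * divisor_eq D)" by simp
    have nn: "frac_val (pmult F) (h * divisor_eq D) \<ge> 0" if F: "prime_elem F" "hom d F" for F d
      using val[OF vring_pmult_in_PD[OF F]] exceptional_ne[OF F] pmult_rep_vring[OF F] by (simp add: val_def)
    obtain P d where P: "h * divisor_eq D = Fract P 1" "hom d P" "P \<noteq> 0" "int d = divisor_deg D"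
      by (rule homfrac_polynomial[OF hf nn])
    then have "int (mult_one P) \<ge> divisor_mult D"
      using val[OF E0_in_PD] val_Fract_1[OF E0_in_PD P(3)] by simp
    then show "h = 0 \<or> ?R" using P by blast
  next
    assume "h = 0 \<or> ?R"
    then obtain P d where P: "h * divisor_eq D = Fract P 1" "hom d P" "P \<noteq> 0" "int d = divisor_deg D"
      "int (mult_one P) \<ge> divisor_mult D" using h by blast
    have hP: "homfrac a b c (int d) (Fract P 1)" unfolding homfrac_def
      by (intro exI[of _ P] exI[of _ 1] exI[of _ d] exI[of _ 0]) (use P in \<open>simp add: homogeneous_1\<close>)
    have h': "h = Fract P 1 * inverse (divisor_eq D)" using s unfolding P(1)[symmetric] by simp
    have "homfrac a b c (int d + - divisor_deg D) h"
      unfolding h' by (intro homfrac_mult hP homfrac_inverse homfrac_divisor_eq D)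
    then have "h \<in> K" using P(4) by (simp add: K_iff_homfrac[OF h])
    moreover have "val R (h * divisor_eq D) \<ge> (if R = E0 then divisor_mult D else 0)" if "R \<in> PD" for R
      unfolding P(1) using val_Fract_1[OF that P(3)] P(5) by simp
    ultimately show "h \<in> sections Bl D" using sec by blast
  qed
qed

end

section \<open>Numerical classes realized by multidegrees\<close>

definition frag_comb :: "('a \<Rightarrow>\<^sub>0 int) list \<Rightarrow> (nat \<Rightarrow>\<^sub>0 int) \<Rightarrow> 'a \<Rightarrow>\<^sub>0 int" where
  "frag_comb Ds m = (\<Sum>i<length Ds. frag_cmul (Poly_Mapping.lookup m i) (Ds ! i))"

lemma frag_comb_0 [simp]: "frag_comb Ds 0 = 0"
  by (simp add: frag_comb_def)

lemma frag_comb_add: "frag_comb Ds (m + m') = frag_comb Ds m + frag_comb Ds m'"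
  by (simp add: frag_comb_def lookup_add frag_cmul_distrib sum.distrib)

lemma frag_comb_cmul: "frag_comb Ds (frag_cmul n m) = frag_cmul n (frag_comb Ds m)"
  by (simp add: frag_comb_def frag_cmul_sum)

lemma frag_comb_of: "i < length Ds \<Longrightarrow> frag_comb Ds (frag_of i) = Ds ! i"
proof -
  assume i: "i < length Ds"
  have "frag_comb Ds (frag_of i) = (\<Sum>j<length Ds. if j = i then Ds ! i else 0)"
    unfolding frag_comb_def by (intro sum.cong refl) (auto simp: lookup_single)
  then show ?thesis using i by simp
qed

lemma generate_weil_divisors:
  assumes "D \<in> generate (free_Abelian_group S) (set Ds)" "set Ds \<subseteq> carrier (free_Abelian_group S)"
  obtains m where "Poly_Mapping.keys m \<subseteq> {..<length Ds}" "D = frag_comb Ds m"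
proof -
  have "\<exists>m. Poly_Mapping.keys m \<subseteq> {..<length Ds} \<and> D = frag_comb Ds m" using assms(1)
  proof (induction rule: generate.induct)
    case one
    show ?case by (intro exI[of _ 0]) simp
  next
    case (incl D)
    then obtain i where "i < length Ds" "D = Ds ! i" by (auto simp: in_set_conv_nth)
    then show ?case by (intro exI[of _ "frag_of i"]) (simp add: frag_comb_of)
  next
    case (inv D)
    then obtain i where i: "i < length Ds" "D = Ds ! i" by (auto simp: in_set_conv_nth)
    have "D \<in> carrier (free_Abelian_group S)" using inv assms(2) by blast
    then have "Poly_Mapping.keys D \<subseteq> S" by (simp only: carrier_free_Abelian_group_iff)
    then have "inv\<^bsub>free_Abelian_group S\<^esub> D = - D" by simp
    then show ?case using i
      by (intro exI[of _ "frag_cmul (- 1) (frag_of i)"]) (simp add: frag_comb_of frag_comb_cmul del: frag_cmul_minus_one, simp)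
  next
    case (eng D D')
    then obtain m m' where "Poly_Mapping.keys m \<subseteq> {..<length Ds}" "D = frag_comb Ds m"
      "Poly_Mapping.keys m' \<subseteq> {..<length Ds}" "D' = frag_comb Ds m'" by (elim exE conjE)
    then show ?case using Poly_Mapping.keys_add[of m m']
      by (intro exI[of _ "m + m'"]) (auto simp: frag_comb_add)
  qed
  then show thesis using that by (elim exE conjE)
qed

context weighted_plane_char_0
begin

abbreviation "W \<equiv> weil_divisors Bl"

lemma ord_along_inverse: "R \<in> PD \<Longrightarrow> h \<in> K \<Longrightarrow> h \<noteq> 0 \<Longrightarrow> ord_along R (inverse h) = - ord_along R h"
proof -
  assume R: "R \<in> PD" and h: "h \<in> K" "h \<noteq> 0"
  have 1: "1 \<in> K" using subring_setD(2)[OF subring_K] .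
  have "ord_along R 1 = 0" using ord_along_mult[OF R 1 _ 1] by simp
  then show ?thesis using ord_along_mult[OF R h K_inverse[OF h(1)]] h by simp
qed

lemma principal_E:
  assumes "D \<in> principal_divisors Bl"
  obtains h where "h \<in> K" "h \<noteq> 0" "\<And>R. R \<in> PD \<Longrightarrow> Poly_Mapping.lookup D R = ord_along R h" "Poly_Mapping.keys D \<subseteq> PD"
  using assms unfolding principal_divisors_def function_field_Bl by auto

lemma subgroup_principal: "subgroup (principal_divisors Bl) W"
proof
  show "principal_divisors Bl \<subseteq> carrier W" unfolding principal_divisors_def by (rule Collect_restrict)
  have 1: "1 \<in> K" using subring_setD(2)[OF subring_K] .
  have "ord_along R 1 = 0" if "R \<in> PD" for R using ord_along_mult[OF that 1 _ 1] by simp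
  then show "\<one>\<^bsub>W\<^esub> \<in> principal_divisors Bl"
    unfolding principal_divisors_def function_field_Bl using 1 by (auto intro!: bexI[of _ 1])
next
  fix D D' assume "D \<in> principal_divisors Bl" "D' \<in> principal_divisors Bl"
  obtain h where h: "h \<in> K" "h \<noteq> 0" "\<And>R. R \<in> PD \<Longrightarrow> Poly_Mapping.lookup D R = ord_along R h" "Poly_Mapping.keys D \<subseteq> PD"
    using \<open>D \<in> principal_divisors Bl\<close> by (rule principal_E) blast
  obtain h' where h': "h' \<in> K" "h' \<noteq> 0" "\<And>R. R \<in> PD \<Longrightarrow> Poly_Mapping.lookup D' R = ord_along R h'" "Poly_Mapping.keys D' \<subseteq> PD"
    using \<open>D' \<in> principal_divisors Bl\<close> by (rule principal_E) blast
  have "Poly_Mapping.keys (D + D') \<subseteq> PD" using h(4) h'(4) Poly_Mapping.keys_add[of D D'] by blast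
  moreover have "h * h' \<in> K" using subring_setD(5)[OF subring_K h(1) h'(1)] .
  ultimately show "D \<otimes>\<^bsub>W\<^esub> D' \<in> principal_divisors Bl"
    unfolding principal_divisors_def function_field_Bl
    using h h' by (auto simp: lookup_add ord_along_mult intro!: bexI[of _ "h * h'"])
next
  fix D assume "D \<in> principal_divisors Bl"
  then obtain h where h: "h \<in> K" "h \<noteq> 0" "\<And>R. R \<in> PD \<Longrightarrow> Poly_Mapping.lookup D R = ord_along R h"
    and D: "Poly_Mapping.keys D \<subseteq> PD" by (rule principal_E) blast
  have "inv\<^bsub>W\<^esub> D = - D" using D by simp
  then show "inv\<^bsub>W\<^esub> D \<in> principal_divisors Bl"
    unfolding principal_divisors_def function_field_Bl
    using h D K_inverse[OF h(1)] ord_along_inverse[OF _ h(1,2)] by (auto intro!: bexI[of _ "inverse h"])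
qed

text \<open>For \<open>D\<close> the divisor of \<open>h\<close>, \<open>inverse h\<close> and
  \<open>h\<close> are sections of \<open>D\<close> and \<open>- D\<close>. The associated
  polynomials have product 1, so both have multiplicity 0, and neither \<open>D\<close> nor
  \<open>- D\<close> can have negative degree or positive \<open>divisor_mult\<close>.\<close>

lemma principal_numerically_trivial:
  assumes "D \<in> principal_divisors Bl"
  shows "divisor_deg D = 0" "divisor_mult D = 0"
proof -
  obtain h where h: "h \<in> K" "h \<noteq> 0" "\<And>R. R \<in> PD \<Longrightarrow> Poly_Mapping.lookup D R = ord_along R h"
    and D: "Poly_Mapping.keys D \<subseteq> PD"
    using assms by (rule principal_E) blast
  have D': "Poly_Mapping.keys (- D) \<subseteq> PD" using D by simp
  have "inverse h \<in> sections Bl D" unfolding sections_def function_field_Bl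
    using h ord_along_inverse[OF _ h(1,2)] K_inverse[OF h(1)] by auto
  then obtain P d where P: "inverse h * divisor_eq D = Fract P 1" "P \<noteq> 0" "int d = divisor_deg D"
      "int (mult_one P) \<ge> divisor_mult D" unfolding sections_Bl_iff[OF D] using h(2) by auto
  have "h \<in> sections Bl (- D)" unfolding sections_def function_field_Bl using h by auto
  then obtain P' d' where P': "h * divisor_eq (- D) = Fract P' 1" "P' \<noteq> 0" "int d' = divisor_deg (- D)"
      "int (mult_one P') \<ge> divisor_mult (- D)" unfolding sections_Bl_iff[OF D'] using h(2) by auto
  have "divisor_eq D * divisor_eq (- D) = 1" using divisor_eq_add[OF D D'] by simp
  then have "(inverse h * divisor_eq D) * (h * divisor_eq (- D)) = 1"
    using h(2) by (simp add: mult.assoc mult.left_commute[of _ h])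
  then have "Fract (P * P') 1 = 1" unfolding P(1) P'(1) by simp
  then have "P * P' = 1" by (simp add: One_fract_def eq_fract)
  then have "mult_one P + mult_one P' = mult_one (1 * 1 :: 'k poly3) - mult_one (1 :: 'k poly3)"
    using E.w_mult[OF P(2) P'(2)] by simp
  then have "mult_one P + mult_one P' = 0" using E.w_mult[of 1 1] by simp
  then show "divisor_mult D = 0" using P(4) P'(4) by (simp add: divisor_mult_def frag_lin_minus)
  show "divisor_deg D = 0" using P(3) P'(3) by (simp add: divisor_deg_def frag_lin_minus)
qed

text \<open>Degree and multiplicity factor through the class group, so the multiple of
  \<open>D\<close> that is a combination of \<open>Ds\<close> up to a principal divisor may be
  replaced by that combination.\<close>

lemma span_multiple:
  assumes Ds: "set Ds \<subseteq> carrier W" and span: "span_class_group Bl Ds" and D: "Poly_Mapping.keys D \<subseteq> PD"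
  obtains N :: nat and m where "N > 0" "Poly_Mapping.keys m \<subseteq> {..<length Ds}"
    "divisor_deg (frag_comb Ds m) = N * divisor_deg D" "divisor_mult (frag_comb Ds m) = N * divisor_mult D"
proof -
  let ?H = "principal_divisors Bl"
  have normal: "?H \<lhd> W" using subgroup_principal comm_group.normal_iff_subgroup[OF abelian_free_Abelian_group] by blast
  interpret \<phi>: group_hom W "class_group Bl" "divisor_class Bl"
    unfolding class_group_def divisor_class_def
    by (intro group_hom.intro group_hom_axioms.intro group_free_Abelian_group normal.factorgroup_is_group
        normal.r_coset_hom_Mod normal)
  have DW: "D \<in> carrier W" using D by simp
  obtain N :: nat where N: "N > 0"
    "divisor_class Bl D [^]\<^bsub>class_group Bl\<^esub> N \<in> generate (class_group Bl) (divisor_class Bl ` set Ds)"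
    using span \<phi>.hom_closed[OF DW] unfolding span_class_group_def by blast
  have "divisor_class Bl (D [^]\<^bsub>W\<^esub> N) \<in> divisor_class Bl ` generate W (set Ds)"
    using N(2) unfolding \<phi>.hom_nat_pow[OF DW] \<phi>.generate_img[OF Ds] .
  then obtain D' where D': "D' \<in> generate W (set Ds)" "divisor_class Bl (D [^]\<^bsub>W\<^esub> N) = divisor_class Bl D'"
    by (elim imageE)
  have "D [^]\<^bsub>W\<^esub> N = frag_cmul (int N) D" by simp
  moreover have "D [^]\<^bsub>W\<^esub> N \<in> carrier W" using DW by (intro \<phi>.G.nat_pow_closed)
  then have "D [^]\<^bsub>W\<^esub> N \<in> ?H #>\<^bsub>W\<^esub> (D [^]\<^bsub>W\<^esub> N)"
    by (rule group.rcos_self[OF group_free_Abelian_group _ subgroup_principal])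
  ultimately have "frag_cmul (int N) D \<in> ?H #>\<^bsub>W\<^esub> D'" using D'(2) unfolding divisor_class_def by simp
  then obtain Q where Q: "Q \<in> ?H" "frag_cmul (int N) D = Q + D'" unfolding r_coset_def by auto
  obtain m where m: "Poly_Mapping.keys m \<subseteq> {..<length Ds}" "D' = frag_comb Ds m"
    by (rule generate_weil_divisors[OF D'(1) Ds])
  have "frag_lin u (frag_comb Ds m) = int N * frag_lin u D - frag_lin u Q" for u
    using arg_cong[OF Q(2), of "frag_lin u"] unfolding m(2) by (simp add: frag_lin_add frag_lin_cmul)
  then show thesis using that[OF N(1) m(1)] principal_numerically_trivial[OF Q(1)]
    by (simp add: divisor_deg_def divisor_mult_def)
qed

lemma homogeneous_degree_0_unit: "hom 0 F \<Longrightarrow> F \<noteq> 0 \<Longrightarrow> F dvd 1"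
  by (rule unit_if_no_variables) (use abc in \<open>auto simp: homogeneous_iff_cf wdeg_def\<close>)

lemma exists_prime_divisor:
  obtains R where "R \<in> PD" "R \<noteq> E0" "eq_deg R > 0"
proof -
  have x0: "varx \<noteq> (0 :: 'k poly3)" by (rule mon_nonzero) simp
  have nu: "\<not> varx dvd (1 :: 'k poly3)"
  proof
    assume "varx dvd (1 :: 'k poly3)"
    then obtain G :: "'k poly3" where G: "1 = varx * G" by (elim dvdE)
    have "eval3 (1 :: 'k poly3) 0 1 1 = eval3 varx 0 1 1 * eval3 G 0 1 1"
      unfolding eval3_mult[symmetric] using G by (rule arg_cong)
    moreover have "eval3 (1 :: 'k poly3) 0 1 1 = 1" using eval3_mon[of "1 :: 'k" 0 0 0 0 1 1] by simp
    moreover have "eval3 (varx :: 'k poly3) 0 1 1 = 0" unfolding eval3_mon by simp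
    ultimately have "(1 :: 'k) = 0" by (metis mult_zero_left)
    then show False by (rule notE[OF one_neq_zero])
  qed
  obtain M where M: "mset_factors M (varx :: 'k poly3)" using mset_factors_exist[OF x0 nu] by blast
  have "M \<noteq> {#}" using mset_factorsD(3)[OF M] nu by auto
  then obtain F where F: "F \<in># M" by (meson multiset_nonemptyE)
  have pF: "prime_elem F" using mset_factorsD(1)[OF M F] by simp
  have "F dvd varx" using dvd_prod_msetD[OF F] mset_factorsD(3)[OF M] by simp
  then obtain G where G: "varx = F * G" by (elim dvdE)
  have "hom a (F * G)" unfolding G[symmetric] by (rule hom_vars)
  then obtain d where d: "hom d F" using homogeneous_factor[of a b c a F G] x0 unfolding G by metis
  let ?R = "vring (pmult F)"
  have R: "?R \<in> PD" "?R \<noteq> E0" by (rule vring_pmult_in_PD[OF pF d]) (rule exceptional_ne[OF pF d])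
  have "eq_deg ?R \<noteq> 0"
  proof
    assume "eq_deg ?R = 0"
    then have "hom 0 (rep ?R)" using equation(1)[OF R(1)] R(2) by (simp add: equation_def)
    then have "rep ?R dvd 1" using rep(1)[OF R] by (intro homogeneous_degree_0_unit) auto
    then show False using prime_elem_not_unit[OF rep(1)[OF R]] by blast
  qed
  then show thesis using that[OF R] by simp
qed

text \<open>A curve of positive degree and the exceptional curve, which has degree 0 and negative
  multiplicity, have linearly independent numerical classes. Hence the multidegrees reach all
  integral pairs up to a common factor \<open>N\<close>.\<close>

lemma span_realizes:
  assumes Ds: "set Ds \<subseteq> carrier W" and span: "span_class_group Bl Ds"
  obtains N :: nat where "N > 0" "\<And>p q. \<exists>m. Poly_Mapping.keys m \<subseteq> {..<length Ds} \<and>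
    divisor_deg (frag_comb Ds m) = int N * p \<and> divisor_mult (frag_comb Ds m) = int N * q"
proof -
  obtain R where R: "R \<in> PD" "R \<noteq> E0" "eq_deg R > 0" by (rule exists_prime_divisor)
  define \<delta> where "\<delta> = divisor_deg (frag_of R)"
  define \<mu> where "\<mu> = divisor_mult (frag_of R)"
  have \<delta>: "\<delta> > 0" using R ram(1)[OF R(1)] by (simp add: \<delta>_def divisor_deg_def)
  have "equation E0 = 1" by (simp add: equation_def)
  then have "eq_deg E0 = 0"
    using equation(1)[OF E0_in_PD] homogeneous_degree_unique[OF _ homogeneous_1, of a b c "eq_deg E0"] by simp
  then have E: "divisor_deg (frag_of E0) = 0" "divisor_mult (frag_of E0) = - ram E0"
    by (simp_all add: divisor_deg_def divisor_mult_def)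
  obtain N1 :: nat and m1 where m1: "N1 > 0" "Poly_Mapping.keys m1 \<subseteq> {..<length Ds}"
    "divisor_deg (frag_comb Ds m1) = N1 * \<delta>" "divisor_mult (frag_comb Ds m1) = N1 * \<mu>"
    using span_multiple[OF Ds span, of "frag_of R"] R(1) unfolding \<delta>_def \<mu>_def by auto
  obtain N2 :: nat and m2 where m2: "N2 > 0" "Poly_Mapping.keys m2 \<subseteq> {..<length Ds}"
    "divisor_deg (frag_comb Ds m2) = 0" "divisor_mult (frag_comb Ds m2) = N2 * (- ram E0)"
    using span_multiple[OF Ds span, of "frag_of E0"] E0_in_PD E by auto
  define N where "N = N1 * nat \<delta> * N2 * nat (ram E0)"
  have intN: "int N = int N1 * \<delta> * int N2 * ram E0"
    using \<delta> ram(1)[OF E0_in_PD] by (simp add: N_def)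
  show thesis
  proof (rule that[of N])
    show "N > 0" using m1(1) m2(1) \<delta> ram(1)[OF E0_in_PD] by (simp add: N_def)
    fix p q
    \<comment> \<open>The solution of the triangular system \<open>x N1 \<delta> = N p\<close> and
      \<open>x N1 \<mu> - y N2 ram E0 = N q\<close>.\<close>
    define x y where "x = int N2 * ram E0 * p" and "y = int N1 * (\<mu> * p - \<delta> * q)"
    let ?m = "frag_cmul x m1 + frag_cmul y m2"
    have "Poly_Mapping.keys ?m \<subseteq> {..<length Ds}"
      using m1(2) m2(2) Poly_Mapping.keys_add[of "frag_cmul x m1" "frag_cmul y m2"] keys_cmul[of x m1] keys_cmul[of y m2]
      by blast
    moreover have "divisor_deg (frag_comb Ds ?m) = int N * p" "divisor_mult (frag_comb Ds ?m) = int N * q"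
      using m1(3,4) m2(3,4) unfolding divisor_deg_def divisor_mult_def frag_comb_add frag_comb_cmul frag_lin_add frag_lin_cmul
      by (simp_all add: intN x_def y_def algebra_simps)
    ultimately show "\<exists>m. Poly_Mapping.keys m \<subseteq> {..<length Ds} \<and>
      divisor_deg (frag_comb Ds m) = int N * p \<and> divisor_mult (frag_comb Ds m) = int N * q" by blast
  qed
qed

end

section \<open>Infinite generation\<close>

text \<open>Allows a restriction on each homogeneous component to be passed from generators to the
  whole algebra.\<close>

lemma subring_set_graded:
  fixes T :: "'m::comm_monoid_add \<Rightarrow> 'f::comm_ring_1 set"
  assumes one: "1 \<in> T 0" and zero: "\<And>m. 0 \<in> T m" and diff: "\<And>m x y. x \<in> T m \<Longrightarrow> y \<in> T m \<Longrightarrow> x - y \<in> T m"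
    and mult: "\<And>m m' x y. x \<in> T m \<Longrightarrow> y \<in> T m' \<Longrightarrow> x * y \<in> T (m + m')"
  shows "subring_set {F. \<forall>m. Poly_Mapping.lookup F m \<in> T m}"
  unfolding subring_set_def
proof (intro conjI ballI CollectI allI)
  show "Poly_Mapping.lookup 1 m \<in> T m" for m
    using one zero by (simp add: lookup_one when_def)
next
  fix F G m assume F: "F \<in> {F. \<forall>m. Poly_Mapping.lookup F m \<in> T m}" and G: "G \<in> {F. \<forall>m. Poly_Mapping.lookup F m \<in> T m}"
  show "Poly_Mapping.lookup (F - G) m \<in> T m" using F G diff by (simp add: lookup_minus)
  have add: "x + y \<in> T m" if "x \<in> T m" "y \<in> T m" for x y
    using diff[OF that(1) diff[OF zero that(2)]] by simp
  have sum: "(\<Sum>i\<in>I. h i) \<in> T m" if "\<And>i. i \<in> I \<Longrightarrow> h i \<in> T m" for I :: "'m set" and h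
    using that by (induction I rule: infinite_finite_induct) (auto intro: add zero)
  have sing: "H = (\<Sum>k\<in>Poly_Mapping.keys H. Poly_Mapping.single k (Poly_Mapping.lookup H k))" for H :: "'m \<Rightarrow>\<^sub>0 'f"
    by (rule poly_mapping_eqI) (auto simp: lookup_sum lookup_single when_def in_keys_iff)
  have "F * G = (\<Sum>k\<in>Poly_Mapping.keys F. \<Sum>k'\<in>Poly_Mapping.keys G.
      Poly_Mapping.single (k + k') (Poly_Mapping.lookup F k * Poly_Mapping.lookup G k'))"
    by (subst sing[of F], subst sing[of G]) (simp add: sum_product mult_single)
  then have "Poly_Mapping.lookup (F * G) m = (\<Sum>k\<in>Poly_Mapping.keys F. \<Sum>k'\<in>Poly_Mapping.keys G.
      Poly_Mapping.lookup F k * Poly_Mapping.lookup G k' when k + k' = m)"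
    by (simp add: lookup_sum lookup_single)
  also have "\<dots> \<in> T m"
    using F G mult zero by (intro sum) (auto simp: when_def)
  finally show "Poly_Mapping.lookup (F * G) m \<in> T m" .
qed

lemma eval3_010_nonzero:
  fixes P :: "'k::field poly3"
  assumes "eval3 P 0 1 0 \<noteq> 0"
  obtains j where "cf P (0,j,0) \<noteq> 0"
proof -
  have "\<exists>Q\<in>supp P. eval3 (mon (cf P Q) Q) 0 1 0 \<noteq> 0"
  proof (rule ccontr)
    assume "\<not> ?thesis"
    then have "(\<Sum>Q\<in>supp P. eval3 (mon (cf P Q) Q) 0 1 0) = 0" by (intro sum.neutral) blast
    then show False using assms hom_sum_supp[OF comm_ring_hom_eval3[of 0 1 0], of P] by simp
  qed
  then obtain i j l where "eval3 (mon (cf P (i,j,l)) (i,j,l)) 0 1 0 \<noteq> 0" by (metis prod_cases3)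
  then have "cf P (i,j,l) \<noteq> 0" "i = 0" "l = 0" by (auto simp: eval3_mon)
  then show thesis using that by blast
qed

context weighted_plane_char_0
begin

lemma top_value_bound:
  fixes n d :: nat and e f g :: int and P :: "'k poly3" and \<mu> :: int
  assumes data: "relation_data (int a) (int b) (int c) e f g"
    and n_def: "n = card {\<delta>::int. \<delta> \<le> 0 \<and> int b + \<delta> * e \<ge> 0 \<and> int a - \<delta> * f \<ge> 0 \<and>
          g dvd int b + \<delta> * e \<and> g dvd int a - \<delta> * f}"
    and exactly_n: "card {\<gamma>::int. \<gamma> \<ge> 0 \<and> (int n - 1) * int b + \<gamma> * e \<ge> 0 \<and> (int n - 1) * int a - \<gamma> * f \<ge> 0 \<and>
          g dvd (int n - 1) * int b + \<gamma> * e \<and> g dvd (int n - 1) * int a - \<gamma> * f} = n"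
    and not_cong: "\<not> (g dvd n * int b \<and> g dvd n * int a)"
    and P: "P \<noteq> 0" "hom d P" "eval3 P 0 1 0 \<noteq> 0" "int (mult_one P) \<ge> \<mu>" "\<mu> > 0"
  shows "g * int d > int a * int b * \<mu>"
proof (rule ccontr)
  assume "\<not> ?thesis"
  then have le: "g * int d \<le> int a * int b * \<mu>" by simp
  obtain j where j: "cf P (0,j,0) \<noteq> 0" by (rule eval3_010_nonzero[OF P(3)])
  then have "wdeg a b c (0,j,0) = d" using P(2) unfolding homogeneous_iff_cf by blast
  then have d: "d = b * j" by (simp add: wdeg_def)
  have "int b * (g * int j) \<le> int b * (int a * \<mu>)" using le unfolding d by (simp add: mult.left_commute mult.assoc)
  then have le': "g * int j \<le> int a * \<mu>" using abc(2) by simp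
  have j0: "j > 0"
  proof (rule ccontr)
    assume "\<not> j > 0"
    then have "hom 0 P" using P(2) d by simp
    then have "P dvd 1" using P(1) by (rule homogeneous_degree_0_unit)
    then obtain Q where Q: "1 = P * Q" by (elim dvdE)
    then have "Q \<noteq> 0" by auto
    then have "mult_one (1 :: 'k poly3) = mult_one P + mult_one Q" unfolding Q by (rule E.w_mult[OF P(1)])
    then show False using E.w_mult[of 1 1] P(4,5) by simp
  qed
  have g: "g > 0" using relation_data.pos(6)[OF data] .
  \<comment> \<open>The factor \<open>a\<close> in \<open>k\<close> makes the degree of
    \<open>P ^ k\<close> equal to \<open>a b s\<close>; the factor \<open>n + 1\<close> makes
    \<open>g s\<close> exceed \<open>n\<close>, as the test functions require.\<close>
  define s where "s = j * (n + 1)"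
  define k where "k = a * (n + 1)"
  have nz: "P ^ k \<noteq> 0" using P(1) by simp
  have hk: "hom (k * d) (P ^ k)" by (rule homogeneous_power[OF P(2)])
  have kd: "k * d = a * b * s" by (simp add: k_def d s_def algebra_simps)
  have mult: "g * int s \<le> int (mult_one (P ^ k))"
  proof -
    have 1: "g * int s = g * int j * (int n + 1)" by (simp add: s_def algebra_simps)
    have 2: "g * int j * (int n + 1) \<le> int a * \<mu> * (int n + 1)" by (rule mult_right_mono[OF le']) simp
    have 3: "int a * \<mu> * (int n + 1) \<le> int a * int (mult_one P) * (int n + 1)"
      by (rule mult_right_mono[OF mult_left_mono[OF P(4)]]) simp_all
    have 4: "int (mult_one (P ^ k)) = int a * int (mult_one P) * (int n + 1)"
      by (simp add: E.w_power[OF P(1)] k_def algebra_simps)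
    show ?thesis using 2 3 unfolding 1 4 by (rule order_trans)
  qed
  have large: "int n < g * int s"
  proof -
    have "n < s" using j0 unfolding s_def by (cases j) simp_all
    moreover have "1 * int s \<le> g * int s" using g by (intro mult_right_mono) simp_all
    ultimately show ?thesis by linarith
  qed
  interpret ev: comm_ring_hom "\<lambda>F :: 'k poly3. eval3 F 0 1 0" by (rule comm_ring_hom_eval3)
  have "eval3 (P ^ k) 0 1 0 = eval3 P 0 1 0 ^ k" by (rule ev.hom_power)
  then have "eval3 (P ^ k) 0 1 0 \<noteq> 0" using P(3) by simp
  then obtain j' where j': "cf (P ^ k) (0,j',0) \<noteq> 0" by (rule eval3_010_nonzero)
  have "cf (P ^ k) (0,j',0) = 0"
  proof (rule top_coefficient_vanishes[OF data n_def exactly_n not_cong, of "supp (P ^ k)" s])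
    show "finite (supp (P ^ k))" by simp
    show "int a * int i + int b * int j + int c * int l = int a * int b * int s" if "(i,j,l) \<in> supp (P ^ k)" for i j l
    proof -
      have "a * i + b * j + c * l = a * b * s" using that hk unfolding homogeneous_iff_cf kd supp_def wdeg_def by auto
      then have "int (a * i + b * j + c * l) = int (a * b * s)" by (rule arg_cong)
      then show ?thesis by simp
    qed
    show "(\<Sum>(i,j,l)\<in>supp (P ^ k). cf (P ^ k) (i,j,l) * of_nat (i choose p) * of_nat (j choose q)) = 0"
      if "int (p + q) < g * int s" for p q
    proof -
      have "p + q + 0 < mult_one (P ^ k)" using that mult by linarith
      then have "cf (shift (P ^ k)) (p,q,0) = 0" using le_mult_one_iff[OF nz, of "mult_one (P ^ k)"] by blast
      then show ?thesis using cf_shift[of "supp (P ^ k)" "P ^ k" p q 0] by simp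
    qed
    show "int n < g * int s" by (rule large)
    show "(0,j',0) \<in> supp (P ^ k)" using j' by (simp add: supp_def)
  qed
  then show False using j' by contradiction
qed

lemma exists_curve:
  fixes e f g t :: int and s m :: nat
  assumes data: "slope_data (int a) (int b) (int c) e f g t"
    and w: "g * g * int c < int a * int b" and m: "int m < g * int s"
  obtains F :: "'k poly3" where "F \<noteq> 0" "hom (a * b * s) F" "mult_one F \<ge> m" "eval3 F 0 1 0 = 1"
proof -
  define d where "d = a * s"
  have d: "int d = int a * int s" by (simp add: d_def)
  obtain T :: "(int \<times> int) set" and \<alpha> :: "int \<times> int \<Rightarrow> 'k" and E :: "int \<times> int \<Rightarrow> nat \<times> nat \<times> nat"
    where T: "finite T"
    and deg: "\<And>P i j l. P \<in> T \<Longrightarrow> E P = (i,j,l) \<Longrightarrow> int a * int i + int b * int j + int c * int l = int a * int b * int s"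
    and ne: "\<And>P. P \<in> T \<Longrightarrow> E P \<noteq> (0,d,0)"
    and mom: "\<And>p q r. p + q + r < m \<Longrightarrow> (\<Sum>P\<in>T. \<alpha> P * (case E P of (i,j,l) \<Rightarrow>
       of_nat (i choose p) * of_nat (j choose q) * of_nat (l choose r))) =
       of_nat (0 choose p) * of_nat (d choose q) * of_nat (0 choose r)"
    by (rule slope_data.nonvanishing_combination[OF data w m d]) blast
  \<comment> \<open>The corner monomial minus its interpolation: by \<open>mom\<close> the two parts
    have the same Taylor coefficients at (1,1,1) below order \<open>m\<close>, while the sum
    involves no monomial that is nonzero at (0,1,0).\<close>
  define F :: "'k poly3" where "F = mon 1 (0,d,0) - (\<Sum>P\<in>T. mon (\<alpha> P) (E P))"
  have deg': "a * i + b * j + c * l = a * b * s" if "P \<in> T" "E P = (i,j,l)" for P i j l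
  proof -
    have "int (a * i + b * j + c * l) = int (a * b * s)" using deg[OF that] by simp
    then show ?thesis by (simp only: of_nat_eq_iff)
  qed
  have hom: "hom (a * b * s) F" unfolding F_def
  proof (intro homogeneous_diff homogeneous_sum homogeneous_mon)
    show "wdeg a b c (0,d,0) = a * b * s" by (simp add: wdeg_def d_def)
    show "wdeg a b c (E P) = a * b * s" if "P \<in> T" for P
      using deg'[OF that] by (cases "E P") (simp add: wdeg_def)
  qed
  interpret ev: comm_ring_hom "\<lambda>F :: 'k poly3. eval3 F 0 1 0" by (rule comm_ring_hom_eval3)
  have "eval3 (mon (\<alpha> P) (E P)) 0 1 0 = 0" if P: "P \<in> T" for P
  proof (cases "E P")
    case (fields i j l)
    have "\<not> (i = 0 \<and> l = 0)"
    proof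
      assume "i = 0 \<and> l = 0"
      then have "b * j = b * (a * s)" using deg'[OF P fields] by (simp add: ac_simps)
      then have "j = d" using abc(2) by (simp add: d_def)
      then show False using ne[OF P] fields \<open>i = 0 \<and> l = 0\<close> by simp
    qed
    then show ?thesis unfolding fields eval3_mon by auto
  qed
  then have one: "eval3 F 0 1 0 = 1"
    unfolding F_def ev.hom_minus ev.hom_sum eval3_mon by simp
  then have F0: "F \<noteq> 0" by auto
  interpret sh: comm_ring_hom "shift :: 'k poly3 \<Rightarrow> 'k poly3" by (rule comm_ring_hom_shift)
  have "m \<le> mult_one F" unfolding le_mult_one_iff[OF F0]
  proof (intro allI impI)
    fix p q r assume pqr: "p + q + r < m"
    have "cf (shift (mon (\<alpha> P) (E P))) (p,q,r) = \<alpha> P * (case E P of (i,j,l) \<Rightarrow>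
       of_nat (i choose p) * of_nat (j choose q) * of_nat (l choose r))" for P
      by (cases "E P") (simp add: cf_shift_mon mult.assoc)
    then show "cf (shift F) (p,q,r) = 0"
      unfolding F_def sh.hom_minus sh.hom_sum cf_diff cf_sum cf_shift_mon using mom[OF pqr] by simp
  qed
  then show thesis using that[OF F0 hom _ one] by blast
qed

definition top_value :: "'k poly3 fract \<Rightarrow> 'k" where
  "top_value q = eval3 (THE P. q = Fract P 1) 0 1 0"

lemma top_value_Fract [simp]: "top_value (Fract P 1) = eval3 P 0 1 0"
  unfolding top_value_def by (simp add: eq_fract)

definition polynomials :: "'k poly3 fract set" where
  "polynomials = range (\<lambda>P. Fract P 1)"

lemma polynomials_closed:
  assumes "p \<in> polynomials" "q \<in> polynomials"
  shows "p - q \<in> polynomials" "p * q \<in> polynomials"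
    "top_value (p - q) = top_value p - top_value q" "top_value (p * q) = top_value p * top_value q"
proof -
  obtain P Q where PQ: "p = Fract P 1" "q = Fract Q 1" using assms unfolding polynomials_def by blast
  have eq: "p - q = Fract (P - Q) 1" "p * q = Fract (P * Q) 1" unfolding PQ by simp_all
  then show "p - q \<in> polynomials" "p * q \<in> polynomials" unfolding polynomials_def by blast+
  show "top_value (p - q) = top_value p - top_value q" "top_value (p * q) = top_value p * top_value q"
    unfolding eq unfolding PQ by (simp_all add: eval3_mult eval3_diff)
qed

text \<open>The set \<open>T m\<close> in the proof allows a section to be nonzero at \<open>(0,1,0)\<close> only if \<open>\<mu> \<le> C (g \<delta> - a b \<mu>)\<close>.\<close>

theorem not_finitely_generated:
  fixes n :: nat and e f g :: int
  assumes data: "relation_data (int a) (int b) (int c) e f g"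
    and n_def: "n = card {\<delta>::int. \<delta> \<le> 0 \<and> int b + \<delta> * e \<ge> 0 \<and> int a - \<delta> * f \<ge> 0 \<and>
          g dvd int b + \<delta> * e \<and> g dvd int a - \<delta> * f}"
    and exactly_n: "card {\<gamma>::int. \<gamma> \<ge> 0 \<and> (int n - 1) * int b + \<gamma> * e \<ge> 0 \<and> (int n - 1) * int a - \<gamma> * f \<ge> 0 \<and>
          g dvd (int n - 1) * int b + \<gamma> * e \<and> g dvd (int n - 1) * int a - \<gamma> * f} = n"
    and not_cong: "\<not> (g dvd n * int b \<and> g dvd n * int a)"
    and w: "g * g * int c < int a * int b"
  shows "\<not> has_fg_cox_ring scalars Bl"
proof
  assume "has_fg_cox_ring scalars Bl"
  then obtain Ds G where Ds: "set Ds \<subseteq> carrier W" and span: "span_class_group Bl Ds"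
    and G: "finite G" "G \<subseteq> cox_ring Bl Ds"
      "generate_ring ring_of_type_algebra (Poly_Mapping.single 0 ` scalars \<union> G) = cox_ring Bl Ds"
    unfolding has_fg_cox_ring_def finitely_generated_algebra_def by blast
  define M where "M = {m :: nat \<Rightarrow>\<^sub>0 int. Poly_Mapping.keys m \<subseteq> {..<length Ds}}"
  define s where "s m = divisor_eq (frag_comb Ds m)" for m
  define \<delta> where "\<delta> m = divisor_deg (frag_comb Ds m)" for m
  define \<mu> where "\<mu> m = divisor_mult (frag_comb Ds m)" for m
  define \<rho> where "\<rho> m = g * \<delta> m - int a * int b * \<mu> m" for m
  \<comment> \<open>An upper bound for \<open>\<mu>\<close> on all multidegrees of the generators.
    As \<open>\<rho>\<close> is an integer, \<open>\<rho> > 0\<close> means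
    \<open>\<rho> \<ge> 1\<close>, and so \<open>\<mu> \<le> C * \<rho>\<close>.\<close>
  define C where "C = (\<Sum>F\<in>G. \<Sum>m\<in>Poly_Mapping.keys F. \<bar>\<mu> m\<bar>)"
  have C0: "C \<ge> 0" unfolding C_def by (intro sum_nonneg) simp
  have M_add: "m + m' \<in> M" if "m \<in> M" "m' \<in> M" for m m'
    using that Poly_Mapping.keys_add[of m m'] unfolding M_def by blast
  have keys: "Poly_Mapping.keys (frag_comb Ds m) \<subseteq> PD" for m
    unfolding frag_comb_def using Ds by (intro keys_frag_combination) (auto simp: subset_iff)
  have s_add: "s (m + m') = s m * s m'" for m m'
    unfolding s_def frag_comb_add by (rule divisor_eq_add[OF keys keys])
  have add: "\<mu> (m + m') = \<mu> m + \<mu> m'" "\<rho> (m + m') = \<rho> m + \<rho> m'" for m m'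
    unfolding \<rho>_def \<mu>_def \<delta>_def divisor_deg_def divisor_mult_def frag_comb_add frag_lin_add by (simp_all add: algebra_simps)
  have zero: "\<mu> 0 = 0" "\<rho> 0 = 0" "s 0 = 1"
    unfolding \<rho>_def \<mu>_def \<delta>_def s_def divisor_deg_def divisor_mult_def by simp_all
  have cox: "F \<in> cox_ring Bl Ds \<longleftrightarrow> (\<forall>m\<in>Poly_Mapping.keys F. m \<in> M \<and> Poly_Mapping.lookup F m \<in> sections Bl (frag_comb Ds m))" for F
    unfolding cox_ring_def M_def frag_comb_def by simp
  \<comment> \<open>The two alternatives correspond to the sign of \<open>\<mu>\<close>. If it is
    positive, \<open>top_value_bound\<close> applies; otherwise \<open>\<rho> \<ge> 0\<close>
    because degrees are nonnegative.\<close>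
  have sec: "h * s m \<in> polynomials \<and> (top_value (h * s m) \<noteq> 0 \<longrightarrow> \<mu> m \<le> 0 \<and> \<rho> m \<ge> 0 \<or> \<rho> m > 0)"
    if h: "h \<in> sections Bl (frag_comb Ds m)" for h m
  proof (cases "h = 0")
    case True
    have "h * s m = Fract 0 1" using True by (simp add: Zero_fract_def)
    then show ?thesis unfolding polynomials_def by (simp add: eval3_def)
  next
    case False
    then obtain P d where P: "h * s m = Fract P 1" "hom d P" "P \<noteq> 0" "int d = \<delta> m" "int (mult_one P) \<ge> \<mu> m"
      using h unfolding sections_Bl_iff[OF keys] s_def \<mu>_def \<delta>_def by blast
    have "\<rho> m > 0" if "eval3 P 0 1 0 \<noteq> 0" "\<mu> m > 0"
      using top_value_bound[OF data n_def exactly_n not_cong P(3,2) that(1) P(5) that(2)]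
      unfolding \<rho>_def P(4) by simp
    moreover have "\<rho> m \<ge> 0" if "\<mu> m \<le> 0"
    proof -
      have "g * \<delta> m \<ge> 0" using relation_data.pos(6)[OF data] P(4) by simp
      moreover have "int a * int b * \<mu> m \<le> 0" using that by (intro mult_nonneg_nonpos) simp_all
      ultimately show ?thesis unfolding \<rho>_def by simp
    qed
    ultimately show ?thesis unfolding P(1) polynomials_def by fastforce
  qed
  define T where "T m = {x. x = 0 \<or> m \<in> M \<and> x * s m \<in> polynomials \<and> (top_value (x * s m) \<noteq> 0 \<longrightarrow> \<mu> m \<le> C * \<rho> m)}" for m
  have sub: "subring_set {F. \<forall>m. Poly_Mapping.lookup F m \<in> T m}"
  proof (rule subring_set_graded)
    have "1 * s 0 = Fract 1 1" by (simp add: zero One_fract_def)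
    then show "1 \<in> T 0" unfolding T_def M_def polynomials_def by (simp add: zero)
    show "0 \<in> T m" for m by (simp add: T_def)
  next
    fix m x y assume xy: "x \<in> T m" "y \<in> T m"
    have neg: "- z \<in> T m" if "z \<in> T m" for z
    proof (cases "z = 0")
      case False
      have zp: "0 \<in> polynomials" "top_value 0 = 0"
        unfolding polynomials_def using top_value_Fract[of 0] by (auto simp: Zero_fract_def eval3_def intro: image_eqI[of _ _ 0])
      then show ?thesis using that False polynomials_closed[OF zp(1), of "z * s m"] by (simp add: T_def)
    qed (simp add: T_def)
    show "x - y \<in> T m"
    proof (cases "x = 0 \<or> y = 0")
      case True
      then show ?thesis using xy(1) neg[OF xy(2)] by (elim disjE) simp_all
    next
      case False
      then have "m \<in> M" "x * s m \<in> polynomials" "y * s m \<in> polynomials"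
        "top_value (x * s m) \<noteq> 0 \<or> top_value (y * s m) \<noteq> 0 \<longrightarrow> \<mu> m \<le> C * \<rho> m" using xy by (auto simp: T_def)
      then show ?thesis using polynomials_closed[of "x * s m" "y * s m"]
        unfolding T_def mem_Collect_eq left_diff_distrib by auto
    qed
  next
    fix m m' x y assume xy: "x \<in> T m" "y \<in> T m'"
    show "x * y \<in> T (m + m')"
    proof (cases "x = 0 \<or> y = 0")
      case False
      then have *: "m \<in> M" "m' \<in> M" "x * s m \<in> polynomials" "y * s m' \<in> polynomials"
        "top_value (x * s m) \<noteq> 0 \<Longrightarrow> \<mu> m \<le> C * \<rho> m" "top_value (y * s m') \<noteq> 0 \<Longrightarrow> \<mu> m' \<le> C * \<rho> m'"
        using xy by (auto simp: T_def)
      have eq: "x * y * s (m + m') = (x * s m) * (y * s m')" by (simp add: s_add ac_simps)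
      show ?thesis using polynomials_closed[OF *(3,4)] *(5,6) M_add[OF *(1,2)]
        unfolding T_def mem_Collect_eq eq add distrib_left by auto
    qed (auto simp: T_def)
  qed
  have gens: "Poly_Mapping.single 0 ` scalars \<union> G \<subseteq> {F. \<forall>m. Poly_Mapping.lookup F m \<in> T m}"
  proof (intro Un_least subsetI)
    fix F :: "(nat \<Rightarrow>\<^sub>0 int) \<Rightarrow>\<^sub>0 'k poly3 fract" assume "F \<in> Poly_Mapping.single 0 ` (scalars :: 'k poly3 fract set)"
    then obtain u :: 'k where F: "F = Poly_Mapping.single 0 (Fract [:[:[:u:]:]:] 1)" unfolding scalars_def by blast
    have "Poly_Mapping.lookup F m \<in> T m" for m
    proof (cases "m = 0")
      case True
      then show ?thesis unfolding F T_def M_def polynomials_def by (simp add: zero)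
    next
      case False
      then show ?thesis unfolding F T_def by (simp add: lookup_single)
    qed
    then show "F \<in> {F. \<forall>m. Poly_Mapping.lookup F m \<in> T m}" by blast
  next
    fix F assume F: "F \<in> G"
    have "Poly_Mapping.lookup F m \<in> T m" for m
    proof (cases "m \<in> Poly_Mapping.keys F")
      case True
      then have m: "m \<in> M" "Poly_Mapping.lookup F m \<in> sections Bl (frag_comb Ds m)" using F G(2) cox by blast+
      have "\<bar>\<mu> m\<bar> \<le> (\<Sum>m\<in>Poly_Mapping.keys F. \<bar>\<mu> m\<bar>)" by (rule member_le_sum[OF True]) simp_all
      also have "\<dots> \<le> C" unfolding C_def by (rule member_le_sum[OF F]) (simp_all add: G(1) sum_nonneg)
      finally have le: "\<mu> m \<le> C" by simp
      have "\<mu> m \<le> C * \<rho> m" if "\<mu> m \<le> 0 \<and> \<rho> m \<ge> 0 \<or> \<rho> m > 0"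
        using that
      proof
        assume *: "\<mu> m \<le> 0 \<and> \<rho> m \<ge> 0"
        then have "0 \<le> C * \<rho> m" using C0 by simp
        then show ?thesis using * by linarith
      next
        assume "\<rho> m > 0"
        then have "C * 1 \<le> C * \<rho> m" using C0 by (intro mult_left_mono) simp_all
        then show ?thesis using le by linarith
      qed
      then show ?thesis using sec[OF m(2)] m(1) unfolding T_def by blast
    next
      case False
      then show ?thesis by (simp add: T_def in_keys_iff)
    qed
    then show "F \<in> {F. \<forall>m. Poly_Mapping.lookup F m \<in> T m}" by blast
  qed
  have cone: "\<mu> m \<le> C * \<rho> m" if m: "m \<in> M" and h: "h \<in> sections Bl (frag_comb Ds m)" "top_value (h * s m) \<noteq> 0" for m h
  proof -
    have "top_value 0 = 0" using top_value_Fract[of 0] by (simp add: fract_collapse eval3_def)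
    then have h0: "h \<noteq> 0" using h(2) by (metis mult_zero_left)
    have "Poly_Mapping.single m h \<in> cox_ring Bl Ds" unfolding cox using m h(1) by simp
    then have "Poly_Mapping.single m h \<in> {F. \<forall>m. Poly_Mapping.lookup F m \<in> T m}"
      using generate_ring_least[OF sub gens] unfolding G(3) by blast
    then have "Poly_Mapping.lookup (Poly_Mapping.single m h) m \<in> T m" by blast
    then show ?thesis using h0 h(2) by (simp add: T_def)
  qed
  obtain N :: nat where N: "N > 0" "\<And>p q. \<exists>m. Poly_Mapping.keys m \<subseteq> {..<length Ds} \<and>
    divisor_deg (frag_comb Ds m) = int N * p \<and> divisor_mult (frag_comb Ds m) = int N * q"
    by (rule span_realizes[OF Ds span]) blast
  obtain t where t: "slope_data (int a) (int b) (int c) e f g t"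
    by (rule relation_data.column_counts[OF data n_def exactly_n not_cong])
  have g: "g > 0" using relation_data.pos(6)[OF data] .
  \<comment> \<open>Chosen to contradict the cone condition for the multidegree with
    \<open>\<delta> = N a b j\<close> and \<open>\<mu> = N (g j - 1)\<close>. There
    \<open>\<rho> = N a b\<close> is independent of \<open>j\<close>, and the condition would give
    \<open>g j - 1 \<le> C a b\<close>.\<close>
  define j where "j = nat (C * int a * int b + 2)"
  have j: "int j = C * int a * int b + 2" using C0 by (simp add: j_def)
  have j2: "int j \<ge> 2" using C0 unfolding j by simp
  have gj: "int j \<le> g * int j" using g mult_right_mono[of 1 g "int j"] by simp
  obtain m where m: "m \<in> M" "\<delta> m = int N * (int a * int b * int j)" "\<mu> m = int N * (g * int j - 1)"
    using N(2)[of "int a * int b * int j" "g * int j - 1"] unfolding M_def \<delta>_def \<mu>_def by auto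
  have mm: "\<mu> m \<ge> 0" unfolding m(3) using gj j2 by (intro mult_nonneg_nonneg) simp_all
  \<comment> \<open>Interpolation works for every multiplicity strictly below \<open>g s\<close>,
    here with \<open>s = N j\<close>; this is why \<open>g j\<close> is lowered by one in
    \<open>\<mu>\<close>.\<close>
  have "int (nat (\<mu> m)) < g * int (N * j)" using mm N(1) unfolding m(3) by (simp add: algebra_simps)
  then obtain F :: "'k poly3" where F: "F \<noteq> 0" "hom (a * b * (N * j)) F" "mult_one F \<ge> nat (\<mu> m)" "eval3 F 0 1 0 = 1"
    by (rule exists_curve[OF t w])
  define h where "h = Fract F 1 / s m"
  have s0: "s m \<noteq> 0" unfolding s_def by (rule divisor_eq_nonzero[OF keys])
  then have hs: "h * s m = Fract F 1" by (simp add: h_def)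
  have "h \<in> sections Bl (frag_comb Ds m)" unfolding sections_Bl_iff[OF keys] s_def[symmetric] \<mu>_def[symmetric] \<delta>_def[symmetric]
    using F hs m(2) mm by (intro disjI2 exI[of _ F] exI[of _ "a * b * (N * j)"]) (simp add: ac_simps)
  then have "\<mu> m \<le> C * \<rho> m" by (rule cone[OF m(1)]) (simp add: hs F)
  moreover have "\<rho> m = int N * (int a * int b)" unfolding \<rho>_def m(2,3) by (simp add: algebra_simps)
  ultimately have "int N * (g * int j - 1) \<le> int N * (C * int a * int b)" unfolding m(3) by (simp add: ac_simps)
  then have "g * int j - 1 \<le> C * int a * int b" using N(1) by simp
  then show False using gj j by linarith
qed

end

theorem theorem1p5:
  fixes a b c e f g n :: nat
    and V :: "'k::{alg_closed_field, field_char_0} poly3 fract model"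
  assumes pos: "a > 0" "b > 0" "c > 0" "e > 0" "f > 0" "g > 0"
    and gcd_abc: "gcd a (gcd b c) = 1"
    and gcd_efg: "gcd e (gcd f g) = 1"
    and relation: "int a * int e + int b * int f - int c * int g = 0"
    and w_less_1: "real (g\<^sup>2 * c) / real (a * b) < 1"
    and n_def: "n = card {\<delta>::int. \<delta> \<le> 0 \<and>
          int b + \<delta> * int e \<ge> 0 \<and> int a - \<delta> * int f \<ge> 0 \<and>
          int g dvd int b + \<delta> * int e \<and> int g dvd int a - \<delta> * int f}"
    and exactly_n: "card {\<gamma>::int. \<gamma> \<ge> 0 \<and>
          (int n - 1) * int b + \<gamma> * int e \<ge> 0 \<and> (int n - 1) * int a - \<gamma> * int f \<ge> 0 \<and>
          int g dvd (int n - 1) * int b + \<gamma> * int e \<and>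
          int g dvd (int n - 1) * int a - \<gamma> * int f} = n"
    and not_cong: "\<not> (g dvd n * b \<and> g dvd n * a)"
    and V_def: "V = blowup (weighted_proj_plane a b c) (wpp_point a b c 1 1 1)"
  shows "\<not> has_fg_cox_ring scalars V"
proof -
  interpret weighted_plane_char_0 a b c "TYPE('k)"
    by unfold_locales (use pos gcd_abc in auto)
  have data: "relation_data (int a) (int b) (int c) (int e) (int f) (int g)"
  proof
    show "gcd (int a) (gcd (int b) (int c)) = 1" "gcd (int e) (gcd (int f) (int g)) = 1"
      using gcd_abc gcd_efg by (simp_all only: gcd_int_int_eq of_nat_1)
  qed (use pos relation in auto)
  have "real (g\<^sup>2 * c) < real (a * b)" using w_less_1 pos by (simp add: field_simps)
  then have "g\<^sup>2 * c < a * b" by (simp only: of_nat_less_iff)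
  then have "int (g * g * c) < int (a * b)" by (simp only: of_nat_less_iff power2_eq_square)
  then have w: "int g * int g * int c < int a * int b" by simp
  have nc: "\<not> (int g dvd int n * int b \<and> int g dvd int n * int a)"
    using not_cong by (simp only: of_nat_mult[symmetric] of_nat_dvd_iff) simp
  show ?thesis unfolding V_def Bl_def[symmetric]
    by (rule not_finitely_generated[OF data n_def exactly_n nc w])
qed

end
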